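(* Let $s>\frac{11}{40}$, $s'>\frac38$ and $b>\frac38$. Then there is a constant $C$, independent of $\tau$, such that for all sequences $(u_n)_{n\in\mathbb{Z}},(u_{1,n})_{n\in\mathbb{Z}},(u_{2,n})_{n\in\mathbb{Z}},(u_{3,n})_{n\in\mathbb{Z}}$ of functions on $\mathbb{T}^2$ for which the right-hand sides below are finite, and for every choice $v_{j,n}=u_{j,n}$ (for all $n$) or $v_{j,n}=\overline{u_{j,n}}$ (for all $n$), $j=1,2,3$, $$\|\Pi_\tau u_n\|_{l^4_\tau L^4}\le C\,\|u_n\|_{X_\tau^{s',b}},$$ $$\|\Pi_\tau(\Pi_\tau v_{1,n}\,\Pi_\tau v_{2,n}\,\Pi_\tau v_{3,n})\|_{X_\tau^{s-1,-b}}\le C\,\|u_{1,n}\|_{X_\tau^{s,b}}\|u_{2,n}\|_{X_\tau^{s,b}}\|u_{3,n}\|_{X_\tau^{s,b}},$$ $$\|\Pi_\tau(\Pi_\tau v_{1,n}\,\Pi_\tau v_{2,n}\,\Pi_\tau v_{3,n})\|_{X_\tau^{-\frac{29}{40},-b}}\le C\,\|u_{1,n}\|_{X_\tau^{\frac{11}{40},b}}\|u_{2,n}\|_{X_\tau^{s,b}}\|u_{3,n}\|_{X_\tau^{s,b}}.$$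
   Context: $\tau\in(0,1]$ is the time step; $\mathbb{T}^2=(\mathbb{R}/2\pi\mathbb{Z})^2$; $\langle y\rangle=(1+|y|^2)^{1/2}$. $\Pi_\tau$ is the Fourier multiplier on $\mathbb{T}^2$ with symbol $\chi(\tau k)$, $k\in\mathbb{Z}^2$, where $\chi$ is the characteristic function of $[-1,1)^2$. For a sequence $(u_n)_{n\in\mathbb{Z}}$ with values in a Banach space $Y$, $\|u_n\|_{l^p_\tau Y}=\big(\tau\sum_n\|u_n\|_Y^p\big)^{1/p}$. Discrete Bourgain space: for a sequence $(u_n)_{n\in\mathbb{Z}}$ of functions on $\mathbb{T}^2$ set $\widetilde{u_n}(\sigma,k)=\tau\sum_{m\in\mathbb{Z}}\widehat{u_m}(k)e^{-im\tau\sigma}$ with $\widehat{u_m}(k)=\int_{\mathbb{T}^2}u_m(x)e^{-ik\cdot x}dx$; this is $2\pi/\tau$-periodic in $\sigma$. With $d_\tau(\sigma)=\frac{e^{i\tau\sigma}-1}{\tau}$, $$\|u_n\|_{X_\tau^{s,b}}=\big\|\langle k\rangle^s\langle d_\tau(\sigma+\langle k\rangle)\rangle^b\,\widetilde{u_n}(\sigma,k)\big\|_{L^2_\sigma l^2_k([-\pi/\tau,\pi/\tau)\times\mathbb{Z}^2)} .$$ *)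

theory Defs
  imports "HOL-Analysis.Analysis"
begin

definition jbracket :: "'a::real_normed_vector \<Rightarrow> real" where
  "jbracket y = sqrt (1 + (norm y)\<^sup>2)"

text \<open>Powers of \<open>[0,\<infinity>]\<close>-valued quantities; used only for exponents \<open>a > 0\<close>.\<close>

definition ennpowr :: "ennreal \<Rightarrow> real \<Rightarrow> ennreal" where
  "ennpowr x a = (if x = \<infinity> then \<infinity> else ennreal (enn2real x powr a))"

text \<open>Functions on the torus are \<open>2\<pi>\<close>-periodic functions of two real variables, integrated over the
  fundamental domain \<open>[-\<pi>,\<pi>)\<^sup>2\<close>. Integrability is what is needed for the Fourier coefficients to
  make sense.\<close>

definition torus_dom :: "(real \<times> real) set" where
  "torus_dom = {-pi..<pi} \<times> {-pi..<pi}"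

definition torus_fun :: "(real \<times> real \<Rightarrow> complex) \<Rightarrow> bool" where
  "torus_fun f \<longleftrightarrow>
     (\<forall>x. \<forall>i j :: int. f (x + (2 * pi * of_int i, 2 * pi * of_int j)) = f x) \<and>
     set_integrable lebesgue torus_dom f"

definition freq :: "int \<times> int \<Rightarrow> real \<times> real" where
  "freq k = (of_int (fst k), of_int (snd k))"

definition fourier_coeff :: "(real \<times> real \<Rightarrow> complex) \<Rightarrow> int \<times> int \<Rightarrow> complex" where
  "fourier_coeff f k =
     set_lebesgue_integral lebesgue torus_dom (\<lambda>x. f x * exp (- \<i> * of_real (freq k \<bullet> x)))"

text \<open>The Fourier multiplier with symbol \<open>\<chi>(\<tau>k)\<close>, \<open>\<chi>\<close> the characteristic function of \<open>[-1,1)\<^sup>2\<close>.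
  For \<open>\<tau> > 0\<close> the sum has finitely many terms; the factor \<open>(2\<pi>)\<^sup>-\<^sup>2\<close> comes from Fourier inversion for
  the above normalisation of the coefficients.\<close>

definition Pi_tau :: "real \<Rightarrow> (real \<times> real \<Rightarrow> complex) \<Rightarrow> real \<times> real \<Rightarrow> complex" where
  "Pi_tau \<tau> f x =
     (\<Sum>k | \<tau> *\<^sub>R freq k \<in> {-1..<1} \<times> {-1..<1}.
        fourier_coeff f k * exp (\<i> * of_real (freq k \<bullet> x))) / of_real ((2 * pi)\<^sup>2)"

definition Lp_torus :: "real \<Rightarrow> (real \<times> real \<Rightarrow> complex) \<Rightarrow> ennreal" where
  "Lp_torus p f =
     ennpowr (\<integral>\<^sup>+x\<in>torus_dom. ennreal (norm (f x) powr p) \<partial>lebesgue) (1 / p)"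

text \<open>Here \<open>a n\<close> stands for the norm of the \<open>n\<close>-th term of the sequence in the space \<open>Y\<close>.\<close>

definition lp_tau :: "real \<Rightarrow> real \<Rightarrow> (int \<Rightarrow> ennreal) \<Rightarrow> ennreal" where
  "lp_tau \<tau> p a =
     ennpowr (ennreal \<tau> * (\<integral>\<^sup>+n. ennpowr (a n) p \<partial>count_space UNIV)) (1 / p)"

definition d_tau :: "real \<Rightarrow> real \<Rightarrow> complex" where
  "d_tau \<tau> \<sigma> = (exp (\<i> * of_real (\<tau> * \<sigma>)) - 1) / of_real \<tau>"

definition period_cell :: "real \<Rightarrow> real set" where
  "period_cell \<tau> = {-pi / \<tau>..<pi / \<tau>}"

text \<open>\<open>g\<close> represents \<open>\<sigma> \<mapsto> \<tau> \<Sum>\<^sub>m fourier_coeff (u m) k * exp (- \<i> m \<tau> \<sigma>)\<close> on one period. For sequences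
  of finite Bourgain norm the coefficients are in general only square summable in \<open>m\<close>, so that the
  sum over \<open>m\<close> has to be taken in \<open>L\<^sup>2\<close> and not pointwise.\<close>

definition has_time_transform ::
    "real \<Rightarrow> (int \<Rightarrow> real \<times> real \<Rightarrow> complex) \<Rightarrow> int \<times> int \<Rightarrow> (real \<Rightarrow> complex) \<Rightarrow> bool" where
  "has_time_transform \<tau> u k g \<longleftrightarrow>
     g \<in> borel_measurable lborel \<and>
     ((\<lambda>M. \<integral>\<^sup>+\<sigma>\<in>period_cell \<tau>.
          ennreal ((norm (g \<sigma> - of_real \<tau> * (\<Sum>m\<in>M. fourier_coeff (u m) k
                      * exp (- \<i> * of_real (of_int m * \<tau> * \<sigma>)))))\<^sup>2) \<partial>lborel)
        \<longlongrightarrow> 0) (finite_subsets_at_top UNIV)"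

definition time_transform ::
    "real \<Rightarrow> (int \<Rightarrow> real \<times> real \<Rightarrow> complex) \<Rightarrow> int \<times> int \<Rightarrow> real \<Rightarrow> complex" where
  "time_transform \<tau> u k = (SOME g. has_time_transform \<tau> u k g)"

text \<open>For fixed \<open>\<tau>\<close> the weight in \<open>\<sigma>\<close> is bounded above and below by positive constants. Hence, if for
  some \<open>k\<close> the coefficients are not square summable in \<open>m\<close> (the case without transform), the norm
  is infinite for every \<open>b\<close>. Otherwise the transform is unique up to null sets of the period cell,
  so the choice made by \<^const>\<open>time_transform\<close> does not matter.\<close>

definition bourgain_norm ::
    "real \<Rightarrow> real \<Rightarrow> real \<Rightarrow> (int \<Rightarrow> real \<times> real \<Rightarrow> complex) \<Rightarrow> ennreal" where
  "bourgain_norm \<tau> s b u =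
     (if \<forall>k. \<exists>g. has_time_transform \<tau> u k g
      then ennpowr
        (\<integral>\<^sup>+k. (\<integral>\<^sup>+\<sigma>\<in>period_cell \<tau>.
            ennreal ((jbracket (freq k) powr s
                      * jbracket (d_tau \<tau> (\<sigma> + jbracket (freq k))) powr b
                      * norm (time_transform \<tau> u k \<sigma>))\<^sup>2) \<partial>lborel) \<partial>count_space UNIV) (1 / 2)
      else \<infinity>)"

definition conj_seq ::
    "(int \<Rightarrow> real \<times> real \<Rightarrow> complex) \<Rightarrow> int \<Rightarrow> real \<times> real \<Rightarrow> complex" where
  "conj_seq u n x = cnj (u n x)"

definition trilinear ::
    "real \<Rightarrow> (int \<Rightarrow> real \<times> real \<Rightarrow> complex) \<Rightarrow> (int \<Rightarrow> real \<times> real \<Rightarrow> complex)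
      \<Rightarrow> (int \<Rightarrow> real \<times> real \<Rightarrow> complex) \<Rightarrow> int \<Rightarrow> real \<times> real \<Rightarrow> complex" where
  "trilinear \<tau> v1 v2 v3 n =
     Pi_tau \<tau> (\<lambda>x. Pi_tau \<tau> (v1 n) x * Pi_tau \<tau> (v2 n) x * Pi_tau \<tau> (v3 n) x)"

end

theory Submission
  imports Defs
begin

text \<open>
  Both kinds of estimate reduce to one quadrilinear form. The fourth power of the \<open>L\<^sup>4\<close> norm of a
  sequence \<open>u\<close> is \<open>\<tau> \<Sum>\<^sub>n \<integral> V\<^sub>1 V\<^sub>2 V\<^sub>3 V\<^sub>4\<close> with all factors equal to \<open>u\<close> or its conjugate. By duality, the
  trilinear bounds are bounds for the same form, where the fourth factor is a test sequence in the space
  with exponents \<open>1 - s\<close> (or \<open>29/40\<close>) and \<open>b\<close>.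

  The form is estimated by splitting the four factors into two pairs and applying Cauchy-Schwarz. This leaves
  \<open>L\<^sup>2\<close> norms of products of two factors. These do not see complex conjugation, so in both factors
  the modulation may be measured from the same characteristic surface \<open>\<sigma> = - \<langle>k\<rangle>\<close>. On the
  Fourier side (lemma \<open>bilinear_estimate\<close>) such a norm is controlled by the supremum over \<open>\<sigma>\<close> and
  \<open>l\<close> of
  \<open>\<Sum>\<^sub>k \<integral> \<langle>d(\<sigma> - s + \<langle>l - k\<rangle>)\<rangle> powr (-2b) * \<langle>d(s + \<langle>k\<rangle>)\<rangle> powr (-2b) ds\<close>.
  As \<open>b > 3/8\<close>, the integral in \<open>s\<close> is bounded by a power of \<open>\<langle>d(\<sigma> + \<langle>k\<rangle> + \<langle>l - k\<rangle>)\<rangle>\<close> with exponent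
  below \<open>-1/2\<close>. It remains to count lattice points near an ellipse
  (lemma \<open>lattice_sum_near_ellipse\<close>): along the row of height \<open>y\<close> in the ball \<open>\<langle>k\<rangle> \<le> R\<close> the phase
  \<open>\<langle>k\<rangle> + \<langle>l - k\<rangle>\<close> is convex with second derivative at least \<open>\<langle>y\<rangle>\<^sup>2 / R\<^sup>3\<close>, so that the row contributes
  at most a multiple of \<open>R powr (3/2) / \<langle>y\<rangle>\<close>. Summing over rows costs only a factor \<open>R powr \<epsilon>\<close>. Hence the \<open>L\<^sup>2\<close>
  norm of a product, one factor of which has frequencies at most \<open>R\<close>, costs slightly more than
  \<open>R powr (3/4)\<close>.

  The constants are uniform in \<open>\<tau>\<close> although \<open>\<sigma>\<close> is only defined modulo \<open>2\<pi>/\<tau>\<close>: after the cutoff,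
  \<open>\<langle>k\<rangle> + \<langle>l - k\<rangle>\<close> varies over an interval no longer than one period, so that the weight \<open>d\<close> is
  comparable to the distance from at most two translates.

  Finally the factors are decomposed dyadically (lemma \<open>quadrilinear_estimate\<close>). With frequency sizes
  \<open>N\<^sub>1, \<dots>, N\<^sub>4\<close>, choosing the pairing that separates the two largest bounds the form by slightly more
  than the product of the two smallest sizes to the power \<open>3/4\<close>. The Sobolev weights beat this, with room to sum
  over all dyadic sizes, once the four exponents add up to more than \<open>3/2\<close> and any three of them to more than
  \<open>3/4\<close>. This holds for four exponents above \<open>3/8\<close>, and for \<open>11/40\<close> taken three times together with
  \<open>29/40\<close>. For larger \<open>s\<close> the test sequence has the smaller exponent \<open>1 - s\<close>, and one uses that the
  form vanishes unless \<open>N\<^sub>4\<close> is at most comparable to the largest of the other sizes.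
\<close>

section \<open>Japanese brackets of lattice frequencies\<close>

lemma jbracket_ge_1: "1 \<le> jbracket y"
  by (simp add: jbracket_def)

lemma jbracket_pos: "0 < jbracket y"
  using jbracket_ge_1[of y] by linarith

lemma norm_le_jbracket: "norm y \<le> jbracket y"
  unfolding jbracket_def by (rule real_le_rsqrt) simp

lemma jbracket_ge_half: "(1 + norm y) / 2 \<le> jbracket y"
  using jbracket_ge_1[of y] norm_le_jbracket[of y] by simp

lemma jbracket_minus [simp]: "jbracket (- y) = jbracket y"
  by (simp add: jbracket_def)

lemma jbracket_le_add:
  assumes "norm x \<le> norm y + norm z"
  shows "jbracket x \<le> jbracket y + jbracket z"
proof -
  have "(norm x)\<^sup>2 \<le> (norm y + norm z)\<^sup>2"
    using assms by (intro power_mono) auto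
  moreover have "norm y * norm z \<le> jbracket y * jbracket z"
    by (intro mult_mono norm_le_jbracket) (use jbracket_pos[of y] in auto)
  moreover have "(jbracket y)\<^sup>2 = 1 + (norm y)\<^sup>2" "(jbracket z)\<^sup>2 = 1 + (norm z)\<^sup>2"
    by (simp_all add: jbracket_def)
  ultimately have "1 + (norm x)\<^sup>2 \<le> (jbracket y + jbracket z)\<^sup>2"
    by (simp add: power2_sum)
  then show ?thesis
    unfolding jbracket_def[of x] using jbracket_pos[of y] jbracket_pos[of z]
    by (intro real_le_lsqrt) auto
qed

lemma freq_add: "freq (k + l) = freq k + freq l"
  by (simp add: freq_def)

lemma freq_minus: "freq (- k) = - freq k"
  by (simp add: freq_def)

abbreviation kbr :: "int \<times> int \<Rightarrow> real" where
  "kbr k \<equiv> jbracket (freq k)"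

lemma jbracket_freq: "kbr (x, y) = sqrt (1 + (of_int x)\<^sup>2 + (of_int y)\<^sup>2)"
  by (simp add: jbracket_def freq_def norm_Pair)

section \<open>Lattice sums along level sets of a sum of two brackets\<close>

lemma powr_minus_scale:
  fixes x c q :: real
  assumes "x \<ge> 0" "c > 0"
  shows "(x / c) powr - q = c powr q * x powr - q"
proof -
  have "(x / c) powr - q = x powr - q / c powr - q"
    using assms by (simp add: powr_divide)
  also have "\<dots> = c powr q * x powr - q"
    by (simp add: powr_minus[of c] divide_inverse)
  finally show ?thesis .
qed

text \<open>A discrete form of the integral of \<open>(1 + r t) powr -q\<close>: by the mean value theorem each summand after the first is at most
  a difference of consecutive values of the antiderivative.\<close>
lemma powr_telescope:
  fixes r q :: real
  assumes r: "r > 0" and q: "q > 1"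
  shows "(\<Sum>m\<le>N. (1 + r * real m) powr - q) \<le> 1 + (1 - (1 + r * real N) powr (1 - q)) / (r * (q - 1))"
proof (induction N)
  case 0
  then show ?case by simp
next
  case (Suc N)
  define x where "x = 1 + r * real N"
  have x: "x > 0" using r by (simp add: x_def add_pos_nonneg)
  have xr: "1 + r * real (Suc N) = x + r" by (simp add: x_def algebra_simps)
  have "\<exists>z. x < z \<and> z < x + r \<and>
      (x + r) powr (1 - q) - x powr (1 - q) = (x + r - x) * ((1 - q) * z powr (1 - q - 1))"
  proof (rule MVT2)
    show "x < x + r" using r by simp
    fix t assume "x \<le> t" "t \<le> x + r"
    then show "((\<lambda>t. t powr (1 - q)) has_real_derivative (1 - q) * t powr (1 - q - 1)) (at t)"
      using x by (auto intro!: derivative_eq_intros has_real_derivative_powr)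
  qed
  then obtain z where z: "x < z" "z < x + r"
    and e: "(x + r) powr (1 - q) - x powr (1 - q) = r * ((1 - q) * z powr - q)" by auto
  have "(x + r) powr - q \<le> z powr - q"
    using z x q by (intro powr_mono2') auto
  also have "z powr - q = (x powr (1 - q) - (x + r) powr (1 - q)) / (r * (q - 1))"
    using e r q by (simp add: field_simps)
  finally have "(x + r) powr - q \<le> (x powr (1 - q) - (x + r) powr (1 - q)) / (r * (q - 1))" .
  then have "(\<Sum>m\<le>Suc N. (1 + r * real m) powr - q)
     \<le> 1 + (1 - x powr (1 - q)) / (r * (q - 1)) + (x powr (1 - q) - (x + r) powr (1 - q)) / (r * (q - 1))"
    using Suc by (simp add: x_def algebra_simps)
  also have "\<dots> = 1 + (1 - (x + r) powr (1 - q)) / (r * (q - 1))"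
    by (simp add: diff_divide_distrib)
  finally show ?case unfolding xr .
qed

lemma sum_inverse_powr_int:
  fixes S :: "int set" and r q :: real
  assumes r: "r > 0" and q: "q > 1" and "finite S"
  shows "(\<Sum>x\<in>S. (1 + r * \<bar>of_int (x - z)\<bar>) powr - q) \<le> 2 * (1 + 1 / (r * (q - 1)))"
proof -
  obtain N :: nat where N: "\<And>x. x \<in> S \<Longrightarrow> nat \<bar>x - z\<bar> \<le> N"
    using finite_imageI[OF \<open>finite S\<close>, of "\<lambda>x. nat \<bar>x - z\<bar>"]
    by (meson finite_nat_set_iff_bounded_le imageI)
  define F where "F m = (1 + r * real m) powr - q" for m :: nat
  have "S \<subseteq> (\<lambda>m. z + int m) ` {..N} \<union> (\<lambda>m. z - int m) ` {..N}"
  proof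
    fix x assume x: "x \<in> S"
    show "x \<in> (\<lambda>m. z + int m) ` {..N} \<union> (\<lambda>m. z - int m) ` {..N}"
    proof (cases "z \<le> x")
      case True
      then have "x = z + int (nat \<bar>x - z\<bar>)" by simp
      then show ?thesis using N[OF x] by blast
    next
      case False
      then have "x = z - int (nat \<bar>x - z\<bar>)" by simp
      then show ?thesis using N[OF x] by blast
    qed
  qed
  then have "(\<Sum>x\<in>S. (1 + r * \<bar>of_int (x - z)\<bar>) powr - q)
     \<le> (\<Sum>x\<in>(\<lambda>m. z + int m) ` {..N} \<union> (\<lambda>m. z - int m) ` {..N}. (1 + r * \<bar>of_int (x - z)\<bar>) powr - q)"
    by (intro sum_mono2) auto
  also have "\<dots> \<le> (\<Sum>x\<in>(\<lambda>m. z + int m) ` {..N}. (1 + r * \<bar>of_int (x - z)\<bar>) powr - q)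
      + (\<Sum>x\<in>(\<lambda>m. z - int m) ` {..N}. (1 + r * \<bar>of_int (x - z)\<bar>) powr - q)"
    by (subst sum_Un) (auto intro!: sum_nonneg)
  also have "\<dots> = 2 * (\<Sum>m\<le>N. F m)"
    by (subst sum.reindex, simp add: inj_on_def)+ (simp add: F_def)
  also have "(\<Sum>m\<le>N. F m) \<le> 1 + (1 - (1 + r * real N) powr (1 - q)) / (r * (q - 1))"
    unfolding F_def by (rule powr_telescope[OF r q])
  also have "\<dots> \<le> 1 + 1 / (r * (q - 1))"
    using r q by (simp add: divide_right_mono)
  finally show ?thesis by simp
qed

text \<open>If \<open>z\<close> is a point of \<open>S\<close> whose value is closest to the level \<open>c\<close>, the separation hypothesis
  gives \<open>\<mu> (x - z)\<^sup>2 \<le> 2 \<bar>\<psi> x - c\<bar>\<close> for every other \<open>x\<close>. So the sum is dominated by a sum of powers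
  of \<open>1 + sqrt \<mu> \<bar>x - z\<bar>\<close> with exponent \<open>-2p < -1\<close>.\<close>
lemma sum_separated_levels:
  fixes S :: "int set" and \<psi> :: "int \<Rightarrow> real"
  assumes p: "p > 1 / 2" and \<mu>: "0 < \<mu>" "\<mu> \<le> 1" and "finite S"
    and sep: "\<And>x z. x \<in> S \<Longrightarrow> z \<in> S \<Longrightarrow> \<mu> * (of_int (x - z))\<^sup>2 \<le> \<bar>\<psi> x - \<psi> z\<bar>"
  shows "(\<Sum>x\<in>S. (1 + \<bar>\<psi> x - c\<bar>) powr - p) \<le> 2 powr p * (4 + 4 / (2 * p - 1)) / sqrt \<mu>"
proof (cases "S = {}")
  case False
  define z where "z = arg_min_on (\<lambda>x. \<bar>\<psi> x - c\<bar>) S"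
  have z: "z \<in> S" and zmin: "\<And>x. x \<in> S \<Longrightarrow> \<bar>\<psi> z - c\<bar> \<le> \<bar>\<psi> x - c\<bar>"
    using arg_min_if_finite[OF \<open>finite S\<close> False, of "\<lambda>x. \<bar>\<psi> x - c\<bar>"]
    by (auto simp: z_def not_less)
  define r where "r = sqrt (\<mu> / 2)"
  have r: "r > 0" "r\<^sup>2 = \<mu> / 2" using \<mu> by (auto simp: r_def)
  have term_le: "(1 + \<bar>\<psi> x - c\<bar>) powr - p \<le> 2 powr p * (1 + r * \<bar>of_int (x - z)\<bar>) powr - (2 * p)"
    if x: "x \<in> S" for x
  proof -
    define m :: real where "m = \<bar>of_int (x - z)\<bar>"
    have m0: "m \<ge> 0" by (simp add: m_def)
    have "\<mu> * m\<^sup>2 \<le> \<bar>\<psi> x - \<psi> z\<bar>" using sep[OF x z] by (simp add: m_def)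
    also have "\<dots> \<le> 2 * \<bar>\<psi> x - c\<bar>" using zmin[OF x] by argo
    finally have *: "(r * m)\<^sup>2 \<le> \<bar>\<psi> x - c\<bar>" by (simp add: power_mult_distrib r(2))
    have "(1 + r * m)\<^sup>2 / 2 \<le> 1 + (r * m)\<^sup>2"
      using zero_le_power2[of "1 - r * m"] by (simp add: power2_eq_square algebra_simps)
    also have "\<dots> \<le> 1 + \<bar>\<psi> x - c\<bar>" using * by simp
    finally have le: "(1 + r * m)\<^sup>2 / 2 \<le> 1 + \<bar>\<psi> x - c\<bar>" .
    have pos: "1 + r * m > 0" using r m0 by (simp add: add_pos_nonneg)
    have "(1 + \<bar>\<psi> x - c\<bar>) powr - p \<le> ((1 + r * m)\<^sup>2 / 2) powr - p"
      using le pos p by (intro powr_mono2') auto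
    also have "\<dots> = 2 powr p * (1 + r * m) powr - (2 * p)"
    proof -
      have "((1 + r * m)\<^sup>2) powr - p = (1 + r * m) powr - (2 * p)"
        using pos by (simp add: powr_powr flip: powr_numeral)
      then show ?thesis using pos by (simp add: powr_divide powr_minus divide_simps)
    qed
    finally show ?thesis by (simp add: m_def)
  qed
  have "(\<Sum>x\<in>S. (1 + \<bar>\<psi> x - c\<bar>) powr - p)
      \<le> (\<Sum>x\<in>S. 2 powr p * (1 + r * \<bar>of_int (x - z)\<bar>) powr - (2 * p))"
    by (intro sum_mono term_le)
  also have "\<dots> = 2 powr p * (\<Sum>x\<in>S. (1 + r * \<bar>of_int (x - z)\<bar>) powr - (2 * p))"
    by (simp add: sum_distrib_left)
  also have "\<dots> \<le> 2 powr p * (2 * (1 + 1 / (r * (2 * p - 1))))"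
    using sum_inverse_powr_int[OF r(1), of "2 * p" S z] p \<open>finite S\<close> by (intro mult_left_mono) auto
  also have "\<dots> \<le> 2 powr p * ((4 + 4 / (2 * p - 1)) / sqrt \<mu>)"
  proof (intro mult_left_mono)
    have s: "0 < sqrt \<mu>" "sqrt \<mu> \<le> 1" using \<mu> by auto
    have sr: "sqrt \<mu> = sqrt 2 * r" by (simp add: r_def real_sqrt_divide)
    have s2: "sqrt 2 \<le> (2::real)" by (rule real_le_lsqrt) auto
    have "2 * r \<ge> sqrt \<mu>" unfolding sr using s2 r by (intro mult_right_mono) auto
    then have "1 / r \<le> 2 / sqrt \<mu>" using frac_le[of 2 2 "sqrt \<mu>" "2 * r"] s(1) by simp
    then have "1 / r * (1 / (2 * p - 1)) \<le> 2 / sqrt \<mu> * (1 / (2 * p - 1))"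
      using p by (intro mult_right_mono) auto
    moreover have "1 \<le> 1 / sqrt \<mu>" using s by simp
    ultimately show "2 * (1 + 1 / (r * (2 * p - 1))) \<le> (4 + 4 / (2 * p - 1)) / sqrt \<mu>"
      by (simp add: add_divide_distrib field_simps)
  qed auto
  finally show ?thesis by simp
qed (use p \<mu> in \<open>auto intro!: divide_nonneg_pos mult_nonneg_nonneg add_nonneg_nonneg\<close>)

text \<open>Quantitative convexity of one bracket along a row. The right-hand side is \<open>N / f z\<close> with
  \<open>N = f x * f z - (a\<^sup>2 + x z)\<close>, and multiplying \<open>N\<close> by its conjugate \<open>f x * f z + (a\<^sup>2 + x z)\<close> gives
  exactly \<open>a\<^sup>2 (x - z)\<^sup>2\<close>.\<close>
lemma sqrt_convex_gap:
  fixes a x z :: real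
  assumes a: "a > 0"
  defines "f \<equiv> \<lambda>t. sqrt (a\<^sup>2 + t\<^sup>2)"
  shows "a\<^sup>2 * (x - z)\<^sup>2 / (2 * f x * (f z)\<^sup>2) \<le> f x - f z - z / f z * (x - z)"
proof -
  have f0: "f t > 0" for t using a by (simp add: f_def add_pos_nonneg)
  have f2: "(f t)\<^sup>2 = a\<^sup>2 + t\<^sup>2" for t by (simp add: f_def)
  define N where "N = f x * f z - a\<^sup>2 - x * z"
  have eq: "f x - f z - z / f z * (x - z) = N / f z"
    using f0[of z] f2[of z] by (simp add: N_def field_simps power2_eq_square)
  have id: "(f x * f z)\<^sup>2 - (a\<^sup>2 + x * z)\<^sup>2 = a\<^sup>2 * (x - z)\<^sup>2"
    unfolding power_mult_distrib f2 by (simp add: power2_eq_square algebra_simps)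
  have cs: "\<bar>a\<^sup>2 + x * z\<bar> \<le> f x * f z"
  proof (rule power2_le_imp_le)
    show "\<bar>a\<^sup>2 + x * z\<bar>\<^sup>2 \<le> (f x * f z)\<^sup>2" 
      using id zero_le_power2[of "a * (x - z)"] by (simp only: power2_abs power_mult_distrib)
  qed (use f0[of x] f0[of z] in auto)
  have "a\<^sup>2 * (x - z)\<^sup>2 = N * (f x * f z + (a\<^sup>2 + x * z))"
    unfolding id[symmetric] N_def by (simp add: power2_eq_square algebra_simps)
  also have "\<dots> \<le> N * (2 * (f x * f z))"
    using cs by (intro mult_left_mono) (auto simp: N_def)
  also have "N * (2 * (f x * f z)) = N / f z * (2 * f x * (f z)\<^sup>2)"
    using f0[of z] by (simp add: power2_eq_square)
  finally show ?thesis
    unfolding eq using f0[of x] f0[of z] by (simp add: pos_divide_le_eq)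
qed

text \<open>The geometric core: the level sets of the phase are ellipses, and a thin neighbourhood
  of such an ellipse contains few lattice points of the ball of radius \<open>R\<close>, uniformly in \<open>l\<close>. On each row the
  phase is convex, with a quadratic gap contributed by the bracket centred at \<open>0\<close> alone.\<close>
lemma lattice_sum_near_ellipse:
  fixes p \<epsilon> :: real
  assumes p: "p > 1 / 2" and \<epsilon>: "\<epsilon> > 0"
  obtains C where "C > 0"
    and "\<And>R K l c. \<lbrakk>R \<ge> 1; finite K; \<And>k. k \<in> K \<Longrightarrow> kbr k \<le> R\<rbrakk> \<Longrightarrow>
      (\<Sum>k\<in>K. (1 + \<bar>kbr k + kbr (l - k) - c\<bar>) powr - p) \<le> C * R powr (3 / 2 + \<epsilon>)"
proof -
  define D where "D = 2 powr p * (4 + 4 / (2 * p - 1))"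
  have D: "D > 0" using p by (auto simp: D_def intro!: mult_pos_pos add_pos_pos)
  define H where "H = 2 * (1 + 1 / \<epsilon>)"
  have H: "H > 0" using \<epsilon> by (auto simp: H_def intro!: add_pos_pos)
  define C where "C = 4 * D * (2 powr (1 + \<epsilon>) * H)"
  show ?thesis
  proof
    show "C > 0" using D H by (simp add: C_def)
    fix R :: real and K :: "(int \<times> int) set" and l c
    assume R: "R \<ge> 1" and fin: "finite K" and KR: "\<And>k. k \<in> K \<Longrightarrow> kbr k \<le> R"
    define \<psi> where "\<psi> y x = kbr (x, y) + kbr ((l - (x, y)))" for x y
    define a where "a y = sqrt (1 + (of_int y)\<^sup>2)" for y :: int
    define S where "S y = {x. (x, y) \<in> K}" for y
    have finS: "finite (S y)" for y
    proof -
      have "S y \<subseteq> fst ` K" by (force simp: S_def)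
      then show ?thesis using fin finite_subset by blast
    qed
    have a1: "a y \<ge> 1" for y by (simp add: a_def)
    have row: "(\<Sum>x\<in>S y. (1 + \<bar>\<psi> y x - c\<bar>) powr - p) \<le> 4 * D * (R powr (3 / 2) / a y)"
      if y: "y \<in> snd ` K" for y
    proof -
      define e where "e = sqrt (1 + (of_int (snd l - y))\<^sup>2)"
      have e0: "e > 0" by (simp add: e_def add_pos_nonneg)
      define f where "f t = sqrt ((a y)\<^sup>2 + t\<^sup>2)" for t
      define g where "g t = sqrt (e\<^sup>2 + t\<^sup>2)" for t
      define s where "s z = of_int z / f (of_int z) + (of_int z - of_int (fst l)) / g (of_int z - of_int (fst l))" for z :: int
      have \<psi>_eq: "\<psi> y x = f (of_int x) + g (of_int x - of_int (fst l))" for x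
        unfolding \<psi>_def f_def g_def a_def e_def
        by (cases l) (simp add: jbracket_freq power2_commute algebra_simps)
      have fx: "f (of_int x) = kbr (x, y)" for x
        by (simp add: f_def a_def jbracket_freq algebra_simps)
      have fR: "f (of_int x) \<le> R" "f (of_int x) \<ge> 1" if "x \<in> S y" for x
        using that KR jbracket_ge_1 by (auto simp: fx S_def)
      obtain x0 where "(x0, y) \<in> K" using y by auto
      then have "f (of_int x0) \<le> R" using KR by (simp add: fx)
      moreover have "a y \<le> f (of_int x0)" using a1[of y] by (simp add: f_def real_le_rsqrt)
      ultimately have aR: "a y \<le> R" by simp
      define \<mu> where "\<mu> = (a y)\<^sup>2 / (2 * R ^ 3)"
      have \<mu>0: "\<mu> > 0" using a1[of y] R by (simp add: \<mu>_def)
      have "(a y)\<^sup>2 \<le> R\<^sup>2" using aR a1[of y] by (intro power_mono) auto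
      also have "\<dots> \<le> 2 * R ^ 3" using R by (simp add: power2_eq_square power3_eq_cube mult_le_cancel_right1)
      finally have \<mu>1: "\<mu> \<le> 1" using R by (simp add: \<mu>_def)
      have gap: "\<mu> * (of_int (x - z))\<^sup>2 \<le> \<psi> y x - \<psi> y z - s z * of_int (x - z)"
        if xz: "x \<in> S y" "z \<in> S y" for x z
      proof -
        have "f (of_int x) * (f (of_int z))\<^sup>2 \<le> R * R\<^sup>2"
          using fR[OF xz(1)] fR[OF xz(2)] R by (intro mult_mono power_mono) auto
        then have "2 * f (of_int x) * (f (of_int z))\<^sup>2 \<le> 2 * R ^ 3"
          by (simp add: power2_eq_square power3_eq_cube)
        then have "\<mu> * (of_int (x - z))\<^sup>2 \<le> (a y)\<^sup>2 * (of_int x - of_int z)\<^sup>2 / (2 * f (of_int x) * (f (of_int z))\<^sup>2)"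
          unfolding \<mu>_def using fR[OF xz(1)] fR[OF xz(2)] R
          by (simp add: divide_left_mono)
        also have "\<dots> \<le> f (of_int x) - f (of_int z) - of_int z / f (of_int z) * (of_int x - of_int z)"
          unfolding f_def using a1[of y] by (intro sqrt_convex_gap) auto
        finally have 1: "\<mu> * (of_int (x - z))\<^sup>2 \<le> f (of_int x) - f (of_int z) - of_int z / f (of_int z) * (of_int x - of_int z)" .
        define x' z' where "x' = real_of_int x - of_int (fst l)" and "z' = real_of_int z - of_int (fst l)"
        have "0 \<le> e\<^sup>2 * (x' - z')\<^sup>2 / (2 * g x' * (g z')\<^sup>2)"
          by (simp add: g_def)
        also have "\<dots> \<le> g x' - g z' - z' / g z' * (x' - z')"
          unfolding g_def using e0 by (intro sqrt_convex_gap)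
        finally have 2: "0 \<le> g x' - g z' - z' / g z' * (x' - z')" .
        from 1 2 show ?thesis unfolding \<psi>_eq s_def x'_def z'_def by (simp add: algebra_simps)
      qed
      \<comment> \<open>To the right of the minimum of the phase (nonnegative slope) and to its left, two points are
        separated by the convexity gap, since then the linear term has a favourable sign.\<close>
      define S1 S2 where "S1 = {x \<in> S y. s x \<ge> 0}" and "S2 = {x \<in> S y. s x < 0}"
      have bound: "(\<Sum>x\<in>S'. (1 + \<bar>\<psi> y x - c\<bar>) powr - p) \<le> D / sqrt \<mu>"
        if S': "S' = S1 \<or> S' = S2" for S'
      proof -
        have "\<mu> * (of_int (x - z))\<^sup>2 \<le> \<bar>\<psi> y x - \<psi> y z\<bar>" if "x \<in> S'" "z \<in> S'" for x z
        proof -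
          have *: "\<mu> * (of_int (x - z))\<^sup>2 \<le> \<bar>\<psi> y x - \<psi> y z\<bar>"
            if "x \<in> S y" "z \<in> S y" "s z * of_int (x - z) \<ge> 0" for x z
            using gap[OF that(1,2)] that(3) by linarith
          have "s z * of_int (x - z) \<ge> 0 \<or> s x * of_int (z - x) \<ge> 0"
            using S' that by (auto simp: S1_def S2_def zero_le_mult_iff)
          moreover have "x \<in> S y" "z \<in> S y" using S' that by (auto simp: S1_def S2_def)
          ultimately show ?thesis using *[of x z] *[of z x]
            by (auto simp: power2_commute abs_minus_commute)
        qed
        moreover have "finite S'" using S' finS[of y] by (auto simp: S1_def S2_def)
        ultimately show ?thesis
          using sum_separated_levels[OF p \<mu>0 \<mu>1, of S' "\<psi> y" c] by (simp add: D_def)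
      qed
      have "(\<Sum>x\<in>S y. (1 + \<bar>\<psi> y x - c\<bar>) powr - p)
          = (\<Sum>x\<in>S1. (1 + \<bar>\<psi> y x - c\<bar>) powr - p) + (\<Sum>x\<in>S2. (1 + \<bar>\<psi> y x - c\<bar>) powr - p)"
        using finS[of y] by (subst sum.union_disjoint[symmetric])
          (auto simp: S1_def S2_def intro!: sum.cong)
      also have "\<dots> \<le> 2 * D / sqrt \<mu>" using bound[of S1] bound[of S2] by simp
      also have "sqrt \<mu> = a y / (sqrt 2 * R powr (3 / 2))"
      proof -
        have "R powr (3 / 2) = sqrt (R ^ 3)"
          using R by (simp add: powr_half_sqrt[symmetric] powr_powr flip: powr_numeral)
        then show ?thesis using a1[of y] by (simp add: \<mu>_def real_sqrt_divide real_sqrt_mult)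
      qed
      also have "2 * D / (a y / (sqrt 2 * R powr (3 / 2))) = sqrt 2 * (2 * D * (R powr (3 / 2) / a y))"
        by simp
      also have "\<dots> \<le> 2 * (2 * D * (R powr (3 / 2) / a y))"
      proof (intro mult_right_mono)
        show "sqrt 2 \<le> (2::real)" by (rule real_le_lsqrt) auto
        show "0 \<le> 2 * D * (R powr (3 / 2) / a y)" using D a1[of y] by simp
      qed
      finally show ?thesis by simp
    qed
    \<comment> \<open>Sacrificing \<open>R powr \<epsilon>\<close> makes the harmonic sum over the rows converge.\<close>
    have inv_a: "1 / a y \<le> R powr \<epsilon> * (2 powr (1 + \<epsilon>) * (1 + 1 * \<bar>of_int (y - 0)\<bar>) powr - (1 + \<epsilon>))"
      if y: "y \<in> snd ` K" for y
    proof -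
      obtain x0 where "(x0, y) \<in> K" using y by auto
      then have "kbr (x0, y) \<le> R" using KR by simp
      moreover have "a y \<le> kbr (x0, y)" by (simp add: jbracket_freq a_def)
      ultimately have aR: "a y \<le> R" by simp
      have ah: "(1 + \<bar>of_int y\<bar>) / 2 \<le> a y"
        using jbracket_ge_half[of "of_int y :: real"] by (simp add: jbracket_def a_def)
      have a0: "a y > 0" using a1[of y] by linarith
      have "1 / a y = a y powr \<epsilon> * a y powr - (1 + \<epsilon>)"
        using a0 by (simp add: powr_minus_divide flip: powr_add)
      also have "\<dots> \<le> R powr \<epsilon> * ((1 + \<bar>of_int y\<bar>) / 2) powr - (1 + \<epsilon>)"
        using aR ah a0 \<epsilon> by (intro mult_mono powr_mono2 powr_mono2') auto
      also have "((1 + \<bar>of_int y\<bar>) / 2) powr - (1 + \<epsilon>) = 2 powr (1 + \<epsilon>) * (1 + 1 * \<bar>of_int (y - 0)\<bar>) powr - (1 + \<epsilon>)"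
        using powr_minus_scale[of "1 + \<bar>of_int y\<bar>" 2 "1 + \<epsilon>"] by simp
      finally show ?thesis .
    qed
    have "(\<Sum>k\<in>K. (1 + \<bar>kbr k + kbr (l - k) - c\<bar>) powr - p)
        = (\<Sum>y\<in>snd ` K. \<Sum>k\<in>{k \<in> K. snd k = y}. (1 + \<bar>kbr k + kbr (l - k) - c\<bar>) powr - p)"
      by (rule sum.image_gen[OF fin])
    also have "\<dots> = (\<Sum>y\<in>snd ` K. \<Sum>x\<in>S y. (1 + \<bar>\<psi> y x - c\<bar>) powr - p)"
    proof (rule sum.cong[OF refl])
      fix y
      show "(\<Sum>k\<in>{k \<in> K. snd k = y}. (1 + \<bar>kbr k + kbr (l - k) - c\<bar>) powr - p)
        = (\<Sum>x\<in>S y. (1 + \<bar>\<psi> y x - c\<bar>) powr - p)"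
        by (rule sum.reindex_bij_witness[of _ "\<lambda>x. (x, y)" fst]) (auto simp: S_def \<psi>_def)
    qed
    also have "\<dots> \<le> (\<Sum>y\<in>snd ` K. 4 * D * (R powr (3 / 2) / a y))"
      by (intro sum_mono row)
    also have "\<dots> = 4 * D * R powr (3 / 2) * (\<Sum>y\<in>snd ` K. 1 / a y)"
      by (simp add: sum_distrib_left)
    also have "\<dots> \<le> 4 * D * R powr (3 / 2) *
        (\<Sum>y\<in>snd ` K. R powr \<epsilon> * (2 powr (1 + \<epsilon>) * (1 + 1 * \<bar>of_int (y - 0)\<bar>) powr - (1 + \<epsilon>)))"
      using D by (intro mult_left_mono sum_mono inv_a) auto
    also have "\<dots> = 4 * D * R powr (3 / 2) * (R powr \<epsilon> * (2 powr (1 + \<epsilon>)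
        * (\<Sum>y\<in>snd ` K. (1 + 1 * \<bar>of_int (y - 0)\<bar>) powr - (1 + \<epsilon>))))"
      by (simp only: sum_distrib_left)
    also have "\<dots> \<le> 4 * D * R powr (3 / 2) * (R powr \<epsilon> * (2 powr (1 + \<epsilon>) * H))"
      using D sum_inverse_powr_int[of 1 "1 + \<epsilon>" "snd ` K" 0] \<epsilon> fin
      by (intro mult_left_mono) (auto simp: H_def)
    also have "\<dots> = C * R powr (3 / 2 + \<epsilon>)"
      using R by (simp add: C_def powr_add)
    finally show "(\<Sum>k\<in>K. (1 + \<bar>kbr k + kbr (l - k) - c\<bar>) powr - p)
        \<le> C * R powr (3 / 2 + \<epsilon>)" .
  qed
qed

section \<open>The modulation weight\<close>

lemma sin_ge_half:
  fixes t :: real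
  assumes "0 \<le> t" "t \<le> pi / 2"
  shows "t / 2 \<le> sin t"
proof -
  define u where "u = t / 2"
  have u: "0 \<le> u" "u \<le> pi / 4" using assms by (auto simp: u_def)
  have "sin 0 - 0 * cos 0 \<le> sin u - u * cos u"
  proof (rule DERIV_nonneg_imp_nondecreasing[OF u(1)])
    fix x assume x: "0 \<le> x" "x \<le> u"
    have "((\<lambda>x. sin x - x * cos x) has_real_derivative x * sin x) (at x)"
      by (auto intro!: derivative_eq_intros)
    moreover have "0 \<le> sin x" using x u pi_gt_zero by (intro sin_ge_zero) auto
    ultimately show "\<exists>y. ((\<lambda>x. sin x - x * cos x) has_real_derivative y) (at x) \<and> 0 \<le> y"
      using x by (intro exI[of _ "x * sin x"]) auto
  qed
  then have 1: "u * cos u \<le> sin u" by simp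
  have t: "t = 2 * u" by (simp add: u_def)
  have c: "cos t \<ge> 0" using assms by (intro cos_ge_zero) auto
  have cu: "cos u \<ge> 0" using u pi_gt_zero by (intro cos_ge_zero) auto
  have "u \<le> u * (1 + cos t)" using u c by (simp add: mult_le_cancel_left1)
  also have "\<dots> = 2 * (u * cos u) * cos u"
    unfolding t cos_double_cos by (simp add: power2_eq_square algebra_simps)
  also have "\<dots> \<le> 2 * sin u * cos u" using 1 cu by (intro mult_right_mono) auto
  also have "\<dots> = sin t" by (simp add: t sin_double)
  finally show ?thesis by (simp add: u_def)
qed

lemma abs_sin_ge_half:
  assumes "\<bar>t\<bar> \<le> pi / 2"
  shows "\<bar>t\<bar> / 2 \<le> \<bar>sin t\<bar>"
  using sin_ge_half[of "\<bar>t\<bar>"] assms by (cases "t \<ge> 0") auto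

lemma norm_d_tau:
  assumes "\<tau> > 0"
  shows "norm (d_tau \<tau> s) = 2 * \<bar>sin (\<tau> * s / 2)\<bar> / \<tau>"
proof -
  have "norm (exp (\<i> * of_real (\<tau> * s)) - 1) = 2 * \<bar>sin (\<tau> * s / 2)\<bar>"
    by (rule dist_exp_i_1)
  then show ?thesis using assms unfolding d_tau_def norm_divide by simp
qed

lemma norm_d_tau_minus: "\<tau> > 0 \<Longrightarrow> norm (d_tau \<tau> (- s)) = norm (d_tau \<tau> s)"
  by (simp add: norm_d_tau)

lemma jbracket_d_tau_minus: "\<tau> > 0 \<Longrightarrow> jbracket (d_tau \<tau> (- s)) = jbracket (d_tau \<tau> s)"
  by (simp add: jbracket_def norm_d_tau_minus)

lemma norm_d_tau_add_le:
  assumes "\<tau> > 0"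
  shows "norm (d_tau \<tau> (x + y)) \<le> norm (d_tau \<tau> x) + norm (d_tau \<tau> y)"
proof -
  define a b where "a = exp (\<i> * of_real (\<tau> * x))" and "b = exp (\<i> * of_real (\<tau> * y))"
  have na: "norm a = 1" unfolding a_def by (rule norm_exp_i_times)
  have ab: "exp (\<i> * of_real (\<tau> * (x + y))) = a * b"
    by (simp add: a_def b_def exp_add[symmetric] algebra_simps)
  have "norm (a * b - 1) \<le> norm (a * (b - 1)) + norm (a - 1)"
    by (rule order_trans[OF _ norm_triangle_ineq]) (simp add: algebra_simps)
  then have "norm (a * b - 1) \<le> norm (a - 1) + norm (b - 1)"
    by (simp add: norm_mult na)
  then have "norm (a * b - 1) / \<tau> \<le> (norm (a - 1) + norm (b - 1)) / \<tau>"
    using assms by (intro divide_right_mono) auto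
  then show ?thesis
    unfolding d_tau_def ab norm_divide using assms by (simp add: a_def b_def add_divide_distrib)
qed

text \<open>\<open>\<bar>d\<^sub>\<tau>(s)\<bar>\<close> is a chord of a circle of radius \<open>1/\<tau>\<close>, hence comparable to the distance
  of \<open>s\<close> from the nearest multiple of the period.\<close>
lemma d_tau_lower_bound:
  fixes s :: real
  assumes \<tau>: "\<tau> > 0"
  shows "\<bar>s - of_int (round (s * \<tau> / (2 * pi))) * (2 * pi / \<tau>)\<bar> / 2 \<le> norm (d_tau \<tau> s)"
proof -
  define j where "j = round (s * \<tau> / (2 * pi))"
  define t where "t = \<tau> * s / 2 - of_int j * pi"
  have "\<bar>of_int j - s * \<tau> / (2 * pi)\<bar> \<le> 1 / 2" unfolding j_def by (rule of_int_round_abs_le)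
  then have "\<bar>of_int j - s * \<tau> / (2 * pi)\<bar> * pi \<le> 1 / 2 * pi" by (intro mult_right_mono) auto
  also have "\<bar>of_int j - s * \<tau> / (2 * pi)\<bar> * pi = \<bar>(of_int j - s * \<tau> / (2 * pi)) * pi\<bar>"
    by (simp add: abs_mult)
  also have "(of_int j - s * \<tau> / (2 * pi)) * pi = - t" by (simp add: t_def field_simps)
  finally have "\<bar>t\<bar> \<le> pi / 2" by simp
  then have "\<bar>t\<bar> / 2 \<le> \<bar>sin t\<bar>" by (rule abs_sin_ge_half)
  also have "\<bar>sin t\<bar> = \<bar>sin (\<tau> * s / 2)\<bar>"
  proof -
    have "sin (of_int j * pi) = 0" by (simp add: sin_zero_iff_int2)
    moreover have "\<bar>cos (of_int j * pi)\<bar> = 1" using calculation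
      by (metis abs_sin_le_one add.right_neutral power2_eq_1_iff abs_1 abs_minus_cancel power_zero_numeral add_0 sin_cos_squared_add)
    ultimately show ?thesis by (simp add: t_def sin_diff abs_mult)
  qed
  finally have "\<bar>t\<bar> / 2 \<le> \<bar>sin (\<tau> * s / 2)\<bar>" .
  then have "2 * (\<bar>t\<bar> / 2) / \<tau> \<le> 2 * \<bar>sin (\<tau> * s / 2)\<bar> / \<tau>"
    using \<tau> by (intro divide_right_mono) auto
  also have "\<dots> = norm (d_tau \<tau> s)" using \<tau> by (simp add: norm_d_tau)
  also have "2 * (\<bar>t\<bar> / 2) / \<tau> = \<bar>t * 2 / \<tau>\<bar> / 2" using \<tau> by (simp add: abs_mult)
  also have "t * 2 / \<tau> = s - of_int j * (2 * pi / \<tau>)" using \<tau> by (simp add: t_def field_simps)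
  finally show ?thesis by (simp add: j_def)
qed

text \<open>On a window of one period the nearest multiple of the period is one of two fixed numbers. This removes
  the periodicity at the price of two translates.\<close>
lemma d_tau_window:
  fixes A \<tau> :: real
  assumes \<tau>: "\<tau> > 0" and q: "q > 0"
  obtains c1 c2 where "\<And>s. A \<le> s \<Longrightarrow> s \<le> A + 2 * pi / \<tau> \<Longrightarrow>
    jbracket (d_tau \<tau> s) powr - q \<le> 4 powr q * ((1 + \<bar>s - c1\<bar>) powr - q + (1 + \<bar>s - c2\<bar>) powr - q)"
proof
  define c where "c j = of_int j * (2 * pi / \<tau>)" for j :: int
  define j0 where "j0 = round (A * \<tau> / (2 * pi))"
  fix s assume s: "A \<le> s" "s \<le> A + 2 * pi / \<tau>"
  define j where "j = round (s * \<tau> / (2 * pi))"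
  have "A * \<tau> / (2 * pi) \<le> s * \<tau> / (2 * pi)"
    using s \<tau> by (intro divide_right_mono mult_right_mono) auto
  then have j1: "j0 \<le> j" unfolding j0_def j_def by (rule round_mono)
  have "s * \<tau> / (2 * pi) \<le> (A + 2 * pi / \<tau>) * \<tau> / (2 * pi)"
    using s \<tau> by (intro divide_right_mono mult_right_mono) auto
  also have "\<dots> = A * \<tau> / (2 * pi) + of_int 1" using \<tau> by (simp add: field_simps)
  finally have "j \<le> round (A * \<tau> / (2 * pi) + of_int 1)" unfolding j_def by (rule round_mono)
  also have "\<dots> = j0 + 1" 
    unfolding j0_def round_def using floor_add_int[of "A * \<tau> / (2 * pi) + 1 / 2" 1]
    by (simp add: algebra_simps)
  finally have j: "j = j0 \<or> j = j0 + 1" using j1 by auto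
  have "\<bar>s - c j\<bar> / 2 \<le> norm (d_tau \<tau> s)"
    unfolding c_def j_def by (rule d_tau_lower_bound[OF \<tau>])
  then have "(1 + \<bar>s - c j\<bar>) / 4 \<le> jbracket (d_tau \<tau> s)"
    using jbracket_ge_half[of "d_tau \<tau> s"] by simp
  then have "jbracket (d_tau \<tau> s) powr - q \<le> ((1 + \<bar>s - c j\<bar>) / 4) powr - q"
    using q by (intro powr_mono2') auto
  also have "\<dots> = 4 powr q * (1 + \<bar>s - c j\<bar>) powr - q"
    by (intro powr_minus_scale) auto
  also have "\<dots> \<le> 4 powr q * ((1 + \<bar>s - c j0\<bar>) powr - q + (1 + \<bar>s - c (j0 + 1)\<bar>) powr - q)"
    using j by (intro mult_left_mono) auto
  finally show "jbracket (d_tau \<tau> s) powr - q \<le> 4 powr q * ((1 + \<bar>s - c j0\<bar>) powr - q + (1 + \<bar>s - c (j0 + 1)\<bar>) powr - q)" .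
qed

lemma jbracket_measurable [measurable]: "(jbracket :: complex \<Rightarrow> real) \<in> borel_measurable borel"
  unfolding jbracket_def by measurable

lemma d_tau_measurable [measurable]: "d_tau \<tau> \<in> borel_measurable borel"
  unfolding d_tau_def by measurable

lemma nn_integral_powr_line:
  fixes q c :: real
  assumes q: "q > 1"
  shows "(\<integral>\<^sup>+s. ennreal ((1 + \<bar>s - c\<bar>) powr - q) \<partial>lborel) \<le> ennreal (2 / (q - 1))"
proof -
  define f where "f s = (1 + \<bar>s\<bar>) powr - q" for s :: real
  have [measurable]: "f \<in> borel_measurable borel" unfolding f_def by measurable
  have half: "(\<integral>\<^sup>+s. ennreal (f s) * indicator {0..} s \<partial>lborel) = ennreal (1 / (q - 1))"
  proof -
    have "(\<integral>\<^sup>+s. ennreal (f s) * indicator {0..} s \<partial>lborel) = 0 - (- ((1 + 0) powr (1 - q)) / (q - 1))"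
    proof (rule nn_integral_FTC_atLeast[where F = "\<lambda>s. - ((1 + s) powr (1 - q)) / (q - 1)"])
      fix x :: real assume "0 \<le> x"
      then show "((\<lambda>s. - ((1 + s) powr (1 - q)) / (q - 1)) has_real_derivative f x) (at x)"
      proof -
        have "f x = - ((1 - q) * (1 + x) powr - q) / (q - 1)"
          using q \<open>0 \<le> x\<close> by (simp add: f_def divide_simps) (simp add: algebra_simps)
        then show ?thesis using q \<open>0 \<le> x\<close> by (auto intro!: derivative_eq_intros)
      qed
    next
      have "((\<lambda>s. (1 + s) powr (1 - q)) \<longlongrightarrow> 0) at_top"
        using q by (intro tendsto_neg_powr filterlim_tendsto_add_at_top[OF tendsto_const] filterlim_ident) auto
      from tendsto_divide[OF tendsto_minus[OF this] tendsto_const, of "q - 1"] q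
      show "((\<lambda>s. - ((1 + s) powr (1 - q)) / (q - 1)) \<longlongrightarrow> 0) at_top" by simp
    qed (auto simp: f_def)
    then show ?thesis by simp
  qed
  have half': "(\<integral>\<^sup>+s. ennreal (f s) * indicator {..0} s \<partial>lborel) = ennreal (1 / (q - 1))"
  proof -
    have "(\<integral>\<^sup>+s. ennreal (f s) * indicator {..0} s \<partial>lborel)
        = (\<integral>\<^sup>+s. ennreal (f (0 + (-1) * s)) * indicator {..0} (0 + (-1) * s) \<partial>lborel)"
      by (subst nn_integral_real_affine[where c = "-1" and t = 0]) auto
    also have "\<dots> = (\<integral>\<^sup>+s. ennreal (f s) * indicator {0..} s \<partial>lborel)"
      by (intro nn_integral_cong) (auto simp: f_def indicator_def)
    finally show ?thesis using half by simp
  qed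
  have "(\<integral>\<^sup>+s. ennreal ((1 + \<bar>s - c\<bar>) powr - q) \<partial>lborel) = (\<integral>\<^sup>+s. ennreal (f (- c + 1 * s)) \<partial>lborel)"
    by (intro nn_integral_cong) (simp add: f_def algebra_simps)
  also have "\<dots> = (\<integral>\<^sup>+s. ennreal (f s) \<partial>lborel)"
    by (subst (2) nn_integral_real_affine[where c = 1 and t = "- c"]) auto
  also have "\<dots> \<le> (\<integral>\<^sup>+s. ennreal (f s) * indicator {0..} s + ennreal (f s) * indicator {..0} s \<partial>lborel)"
    by (intro nn_integral_mono) (auto simp: indicator_def)
  also have "\<dots> = ennreal (1 / (q - 1)) + ennreal (1 / (q - 1))"
    by (subst nn_integral_add) (auto simp: half half')
  also have "\<dots> = ennreal (2 / (q - 1))"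
    using q by (subst ennreal_plus[symmetric]) auto
  finally show ?thesis .
qed

lemma period_cell_integral_bound:
  fixes \<tau> q \<theta> :: real
  assumes \<tau>: "\<tau> > 0" and q: "q > 1"
  shows "(\<integral>\<^sup>+s\<in>period_cell \<tau>. ennreal (jbracket (d_tau \<tau> (s + \<theta>)) powr - q) \<partial>lborel)
      \<le> ennreal (4 powr q * (4 / (q - 1)))"
proof -
  obtain c1 c2 where c: "\<And>s. \<theta> - pi / \<tau> \<le> s \<Longrightarrow> s \<le> \<theta> - pi / \<tau> + 2 * pi / \<tau> \<Longrightarrow>
    jbracket (d_tau \<tau> s) powr - q \<le> 4 powr q * ((1 + \<bar>s - c1\<bar>) powr - q + (1 + \<bar>s - c2\<bar>) powr - q)"
    using d_tau_window[OF \<tau>, of q "\<theta> - pi / \<tau>"] q by auto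
  have "(\<integral>\<^sup>+s\<in>period_cell \<tau>. ennreal (jbracket (d_tau \<tau> (s + \<theta>)) powr - q) \<partial>lborel)
     \<le> (\<integral>\<^sup>+s. ennreal (4 powr q) * (ennreal ((1 + \<bar>s - (c1 - \<theta>)\<bar>) powr - q)
            + ennreal ((1 + \<bar>s - (c2 - \<theta>)\<bar>) powr - q)) \<partial>lborel)"
  proof (rule nn_integral_mono)
    fix s
    show "ennreal (jbracket (d_tau \<tau> (s + \<theta>)) powr - q) * indicator (period_cell \<tau>) s
       \<le> ennreal (4 powr q) * (ennreal ((1 + \<bar>s - (c1 - \<theta>)\<bar>) powr - q)
            + ennreal ((1 + \<bar>s - (c2 - \<theta>)\<bar>) powr - q))"
    proof (cases "s \<in> period_cell \<tau>")
      case True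
      then have "\<theta> - pi / \<tau> \<le> s + \<theta>" "s + \<theta> \<le> \<theta> - pi / \<tau> + 2 * pi / \<tau>"
        by (auto simp: period_cell_def)
      from c[OF this] show ?thesis
        using True by (simp add: ennreal_plus[symmetric] ennreal_mult[symmetric] algebra_simps del: ennreal_plus)
    qed simp
  qed
  also have "\<dots> = ennreal (4 powr q) * ((\<integral>\<^sup>+s. ennreal ((1 + \<bar>s - (c1 - \<theta>)\<bar>) powr - q) \<partial>lborel)
            + (\<integral>\<^sup>+s. ennreal ((1 + \<bar>s - (c2 - \<theta>)\<bar>) powr - q) \<partial>lborel))"
    by (simp add: nn_integral_cmult nn_integral_add)
  also have "\<dots> \<le> ennreal (4 powr q) * (ennreal (2 / (q - 1)) + ennreal (2 / (q - 1)))"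
    by (intro mult_left_mono add_mono nn_integral_powr_line q) auto
  also have "\<dots> = ennreal (4 powr q * (4 / (q - 1)))"
    using q by (simp add: ennreal_plus[symmetric] ennreal_mult[symmetric] del: ennreal_plus)
  finally show ?thesis .
qed

text \<open>The closed box, which contains the support of the symbol of \<open>\<Pi>\<^sub>\<tau>\<close> and is symmetric under
  \<open>k \<mapsto> -k\<close>; so it also contains the frequencies of conjugates.\<close>
definition freq_box :: "real \<Rightarrow> (int \<times> int) set" where
  "freq_box \<tau> = {k. \<tau> * \<bar>of_int (fst k)\<bar> \<le> 1 \<and> \<tau> * \<bar>of_int (snd k)\<bar> \<le> 1}"

text \<open>The point of the frequency cutoff: a sum of two brackets stays within one period \<open>2\<pi>/\<tau>\<close>.\<close>
lemma jbracket_freq_box: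
  assumes \<tau>: "0 < \<tau>" "\<tau> \<le> 1" and k: "k \<in> freq_box \<tau>"
  shows "kbr k \<le> pi / \<tau>"
proof -
  have sq: "(\<tau> * of_int x)\<^sup>2 \<le> 1" if "\<tau> * \<bar>of_int x\<bar> \<le> 1" for x :: int
    using power_mono[OF that, of 2] \<tau> by (simp add: power_mult_distrib)
  have "\<tau>\<^sup>2 \<le> 1" using \<tau> by (simp add: power_le_one)
  moreover have "(\<tau> * of_int (fst k))\<^sup>2 \<le> 1" "(\<tau> * of_int (snd k))\<^sup>2 \<le> 1"
    using k by (auto simp: freq_box_def intro!: sq)
  moreover have "(kbr k)\<^sup>2 = 1 + (of_int (fst k))\<^sup>2 + (of_int (snd k))\<^sup>2"
    using jbracket_freq[of "fst k" "snd k"] by simp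
  ultimately have "(\<tau> * kbr k)\<^sup>2 \<le> 3"
    by (simp add: power_mult_distrib algebra_simps)
  also have "\<dots> \<le> 3\<^sup>2" by simp
  also have "\<dots> \<le> pi\<^sup>2" using pi_gt3 by (intro power_mono) auto
  finally have "\<tau> * kbr k \<le> pi" by (rule power2_le_imp_le) simp
  then show ?thesis using \<tau> by (simp add: field_simps)
qed

text \<open>The larger of \<open>x\<close> and \<open>y\<close> is at least \<open>D/2\<close>. Of the total power \<open>4b = p + q\<close>, the larger one is charged
  with the power \<open>p\<close> and the smaller one with \<open>q\<close>. For \<open>b > 3/8\<close> one has \<open>p > 1/2\<close>, which
  is what the lattice sum needs, and \<open>q > 1\<close>, which makes the integral over the modulation converge.\<close>
lemma powr_product_le:
  fixes b D x y :: real
  assumes b: "b > 3 / 8" and D: "1 \<le> D" "D \<le> x + y" and x: "1 \<le> x" and y: "1 \<le> y"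
  defines "p \<equiv> 2 * b - 1 / 4" and "q \<equiv> 2 * b + 1 / 4"
  shows "x powr - (2 * b) * y powr - (2 * b) \<le> 2 powr p * D powr - p * (x powr - q + y powr - q)"
proof -
  have p: "p > 0" using b by (simp add: p_def)
  have *: "x powr - (2 * b) * y powr - (2 * b) \<le> 2 powr p * D powr - p * y powr - q"
    if "y \<le> x" "1 \<le> y" "D \<le> x + y" for x y :: real
  proof -
    have "x powr - (2 * b) * y powr - (2 * b) = x powr - p * (x powr - (1 / 4) * y powr - (2 * b))"
      by (simp add: p_def powr_add[symmetric])
    also have "\<dots> \<le> (D / 2) powr - p * (y powr - (1 / 4) * y powr - (2 * b))"
      using that D(1) p b by (intro mult_mono powr_mono2') auto
    also have "(D / 2) powr - p = 2 powr p * D powr - p"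
      using D(1) by (intro powr_minus_scale) auto
    also have "y powr - (1 / 4) * y powr - (2 * b) = y powr - q"
      unfolding powr_add[symmetric] q_def by (rule arg_cong[where f = "(powr) y"]) simp
    finally show ?thesis by simp
  qed
  show ?thesis
  proof (cases "y \<le> x")
    case True
    have "2 powr p * D powr - p * y powr - q \<le> 2 powr p * D powr - p * (x powr - q + y powr - q)"
      by (intro mult_left_mono) auto
    then show ?thesis by (rule order_trans[OF *[OF True y D(2)]])
  next
    case False
    have "2 powr p * D powr - p * x powr - q \<le> 2 powr p * D powr - p * (x powr - q + y powr - q)"
      by (intro mult_left_mono) auto
    then show ?thesis using *[of x y] False x D(2) by (simp add: mult.commute add.commute)
  qed
qed

abbreviation modulation :: "real \<Rightarrow> int \<times> int \<Rightarrow> real \<Rightarrow> real" where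
  "modulation \<tau> k s \<equiv> jbracket (d_tau \<tau> (s + kbr k))"

text \<open>The kernel of the bilinear estimate. The two modulations at \<open>\<sigma> - s\<close> and \<open>s\<close> add up to the phase
  \<open>\<sigma> + \<langle>k\<rangle> + \<langle>l - k\<rangle>\<close>, which does not depend on \<open>s\<close>; after the integration in \<open>s\<close> only the
  lattice sum remains.\<close>
lemma modulation_kernel_bound:
  fixes b \<epsilon> :: real
  assumes b: "b > 3 / 8" and \<epsilon>: "\<epsilon> > 0"
  obtains C where "C > 0"
    and "\<And>\<tau> R K l \<sigma>. \<lbrakk>0 < \<tau>; \<tau> \<le> 1; R \<ge> 1; finite K; K \<subseteq> freq_box \<tau>; (\<lambda>k. l - k) ` K \<subseteq> freq_box \<tau>;
        \<And>k. k \<in> K \<Longrightarrow> kbr k \<le> R\<rbrakk> \<Longrightarrow>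
      (\<Sum>k\<in>K. \<integral>\<^sup>+s\<in>period_cell \<tau>. ennreal (modulation \<tau> (l - k) (\<sigma> - s) powr - (2 * b)
          * modulation \<tau> k s powr - (2 * b)) \<partial>lborel) \<le> ennreal (C * R powr (3 / 2 + \<epsilon>))"
proof -
  define p q where "p = 2 * b - 1 / 4" and "q = 2 * b + 1 / 4"
  have p: "p > 1 / 2" and q: "q > 1" using b by (auto simp: p_def q_def)
  show ?thesis
  proof (cases rule: lattice_sum_near_ellipse[OF p \<epsilon>])
  case (1 C0)
    note C0 = 1(1) and lat = 1(2)
    define I where "I = 4 powr q * (4 / (q - 1))"
    have I: "I > 0" using q by (simp add: I_def)
    define C where "C = 2 powr p * (2 * I) * (4 powr p * (2 * C0))"
    show ?thesis
    proof
      show "C > 0" using I C0 by (simp add: C_def)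
      fix \<tau> R :: real and K l \<sigma>
      assume \<tau>: "0 < \<tau>" "\<tau> \<le> 1" and R: "R \<ge> 1" and fin: "finite K" and K: "K \<subseteq> freq_box \<tau>"
        and lK: "(\<lambda>k. l - k) ` K \<subseteq> freq_box \<tau>" and KR: "\<And>k. k \<in> K \<Longrightarrow> kbr k \<le> R"
      define A where "A k = \<sigma> + (kbr k + kbr (l - k))" for k
      obtain c1 c2 where c: "\<And>s. \<sigma> \<le> s \<Longrightarrow> s \<le> \<sigma> + 2 * pi / \<tau> \<Longrightarrow>
        jbracket (d_tau \<tau> s) powr - p \<le> 4 powr p * ((1 + \<bar>s - c1\<bar>) powr - p + (1 + \<bar>s - c2\<bar>) powr - p)"
        using d_tau_window[OF \<tau>(1), of p \<sigma>] p by auto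
      have sumA: "(\<Sum>k\<in>K. jbracket (d_tau \<tau> (A k)) powr - p) \<le> 4 powr p * (2 * C0) * R powr (3 / 2 + \<epsilon>)"
      proof -
        have "(\<Sum>k\<in>K. jbracket (d_tau \<tau> (A k)) powr - p)
           \<le> (\<Sum>k\<in>K. 4 powr p * ((1 + \<bar>A k - c1\<bar>) powr - p + (1 + \<bar>A k - c2\<bar>) powr - p))"
        proof (intro sum_mono c)
          fix k assume k: "k \<in> K"
          show "\<sigma> \<le> A k" using jbracket_pos[of "freq k"] jbracket_pos[of "freq (l - k)"] by (simp add: A_def)
          have "kbr k \<le> pi / \<tau>" "kbr (l - k) \<le> pi / \<tau>"
            using k K lK by (auto intro!: jbracket_freq_box \<tau>)
          then show "A k \<le> \<sigma> + 2 * pi / \<tau>" by (simp add: A_def)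
        qed
        also have "\<dots> = 4 powr p * ((\<Sum>k\<in>K. (1 + \<bar>kbr k + kbr (l - k) - (c1 - \<sigma>)\<bar>) powr - p)
            + (\<Sum>k\<in>K. (1 + \<bar>kbr k + kbr (l - k) - (c2 - \<sigma>)\<bar>) powr - p))"
          by (simp add: sum_distrib_left sum.distrib A_def algebra_simps)
        also have "\<dots> \<le> 4 powr p * (C0 * R powr (3 / 2 + \<epsilon>) + C0 * R powr (3 / 2 + \<epsilon>))"
          by (intro mult_left_mono add_mono lat R fin KR) auto
        finally show ?thesis by (simp add: algebra_simps)
      qed
      have each: "(\<integral>\<^sup>+s\<in>period_cell \<tau>. ennreal (modulation \<tau> (l - k) (\<sigma> - s) powr - (2 * b)
            * modulation \<tau> k s powr - (2 * b)) \<partial>lborel)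
         \<le> ennreal (2 powr p * (2 * I) * jbracket (d_tau \<tau> (A k)) powr - p)" for k
      proof -
        define \<theta>1 \<theta>2 where "\<theta>1 = \<sigma> + kbr (l - k)" and "\<theta>2 = kbr k"
        have refl: "jbracket (d_tau \<tau> (\<theta>1 - s)) = jbracket (d_tau \<tau> (s + - \<theta>1))" for s
          using jbracket_d_tau_minus[OF \<tau>(1), of "\<theta>1 - s"] by simp
        have "(\<integral>\<^sup>+s\<in>period_cell \<tau>. ennreal (modulation \<tau> (l - k) (\<sigma> - s) powr - (2 * b)
            * modulation \<tau> k s powr - (2 * b)) \<partial>lborel)
          \<le> (\<integral>\<^sup>+s. ennreal (2 powr p * jbracket (d_tau \<tau> (A k)) powr - p)
              * (ennreal (jbracket (d_tau \<tau> (s + - \<theta>1)) powr - q) * indicator (period_cell \<tau>) s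
                + ennreal (jbracket (d_tau \<tau> (s + \<theta>2)) powr - q) * indicator (period_cell \<tau>) s) \<partial>lborel)"
        proof (rule nn_integral_mono)
          fix s
          have th: "\<sigma> - s + kbr (l - k) = \<theta>1 - s" by (simp add: \<theta>1_def)
          have "norm (d_tau \<tau> (A k)) \<le> norm (d_tau \<tau> (\<theta>1 - s)) + norm (d_tau \<tau> (s + \<theta>2))"
            using norm_d_tau_add_le[OF \<tau>(1), of "\<theta>1 - s" "s + \<theta>2"]
            by (simp add: A_def \<theta>1_def \<theta>2_def algebra_simps)
          then have "jbracket (d_tau \<tau> (A k)) \<le> jbracket (d_tau \<tau> (\<theta>1 - s)) + jbracket (d_tau \<tau> (s + \<theta>2))"
            by (rule jbracket_le_add)
          from powr_product_le[OF b jbracket_ge_1 this jbracket_ge_1 jbracket_ge_1, folded p_def q_def]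
          show "ennreal (modulation \<tau> (l - k) (\<sigma> - s) powr - (2 * b)
            * modulation \<tau> k s powr - (2 * b)) * indicator (period_cell \<tau>) s
            \<le> ennreal (2 powr p * jbracket (d_tau \<tau> (A k)) powr - p)
              * (ennreal (jbracket (d_tau \<tau> (s + - \<theta>1)) powr - q) * indicator (period_cell \<tau>) s
                + ennreal (jbracket (d_tau \<tau> (s + \<theta>2)) powr - q) * indicator (period_cell \<tau>) s)"
            unfolding th refl \<theta>2_def[symmetric]
            by (cases "s \<in> period_cell \<tau>")
              (auto simp: ennreal_plus[symmetric] ennreal_mult[symmetric] simp del: ennreal_plus intro!: ennreal_leI)
        qed
        also have "\<dots> = ennreal (2 powr p * jbracket (d_tau \<tau> (A k)) powr - p)
              * ((\<integral>\<^sup>+s\<in>period_cell \<tau>. ennreal (jbracket (d_tau \<tau> (s + - \<theta>1)) powr - q) \<partial>lborel)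
                + (\<integral>\<^sup>+s\<in>period_cell \<tau>. ennreal (jbracket (d_tau \<tau> (s + \<theta>2)) powr - q) \<partial>lborel))"
          by (subst nn_integral_cmult, (unfold period_cell_def, measurable)[1])
            (subst nn_integral_add, simp_all add: period_cell_def)
        also have "\<dots> \<le> ennreal (2 powr p * jbracket (d_tau \<tau> (A k)) powr - p) * (ennreal I + ennreal I)"
          unfolding I_def by (intro mult_left_mono add_mono period_cell_integral_bound \<tau> q) auto
        also have "\<dots> = ennreal (2 powr p * (2 * I) * jbracket (d_tau \<tau> (A k)) powr - p)"
          using I by (simp add: ennreal_plus[symmetric] ennreal_mult[symmetric] algebra_simps del: ennreal_plus)
        finally show ?thesis .
      qed
      have "(\<Sum>k\<in>K. \<integral>\<^sup>+s\<in>period_cell \<tau>. ennreal (modulation \<tau> (l - k) (\<sigma> - s) powr - (2 * b)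
            * modulation \<tau> k s powr - (2 * b)) \<partial>lborel)
          \<le> (\<Sum>k\<in>K. ennreal (2 powr p * (2 * I) * jbracket (d_tau \<tau> (A k)) powr - p))"
        by (intro sum_mono each)
      also have "\<dots> = ennreal (2 powr p * (2 * I) * (\<Sum>k\<in>K. jbracket (d_tau \<tau> (A k)) powr - p))"
        using I by (subst sum_ennreal) (auto simp: sum_distrib_left)
      also have "\<dots> \<le> ennreal (2 powr p * (2 * I) * (4 powr p * (2 * C0) * R powr (3 / 2 + \<epsilon>)))"
        using I by (intro ennreal_leI mult_left_mono sumA) auto
      finally show "(\<Sum>k\<in>K. \<integral>\<^sup>+s\<in>period_cell \<tau>. ennreal (modulation \<tau> (l - k) (\<sigma> - s) powr - (2 * b)
            * modulation \<tau> k s powr - (2 * b)) \<partial>lborel) \<le> ennreal (C * R powr (3 / 2 + \<epsilon>))"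
        by (simp add: C_def algebra_simps)
    qed
  qed
qed

section \<open>Fourier series in time\<close>

definition wave :: "real \<Rightarrow> int \<Rightarrow> real \<Rightarrow> complex" where
  "wave \<tau> n s = exp (\<i> * of_real (of_int n * \<tau> * s))"

lemma wave_measurable [measurable]: "wave \<tau> n \<in> borel_measurable borel"
  unfolding wave_def by measurable

lemma wave_0: "wave \<tau> 0 = (\<lambda>s. 1)"
  by (simp add: wave_def fun_eq_iff)

lemma norm_wave [simp]: "norm (wave \<tau> n s) = 1"
  unfolding wave_def by (rule norm_exp_i_times)

lemma wave_add: "wave \<tau> n (s + t) = wave \<tau> n s * wave \<tau> n t"
  by (simp add: wave_def exp_add[symmetric] algebra_simps)

lemma wave_mult: "wave \<tau> n s * wave \<tau> m s = wave \<tau> (n + m) s"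
  by (simp add: wave_def exp_add[symmetric] algebra_simps)

lemma cnj_wave: "cnj (wave \<tau> n s) = wave \<tau> (- n) s"
  by (simp add: wave_def exp_cnj)

abbreviation cell_L2 :: "real set \<Rightarrow> (real \<Rightarrow> complex) \<Rightarrow> ennreal" where
  "cell_L2 P g \<equiv> \<integral>\<^sup>+s\<in>P. ennreal ((norm (g s))\<^sup>2) \<partial>lborel"

lemma period_cell_sets [measurable, simp]: "period_cell \<tau> \<in> sets borel"
  by (simp add: period_cell_def)

lemma emeasure_period_cell: "\<tau> > 0 \<Longrightarrow> emeasure lborel (period_cell \<tau>) = ennreal (2 * pi / \<tau>)"
  by (simp add: period_cell_def)

lemma set_integrable_bounded_period_cell:
  fixes f :: "real \<Rightarrow> complex"
  assumes "\<tau> > 0" and [measurable]: "f \<in> borel_measurable borel" and "\<And>s. norm (f s) \<le> B"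
  shows "set_integrable lborel (period_cell \<tau>) f"
  unfolding set_integrable_def
proof (rule Bochner_Integration.integrable_bound)
  show "integrable lborel (\<lambda>s. B * indicator (period_cell \<tau>) s)"
    using assms(1) by (intro integrable_mult_right integrable_real_indicator)
      (auto simp: emeasure_period_cell)
  show "AE s in lborel. norm (indicator (period_cell \<tau>) s *\<^sub>R f s) \<le> norm (B * indicator (period_cell \<tau>) s)"
    using assms(3) by (auto simp: indicator_def intro!: AE_I2 order_trans[OF assms(3) abs_ge_self])
qed measurable

lemma set_integrable_wave: "\<tau>' > 0 \<Longrightarrow> set_integrable lborel (period_cell \<tau>') (\<lambda>s. c * wave \<tau> n s)"
  by (rule set_integrable_bounded_period_cell[where B = "norm c"]) (auto simp: norm_mult)

text \<open>The integral runs over \<open>j\<close> periods: \<open>j = 1\<close> serves the Fourier coefficients, and \<open>j = 2\<close> the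
  doubled cell that contains the sums of two points of a cell.\<close>
lemma wave_integral:
  fixes j :: nat
  assumes \<tau>: "\<tau> > 0" and j: "j > 0"
  shows "set_lebesgue_integral lborel (period_cell (\<tau> / real j)) (wave \<tau> n)
     = (if n = 0 then of_real (2 * pi * real j / \<tau>) else 0)"
proof -
  define T where "T = pi * real j / \<tau>"
  have T: "T > 0" using \<tau> j by (simp add: T_def)
  have cell: "period_cell (\<tau> / real j) = {- T..<T}" by (simp add: period_cell_def T_def)
  show ?thesis
  proof (cases "n = 0")
    case True
    have "set_lebesgue_integral lborel {- T..<T} (\<lambda>s. 1 :: complex) = of_real (2 * T)"
      using T by (simp add: set_lebesgue_integral_def scaleR_conv_of_real)
    then show ?thesis using True by (simp add: cell wave_0 T_def)
  next
    case False
    define c where "c = of_int n * \<tau>"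
    have c: "c \<noteq> 0" using False \<tau> by (simp add: c_def)
    define F where "F s = exp (\<i> * of_real (c * s)) / (\<i> * of_real c)" for s :: real
    have "(\<integral>s. indicator {- T..T} s *\<^sub>R wave \<tau> n s \<partial>lborel) = F T - F (- T)"
    proof (rule integral_FTC_Icc)
      show "- T \<le> T" using T by simp
      show "continuous_on {- T..T} (wave \<tau> n)" unfolding wave_def by (intro continuous_intros)
      fix s
      have "((\<lambda>z. exp (\<i> * (of_real c * z)) / (\<i> * of_real c)) has_field_derivative
             exp (\<i> * (of_real c * of_real s))) (at (of_real s))"
        using c by (auto intro!: derivative_eq_intros simp: mult_ac)
      from has_vector_derivative_real_field[OF this]
      have "(F has_vector_derivative wave \<tau> n s) (at s)"
        by (simp add: F_def[abs_def] wave_def c_def o_def)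
      then show "(F has_vector_derivative wave \<tau> n s) (at s within {- T..T})"
        by (rule has_vector_derivative_at_within)
    qed
    also have "F T = F (- T)"
    proof -
      have cT: "c * T = of_int (n * int j) * pi" using \<tau> by (simp add: c_def T_def)
      have "sin (c * T) = 0" unfolding cT sin_zero_iff_int2 by blast
      then have "exp (\<i> * of_real (c * T)) = exp (\<i> * of_real (- (c * T)))"
        by (intro complex_eqI) (simp_all add: Re_exp Im_exp)
      then show ?thesis by (simp add: F_def)
    qed
    finally have "(\<integral>s. indicator {- T..T} s *\<^sub>R wave \<tau> n s \<partial>lborel) = 0" by simp
    moreover have "(\<integral>s. indicator {- T..<T} s *\<^sub>R wave \<tau> n s \<partial>lborel) = (\<integral>s. indicator {- T..T} s *\<^sub>R wave \<tau> n s \<partial>lborel)"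
    proof (rule integral_cong_AE)
      show "AE s in lborel. indicator {- T..<T} s *\<^sub>R wave \<tau> n s = indicator {- T..T} s *\<^sub>R wave \<tau> n s"
        using AE_lborel_singleton[of T] by eventually_elim (auto simp: indicator_def)
    qed measurable
    ultimately show ?thesis using False by (simp add: cell set_lebesgue_integral_def)
  qed
qed

lemma nn_integral_norm_power2_wave_sum:
  fixes j :: nat and w :: "int \<Rightarrow> complex"
  assumes \<tau>: "\<tau> > 0" and j: "j > 0" and M: "finite M"
  shows "cell_L2 (period_cell (\<tau> / real j)) (\<lambda>s. \<Sum>n\<in>M. w n * wave \<tau> n s)
     = ennreal (2 * pi * real j / \<tau> * (\<Sum>n\<in>M. (norm (w n))\<^sup>2))"
proof -
  define P where "P = period_cell (\<tau> / real j)"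
  have \<tau>j: "\<tau> / real j > 0" using \<tau> j by simp
  have [measurable]: "P \<in> sets borel" by (simp add: P_def)
  define f where "f s = (\<Sum>n\<in>M. w n * wave \<tau> n s)" for s
  have [measurable]: "f \<in> borel_measurable borel" unfolding f_def by measurable
  have fB: "norm (f s) \<le> (\<Sum>n\<in>M. norm (w n))" for s
    unfolding f_def by (rule order_trans[OF norm_sum]) (simp add: norm_mult)
  have eq: "of_real ((norm (f s))\<^sup>2) = (\<Sum>n\<in>M. \<Sum>m\<in>M. (w n * cnj (w m)) * wave \<tau> (n - m) s)" for s
  proof -
    have "wave \<tau> (n - m) s = wave \<tau> n s * cnj (wave \<tau> m s)" for n m
      by (simp add: cnj_wave wave_mult)
    then show ?thesis
      unfolding complex_norm_square f_def by (simp add: sum_product mult_ac)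
  qed
  have int: "set_integrable lborel P (\<lambda>s. complex_of_real ((norm (f s))\<^sup>2))"
    unfolding P_def
    by (rule set_integrable_bounded_period_cell[OF \<tau>j, where B = "(\<Sum>n\<in>M. norm (w n))\<^sup>2"])
      (auto intro!: power_mono fB simp: norm_power)
  have "set_lebesgue_integral lborel P (\<lambda>s. complex_of_real ((norm (f s))\<^sup>2))
     = (\<Sum>n\<in>M. \<Sum>m\<in>M. set_lebesgue_integral lborel P (\<lambda>s. (w n * cnj (w m)) * wave \<tau> (n - m) s))"
    unfolding eq set_lebesgue_integral_def scaleR_sum_right P_def
    by (subst Bochner_Integration.integral_sum;
        (intro Bochner_Integration.integrable_sum)?, (rule set_integrable_wave[OF \<tau>j, unfolded set_integrable_def])?)
      (intro sum.cong refl Bochner_Integration.integral_sum set_integrable_wave[OF \<tau>j, unfolded set_integrable_def])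
  also have "\<dots> = (\<Sum>n\<in>M. \<Sum>m\<in>M. if n = m then w n * cnj (w m) * of_real (2 * pi * real j / \<tau>) else 0)"
    by (intro sum.cong refl) (auto simp: P_def wave_integral[OF \<tau> j])
  also have "\<dots> = (\<Sum>n\<in>M. of_real (2 * pi * real j / \<tau>) * of_real ((norm (w n))\<^sup>2))"
    unfolding complex_norm_square using M by (simp add: mult.commute)
  also have "\<dots> = complex_of_real (2 * pi * real j / \<tau> * (\<Sum>n\<in>M. (norm (w n))\<^sup>2))"
    by (simp only: sum_distrib_left of_real_sum of_real_mult[of "2 * pi * real j / \<tau>"])
  finally have 1: "set_lebesgue_integral lborel P (\<lambda>s. complex_of_real ((norm (f s))\<^sup>2))
     = complex_of_real (2 * pi * real j / \<tau> * (\<Sum>n\<in>M. (norm (w n))\<^sup>2))" .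
  have int': "set_integrable lborel P (\<lambda>s. (norm (f s))\<^sup>2)"
    using integrable_Re[OF int[unfolded set_integrable_def]] by (simp add: set_integrable_def)
  have "set_lebesgue_integral lborel P (\<lambda>s. complex_of_real ((norm (f s))\<^sup>2))
     = of_real (set_lebesgue_integral lborel P (\<lambda>s. (norm (f s))\<^sup>2))"
    by (rule set_integral_complex_of_real)
  with 1 have 2: "set_lebesgue_integral lborel P (\<lambda>s. (norm (f s))\<^sup>2) = 2 * pi * real j / \<tau> * (\<Sum>n\<in>M. (norm (w n))\<^sup>2)"
    by (metis of_real_eq_iff)
  have "cell_L2 P f = (\<integral>\<^sup>+s. ennreal (indicator P s *\<^sub>R (norm (f s))\<^sup>2) \<partial>lborel)"
    by (intro nn_integral_cong) (simp add: indicator_def)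
  also have "\<dots> = ennreal (set_lebesgue_integral lborel P (\<lambda>s. (norm (f s))\<^sup>2))"
    using int' unfolding set_lebesgue_integral_def set_integrable_def
    by (intro nn_integral_eq_integral) auto
  finally show ?thesis unfolding 2 by (simp add: P_def f_def)
qed

definition time_coeff :: "real \<Rightarrow> (real \<Rightarrow> complex) \<Rightarrow> int \<Rightarrow> complex" where
  "time_coeff \<tau> g n = set_lebesgue_integral lborel (period_cell \<tau>) (\<lambda>s. g s * wave \<tau> n s) / of_real (2 * pi)"

abbreviation modulation_energy :: "real \<Rightarrow> real \<Rightarrow> int \<times> int \<Rightarrow> (real \<Rightarrow> complex) \<Rightarrow> ennreal" where
  "modulation_energy \<tau> b k g \<equiv>
     \<integral>\<^sup>+s\<in>period_cell \<tau>. ennreal (modulation \<tau> k s powr (2 * b) * (norm (g s))\<^sup>2) \<partial>lborel"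

text \<open>The sequence \<open>a\<close> of coefficients at the frequency \<open>k\<close> has modulation energy at most \<open>A\<close>. Recording a
  real bound rather than the energy itself keeps the later sums over frequencies in real arithmetic, and the
  transform \<open>g\<close> is hidden because it is only determined up to null sets.\<close>
definition modulated :: "real \<Rightarrow> real \<Rightarrow> int \<times> int \<Rightarrow> (int \<Rightarrow> complex) \<Rightarrow> real \<Rightarrow> bool" where
  "modulated \<tau> b k a A \<longleftrightarrow> 0 \<le> A \<and> (\<exists>g. g \<in> borel_measurable borel \<and> a = time_coeff \<tau> g \<and>
     (modulation_energy \<tau> b k g) \<le> ennreal A)"

lemma set_integrable_of_square:
  fixes g :: "real \<Rightarrow> complex"
  assumes \<tau>: "\<tau> > 0" and [measurable]: "g \<in> borel_measurable borel"
    and fin: "cell_L2 (period_cell \<tau>) g < \<infinity>"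
  shows "set_integrable lborel (period_cell \<tau>) g"
  unfolding set_integrable_def
proof (rule integrableI_bounded)
  have "(\<integral>\<^sup>+s. ennreal (norm (indicator (period_cell \<tau>) s *\<^sub>R g s)) \<partial>lborel)
     \<le> (\<integral>\<^sup>+s. indicator (period_cell \<tau>) s + ennreal ((norm (g s))\<^sup>2) * indicator (period_cell \<tau>) s \<partial>lborel)"
  proof (rule nn_integral_mono)
    fix s
    have "2 * norm (g s) \<le> 1 + (norm (g s))\<^sup>2"
      using zero_le_power2[of "norm (g s) - 1"] by (simp add: power2_eq_square algebra_simps)
    then have "norm (g s) \<le> 1 + (norm (g s))\<^sup>2"
      using norm_ge_zero[of "g s"] by linarith
    then have "ennreal (norm (g s)) \<le> 1 + ennreal ((norm (g s))\<^sup>2)"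
      by (simp add: ennreal_plus[symmetric] ennreal_1[symmetric] ennreal_leI del: ennreal_plus ennreal_1)
    then show "ennreal (norm (indicator (period_cell \<tau>) s *\<^sub>R g s))
       \<le> indicator (period_cell \<tau>) s + ennreal ((norm (g s))\<^sup>2) * indicator (period_cell \<tau>) s"
      by (auto simp: indicator_def)
  qed
  also have "\<dots> = emeasure lborel (period_cell \<tau>) + cell_L2 (period_cell \<tau>) g"
    by (subst nn_integral_add) auto
  also have "\<dots> < \<infinity>" using fin \<tau> by (simp add: emeasure_period_cell)
  finally show "(\<integral>\<^sup>+s. ennreal (norm (indicator (period_cell \<tau>) s *\<^sub>R g s)) \<partial>lborel) < \<infinity>" .
qed measurable

lemma set_integrable_mult_wave:
  fixes g :: "real \<Rightarrow> complex"
  assumes "set_integrable lborel P g" and [measurable]: "P \<in> sets borel"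
  shows "set_integrable lborel P (\<lambda>s. g s * wave \<tau> n s)"
  using assms(1) unfolding set_integrable_def
proof (rule Bochner_Integration.integrable_bound)
  show "AE s in lborel. norm (indicator P s *\<^sub>R (g s * wave \<tau> n s)) \<le> norm (indicator P s *\<^sub>R g s)"
    by (auto simp: norm_mult)
  have "(\<lambda>s. (indicator P s *\<^sub>R g s) * wave \<tau> n s) \<in> borel_measurable lborel"
    using borel_measurable_integrable[OF assms(1)[unfolded set_integrable_def]] by measurable
  then show "(\<lambda>s. indicator P s *\<^sub>R (g s * wave \<tau> n s)) \<in> borel_measurable lborel"
    by simp
qed

lemma norm_set_lebesgue_integral_le:
  fixes g :: "real \<Rightarrow> complex"
  shows "ennreal (norm (set_lebesgue_integral lborel P g)) \<le> (\<integral>\<^sup>+s\<in>P. ennreal (norm (g s)) \<partial>lborel)"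
proof -
  have "ennreal (norm (set_lebesgue_integral lborel P g)) \<le> (\<integral>\<^sup>+s. ennreal (norm (indicator P s *\<^sub>R g s)) \<partial>lborel)"
  proof (cases "integrable lborel (\<lambda>s. indicator P s *\<^sub>R g s)")
    case True
    then show ?thesis unfolding set_lebesgue_integral_def by (rule integral_norm_bound_ennreal)
  next
    case False
    then show ?thesis by (simp add: set_lebesgue_integral_def not_integrable_integral_eq)
  qed
  also have "\<dots> = (\<integral>\<^sup>+s\<in>P. ennreal (norm (g s)) \<partial>lborel)"
    by (intro nn_integral_cong) (auto simp: indicator_def)
  finally show ?thesis .
qed

lemma set_lebesgue_integral_sum_wave:
  fixes g :: "real \<Rightarrow> complex"
  assumes g: "set_integrable lborel P g" and P: "P \<in> sets borel"
  shows "set_lebesgue_integral lborel P (\<lambda>s. g s * (\<Sum>n\<in>M. w n * wave \<tau> n s))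
     = (\<Sum>n\<in>M. w n * set_lebesgue_integral lborel P (\<lambda>s. g s * wave \<tau> n s))"
proof -
  have "set_lebesgue_integral lborel P (\<lambda>s. g s * (\<Sum>n\<in>M. w n * wave \<tau> n s))
      = (\<integral>s. (\<Sum>n\<in>M. w n * (indicator P s *\<^sub>R (g s * wave \<tau> n s))) \<partial>lborel)"
    unfolding set_lebesgue_integral_def
    by (intro Bochner_Integration.integral_cong) (auto simp: sum_distrib_left scaleR_sum_right mult_ac)
  also have "\<dots> = (\<Sum>n\<in>M. w n * (\<integral>s. indicator P s *\<^sub>R (g s * wave \<tau> n s) \<partial>lborel))"
    using set_integrable_mult_wave[OF g P, unfolded set_integrable_def]
    by (subst Bochner_Integration.integral_sum) (auto simp del: mult_scaleR_right)
  finally show ?thesis by (simp add: set_lebesgue_integral_def)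
qed

section \<open>The bilinear estimate\<close>

lemma modulation_powr_ge_1: "b \<ge> 0 \<Longrightarrow> 1 \<le> modulation \<tau> k s powr b"
  using jbracket_ge_1 by (rule ge_one_powr_ge_zero)

text \<open>A pointwise substitute for the weighted Cauchy-Schwarz inequality; the parameter \<open>t\<close> is optimised after
  integration.\<close>
lemma weighted_am_gm:
  fixes x y z u v t :: real
  assumes "t > 0" "u > 0" "v > 0"
  shows "x * y * z \<le> t / 2 * ((u * x\<^sup>2) * (v * y\<^sup>2)) + 1 / (2 * t) * (z\<^sup>2 * ((1 / u) * (1 / v)))"
proof -
  define a where "a = t * u * v"
  have a: "a > 0" using assms by (simp add: a_def)
  have "0 \<le> (a * (x * y) - z)\<^sup>2 / (2 * a)" using a by simp
  also have "\<dots> = a / 2 * (x * y)\<^sup>2 - x * y * z + z\<^sup>2 / (2 * a)"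
    using a by (simp add: power2_eq_square field_simps)
  finally show ?thesis using assms by (simp add: a_def power_mult_distrib field_simps)
qed

text \<open>Substituting \<open>\<sigma> = s + t\<close>. Sums of two points of the cell lie in the doubled cell \<open>period_cell (\<tau> / 2)\<close>;
  enlarging to it replaces a periodic extension of the functions.\<close>
lemma convolution_integral_bound:
  fixes Z :: "real \<Rightarrow> complex" and W1 W2 :: "real \<Rightarrow> real"
  assumes \<tau>: "\<tau> > 0" and [measurable]: "Z \<in> borel_measurable borel"
    "W1 \<in> borel_measurable borel" "W2 \<in> borel_measurable borel"
    and W1: "\<And>s. W1 s \<ge> 0" and W2: "\<And>s. W2 s \<ge> 0"
  shows "(\<integral>\<^sup>+s\<in>period_cell \<tau>. (\<integral>\<^sup>+t\<in>period_cell \<tau>. ennreal ((norm (Z (s + t)))\<^sup>2 * (W1 s * W2 t)) \<partial>lborel) \<partial>lborel)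
    \<le> (\<integral>\<^sup>+\<sigma>\<in>period_cell (\<tau> / real 2). ennreal ((norm (Z \<sigma>))\<^sup>2) *
        (\<integral>\<^sup>+t\<in>period_cell \<tau>. ennreal (W1 (\<sigma> - t) * W2 t) \<partial>lborel) \<partial>lborel)"
proof -
  define P where "P = period_cell \<tau>"
  define P2 where "P2 = period_cell (\<tau> / real 2)"
  have [measurable]: "P \<in> sets borel" "P2 \<in> sets borel" by (simp_all add: P_def P2_def)
  have PP: "\<sigma> \<in> P2" if "\<sigma> - t \<in> P" "t \<in> P" for \<sigma> t
  proof -
    have e: "pi / (\<tau> / real 2) = pi / \<tau> + pi / \<tau>" "- pi / (\<tau> / real 2) = - (pi / \<tau>) - pi / \<tau>"
      by simp_all
    have "- (pi / \<tau>) \<le> \<sigma> - t" "\<sigma> - t < pi / \<tau>" "- (pi / \<tau>) \<le> t" "t < pi / \<tau>"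
      using that by (auto simp: P_def period_cell_def)
    then show ?thesis unfolding P2_def period_cell_def e by simp
  qed
  have "(\<integral>\<^sup>+s\<in>P. (\<integral>\<^sup>+t\<in>P. ennreal ((norm (Z (s + t)))\<^sup>2 * (W1 s * W2 t)) \<partial>lborel) \<partial>lborel)
      = (\<integral>\<^sup>+s. (\<integral>\<^sup>+t. ennreal ((norm (Z (s + t)))\<^sup>2 * (W1 s * W2 t)) * indicator P t * indicator P s \<partial>lborel) \<partial>lborel)"
    by (subst nn_integral_multc) auto
  also have "\<dots> = (\<integral>\<^sup>+t. (\<integral>\<^sup>+s. ennreal ((norm (Z (s + t)))\<^sup>2 * (W1 s * W2 t)) * indicator P t * indicator P s \<partial>lborel) \<partial>lborel)"
    by (rule lborel_pair.Fubini') measurable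
  also have "\<dots> = (\<integral>\<^sup>+t. (\<integral>\<^sup>+\<sigma>. ennreal ((norm (Z \<sigma>))\<^sup>2 * (W1 (\<sigma> - t) * W2 t)) * indicator P t * indicator P (\<sigma> - t) \<partial>lborel) \<partial>lborel)"
  proof (rule nn_integral_cong)
    fix t
    show "(\<integral>\<^sup>+s. ennreal ((norm (Z (s + t)))\<^sup>2 * (W1 s * W2 t)) * indicator P t * indicator P s \<partial>lborel)
      = (\<integral>\<^sup>+\<sigma>. ennreal ((norm (Z \<sigma>))\<^sup>2 * (W1 (\<sigma> - t) * W2 t)) * indicator P t * indicator P (\<sigma> - t) \<partial>lborel)"
      by (subst (2) nn_integral_real_affine[where c = 1 and t = t]) (auto simp: add.commute)
  qed
  also have "\<dots> \<le> (\<integral>\<^sup>+t. (\<integral>\<^sup>+\<sigma>. ennreal ((norm (Z \<sigma>))\<^sup>2 * (W1 (\<sigma> - t) * W2 t)) * indicator P t * indicator P2 \<sigma> \<partial>lborel) \<partial>lborel)"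
    by (intro nn_integral_mono) (auto simp: indicator_def dest: PP)
  also have "\<dots> = (\<integral>\<^sup>+\<sigma>. (\<integral>\<^sup>+t. ennreal ((norm (Z \<sigma>))\<^sup>2 * (W1 (\<sigma> - t) * W2 t)) * indicator P t * indicator P2 \<sigma> \<partial>lborel) \<partial>lborel)"
    by (rule lborel_pair.Fubini') measurable
  also have "\<dots> = (\<integral>\<^sup>+\<sigma>. ennreal ((norm (Z \<sigma>))\<^sup>2) * (\<integral>\<^sup>+t\<in>P. ennreal (W1 (\<sigma> - t) * W2 t) \<partial>lborel) * indicator P2 \<sigma> \<partial>lborel)"
  proof (rule nn_integral_cong)
    fix \<sigma>
    have "(\<integral>\<^sup>+t. ennreal ((norm (Z \<sigma>))\<^sup>2 * (W1 (\<sigma> - t) * W2 t)) * indicator P t * indicator P2 \<sigma> \<partial>lborel)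
      = (\<integral>\<^sup>+t. ennreal ((norm (Z \<sigma>))\<^sup>2) * (ennreal (W1 (\<sigma> - t) * W2 t) * indicator P t) * indicator P2 \<sigma> \<partial>lborel)"
      by (intro nn_integral_cong) (simp add: ennreal_mult W1 W2 mult.assoc)
    also have "\<dots> = ennreal ((norm (Z \<sigma>))\<^sup>2) * (\<integral>\<^sup>+t\<in>P. ennreal (W1 (\<sigma> - t) * W2 t) \<partial>lborel) * indicator P2 \<sigma>"
      by (subst nn_integral_multc, measurable, subst nn_integral_cmult) auto
    finally show "(\<integral>\<^sup>+t. ennreal ((norm (Z \<sigma>))\<^sup>2 * (W1 (\<sigma> - t) * W2 t)) * indicator P t * indicator P2 \<sigma> \<partial>lborel)
      = ennreal ((norm (Z \<sigma>))\<^sup>2) * (\<integral>\<^sup>+t\<in>P. ennreal (W1 (\<sigma> - t) * W2 t) \<partial>lborel) * indicator P2 \<sigma>" .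
  qed
  finally show ?thesis by (simp add: P_def P2_def)
qed

lemma trilinear_pairing_bound:
  fixes g h Z :: "real \<Rightarrow> complex" and W1 W2 :: "real \<Rightarrow> real"
  assumes \<tau>: "\<tau> > 0" and t: "t > 0"
    and [measurable]: "g \<in> borel_measurable borel" "h \<in> borel_measurable borel" "Z \<in> borel_measurable borel"
    "W1 \<in> borel_measurable borel" "W2 \<in> borel_measurable borel"
    and W1: "\<And>s. W1 s > 0" and W2: "\<And>s. W2 s > 0"
    and A: "A \<ge> 0" "(\<integral>\<^sup>+s\<in>period_cell \<tau>. ennreal (W1 s * (norm (g s))\<^sup>2) \<partial>lborel) \<le> ennreal A"
    and B: "B \<ge> 0" "(\<integral>\<^sup>+s\<in>period_cell \<tau>. ennreal (W2 s * (norm (h s))\<^sup>2) \<partial>lborel) \<le> ennreal B"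
  shows "ennreal (norm (set_lebesgue_integral lborel (period_cell \<tau>)
            (\<lambda>s. g s * set_lebesgue_integral lborel (period_cell \<tau>) (\<lambda>t. h t * Z (s + t)))))
    \<le> ennreal (t / 2 * (A * B)) + ennreal (1 / (2 * t)) *
       (\<integral>\<^sup>+\<sigma>\<in>period_cell (\<tau> / real 2). ennreal ((norm (Z \<sigma>))\<^sup>2) *
        (\<integral>\<^sup>+s\<in>period_cell \<tau>. ennreal (1 / W1 (\<sigma> - s) * (1 / W2 s)) \<partial>lborel) \<partial>lborel)"
proof -
  define P where "P = period_cell \<tau>"
  have [measurable]: "P \<in> sets borel" by (simp add: P_def)
  define X where "X s r = ennreal (W1 s * (norm (g s))\<^sup>2) * indicator P s * (ennreal (W2 r * (norm (h r))\<^sup>2) * indicator P r)" for s r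
  define Y where "Y s r = ennreal ((norm (Z (s + r)))\<^sup>2 * (1 / W1 s * (1 / W2 r))) * indicator P r * indicator P s" for s r
  have [measurable]: "case_prod X \<in> borel_measurable (borel \<Otimes>\<^sub>M borel)" "case_prod Y \<in> borel_measurable (borel \<Otimes>\<^sub>M borel)"
    unfolding X_def Y_def by measurable
  have [measurable]: "case_prod X \<in> borel_measurable (lborel \<Otimes>\<^sub>M lborel)" "case_prod Y \<in> borel_measurable (lborel \<Otimes>\<^sub>M lborel)"
    unfolding X_def Y_def by measurable
  have point: "ennreal (norm (g s) * norm (h r) * norm (Z (s + r))) * indicator P r * indicator P s
      \<le> ennreal (t / 2) * X s r + ennreal (1 / (2 * t)) * Y s r" for s r
  proof -
    have "norm (g s) * norm (h r) * norm (Z (s + r)) \<le>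
       t / 2 * ((W1 s * (norm (g s))\<^sup>2) * (W2 r * (norm (h r))\<^sup>2))
       + 1 / (2 * t) * ((norm (Z (s + r)))\<^sup>2 * ((1 / W1 s) * (1 / W2 r)))"
      by (rule weighted_am_gm) (use t W1 W2 in auto)
    also have "ennreal \<dots> = ennreal (t / 2) * (ennreal (W1 s * (norm (g s))\<^sup>2) * ennreal (W2 r * (norm (h r))\<^sup>2))
       + ennreal (1 / (2 * t)) * ennreal ((norm (Z (s + r)))\<^sup>2 * ((1 / W1 s) * (1 / W2 r)))"
    proof -
      have nn: "0 \<le> W1 s * (norm (g s))\<^sup>2" "0 \<le> W2 r * (norm (h r))\<^sup>2"
        "0 \<le> (norm (Z (s + r)))\<^sup>2 * ((1 / W1 s) * (1 / W2 r))" "0 \<le> t / 2" "0 \<le> 1 / (2 * t)"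
        using W1[of s] W2[of r] t by auto
      then show ?thesis by (simp only: ennreal_mult[symmetric] ennreal_plus[symmetric] mult_nonneg_nonneg)
    qed
    finally have "ennreal (norm (g s) * norm (h r) * norm (Z (s + r))) \<le>
       ennreal (t / 2) * (ennreal (W1 s * (norm (g s))\<^sup>2) * ennreal (W2 r * (norm (h r))\<^sup>2))
       + ennreal (1 / (2 * t)) * ennreal ((norm (Z (s + r)))\<^sup>2 * ((1 / W1 s) * (1 / W2 r)))"
      by (simp add: ennreal_leI)
    then show ?thesis by (auto simp: X_def Y_def indicator_def)
  qed
  have "ennreal (norm (set_lebesgue_integral lborel P (\<lambda>s. g s * set_lebesgue_integral lborel P (\<lambda>t. h t * Z (s + t)))))
     \<le> (\<integral>\<^sup>+s\<in>P. ennreal (norm (g s * set_lebesgue_integral lborel P (\<lambda>t. h t * Z (s + t)))) \<partial>lborel)"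
    by (rule norm_set_lebesgue_integral_le)
  also have "\<dots> \<le> (\<integral>\<^sup>+s\<in>P. ennreal (norm (g s)) * (\<integral>\<^sup>+r\<in>P. ennreal (norm (h r * Z (s + r))) \<partial>lborel) \<partial>lborel)"
  proof (intro nn_integral_mono mult_right_mono)
    fix s
    have "ennreal (norm (g s * set_lebesgue_integral lborel P (\<lambda>t. h t * Z (s + t))))
       = ennreal (norm (g s)) * ennreal (norm (set_lebesgue_integral lborel P (\<lambda>t. h t * Z (s + t))))"
      by (simp add: norm_mult ennreal_mult)
    also have "\<dots> \<le> ennreal (norm (g s)) * (\<integral>\<^sup>+r\<in>P. ennreal (norm (h r * Z (s + r))) \<partial>lborel)"
      by (intro mult_left_mono norm_set_lebesgue_integral_le) auto
    finally show "ennreal (norm (g s * set_lebesgue_integral lborel P (\<lambda>t. h t * Z (s + t))))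
       \<le> ennreal (norm (g s)) * (\<integral>\<^sup>+r\<in>P. ennreal (norm (h r * Z (s + r))) \<partial>lborel)" .
  qed auto
  also have "\<dots> = (\<integral>\<^sup>+s. (\<integral>\<^sup>+r. ennreal (norm (g s) * norm (h r) * norm (Z (s + r))) * indicator P r * indicator P s \<partial>lborel) \<partial>lborel)"
  proof (rule nn_integral_cong)
    fix s
    have "(\<integral>\<^sup>+r. ennreal (norm (g s) * norm (h r) * norm (Z (s + r))) * indicator P r * indicator P s \<partial>lborel)
       = (\<integral>\<^sup>+r. ennreal (norm (g s)) * (ennreal (norm (h r * Z (s + r))) * indicator P r) * indicator P s \<partial>lborel)"
      by (intro nn_integral_cong) (simp add: norm_mult ennreal_mult mult.assoc)
    also have "\<dots> = ennreal (norm (g s)) * (\<integral>\<^sup>+r\<in>P. ennreal (norm (h r * Z (s + r))) \<partial>lborel) * indicator P s"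
      by (subst nn_integral_multc, measurable, subst nn_integral_cmult) auto
    finally show "ennreal (norm (g s)) * (\<integral>\<^sup>+r\<in>P. ennreal (norm (h r * Z (s + r))) \<partial>lborel) * indicator P s
        = (\<integral>\<^sup>+r. ennreal (norm (g s) * norm (h r) * norm (Z (s + r))) * indicator P r * indicator P s \<partial>lborel)" ..
  qed
  also have "\<dots> \<le> (\<integral>\<^sup>+s. (\<integral>\<^sup>+r. ennreal (t / 2) * X s r + ennreal (1 / (2 * t)) * Y s r \<partial>lborel) \<partial>lborel)"
    by (intro nn_integral_mono point)
  also have "\<dots> = (\<integral>\<^sup>+s. ennreal (t / 2) * (\<integral>\<^sup>+r. X s r \<partial>lborel) + ennreal (1 / (2 * t)) * (\<integral>\<^sup>+r. Y s r \<partial>lborel) \<partial>lborel)"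
    by (intro nn_integral_cong, subst nn_integral_add) (auto simp: nn_integral_cmult)
  also have "\<dots> = ennreal (t / 2) * (\<integral>\<^sup>+s. \<integral>\<^sup>+r. X s r \<partial>lborel \<partial>lborel) + ennreal (1 / (2 * t)) * (\<integral>\<^sup>+s. \<integral>\<^sup>+r. Y s r \<partial>lborel \<partial>lborel)"
    by (subst nn_integral_add) (auto simp: nn_integral_cmult)
  also have "\<dots> \<le> ennreal (t / 2) * (ennreal A * ennreal B) + ennreal (1 / (2 * t)) *
      (\<integral>\<^sup>+\<sigma>\<in>period_cell (\<tau> / real 2). ennreal ((norm (Z \<sigma>))\<^sup>2) *
        (\<integral>\<^sup>+s\<in>period_cell \<tau>. ennreal (1 / W1 (\<sigma> - s) * (1 / W2 s)) \<partial>lborel) \<partial>lborel)"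
  proof (intro add_mono mult_left_mono)
    have "(\<integral>\<^sup>+s. \<integral>\<^sup>+r. X s r \<partial>lborel \<partial>lborel)
       = (\<integral>\<^sup>+s\<in>P. ennreal (W1 s * (norm (g s))\<^sup>2) \<partial>lborel) * (\<integral>\<^sup>+s\<in>P. ennreal (W2 s * (norm (h s))\<^sup>2) \<partial>lborel)"
      unfolding X_def by (simp add: nn_integral_cmult nn_integral_multc)
    also have "\<dots> \<le> ennreal A * ennreal B"
      using A(2) B(2) by (intro mult_mono) (auto simp: P_def)
    finally show "(\<integral>\<^sup>+s. \<integral>\<^sup>+r. X s r \<partial>lborel \<partial>lborel) \<le> ennreal A * ennreal B" .
    have "(\<integral>\<^sup>+s. \<integral>\<^sup>+r. Y s r \<partial>lborel \<partial>lborel)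
       = (\<integral>\<^sup>+s\<in>P. (\<integral>\<^sup>+r\<in>P. ennreal ((norm (Z (s + r)))\<^sup>2 * (1 / W1 s * (1 / W2 r))) \<partial>lborel) \<partial>lborel)"
      unfolding Y_def by (subst nn_integral_multc) auto
    also have "\<dots> \<le> (\<integral>\<^sup>+\<sigma>\<in>period_cell (\<tau> / real 2). ennreal ((norm (Z \<sigma>))\<^sup>2) *
        (\<integral>\<^sup>+s\<in>period_cell \<tau>. ennreal (1 / W1 (\<sigma> - s) * (1 / W2 s)) \<partial>lborel) \<partial>lborel)"
      unfolding P_def using W1 W2 by (intro convolution_integral_bound[OF \<tau>]) (auto simp: less_imp_le)
    finally show "(\<integral>\<^sup>+s. \<integral>\<^sup>+r. Y s r \<partial>lborel \<partial>lborel) \<le> (\<integral>\<^sup>+\<sigma>\<in>period_cell (\<tau> / real 2). ennreal ((norm (Z \<sigma>))\<^sup>2) *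
        (\<integral>\<^sup>+s\<in>period_cell \<tau>. ennreal (1 / W1 (\<sigma> - s) * (1 / W2 s)) \<partial>lborel) \<partial>lborel)" .
  qed auto
  also have "ennreal (t / 2) * (ennreal A * ennreal B) = ennreal (t / 2 * (A * B))"
    using t A(1) B(1) by (simp add: ennreal_mult[symmetric])
  finally show ?thesis by (simp add: P_def)
qed

text \<open>A duality argument in which the left-hand side \<open>Q\<close> is its own test function. Writing the coefficients as
  integrals turns \<open>Q\<close> into a double integral of \<open>g h Z\<close>, where \<open>Z\<close> is the trigonometric polynomial in time
  with coefficients \<open>\<tau> * cnj z\<close>. The weighted arithmetic-geometric mean inequality bounds this by the
  product of the energies plus the kernel bound times \<open>\<parallel>Z\<parallel>\<^sup>2\<close>, and the latter is a multiple of \<open>Q\<close> by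
  Parseval; a suitable \<open>t\<close> lets it be absorbed.\<close>
lemma bilinear_estimate:
  fixes b \<epsilon> :: real
  assumes b: "b > 3 / 8" and \<epsilon>: "\<epsilon> > 0"
  obtains C where "C > 0"
    and "\<And>\<tau> R K1 K2 L M a c A B. \<lbrakk>0 < \<tau>; \<tau> \<le> 1; R \<ge> 1; finite K1; finite K2; K1 \<subseteq> freq_box \<tau>; K2 \<subseteq> freq_box \<tau>;
        \<And>k. k \<in> K2 \<Longrightarrow> kbr k \<le> R; finite L; finite M;
        \<And>k. k \<in> K1 \<Longrightarrow> modulated \<tau> b k (a k) (A k); \<And>k. k \<in> K2 \<Longrightarrow> modulated \<tau> b k (c k) (B k)\<rbrakk> \<Longrightarrow>
      \<tau> * (\<Sum>n\<in>M. \<Sum>l\<in>L. (norm (\<Sum>k | k \<in> K2 \<and> l - k \<in> K1. a (l - k) n * c k n))\<^sup>2)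
        \<le> C * R powr (3 / 2 + \<epsilon>) * sum A K1 * sum B K2"
proof -
  show ?thesis
  proof (cases rule: modulation_kernel_bound[OF b \<epsilon>])
  case (1 C)
    note C = 1(1) and kernel = 1(2)
    show ?thesis
    proof
      show "C > 0" by fact
      fix \<tau> R :: real and K1 K2 L :: "(int \<times> int) set" and M :: "int set" and a c A B
      assume \<tau>: "0 < \<tau>" "\<tau> \<le> 1" and R: "R \<ge> 1" and fin1: "finite K1" and fin2: "finite K2"
        and K1: "K1 \<subseteq> freq_box \<tau>" and K2: "K2 \<subseteq> freq_box \<tau>"
        and KR: "\<And>k. k \<in> K2 \<Longrightarrow> kbr k \<le> R" and L: "finite L" and M: "finite M"
        and a: "\<And>k. k \<in> K1 \<Longrightarrow> modulated \<tau> b k (a k) (A k)"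
        and c: "\<And>k. k \<in> K2 \<Longrightarrow> modulated \<tau> b k (c k) (B k)"
      define P where "P = period_cell \<tau>"
      define \<kappa> where "\<kappa> = C * R powr (3 / 2 + \<epsilon>)"
      have \<kappa>: "\<kappa> > 0" using C R by (simp add: \<kappa>_def)
      define D where "D l = {k. k \<in> K2 \<and> l - k \<in> K1}" for l
      have finD: "finite (D l)" for l unfolding D_def using fin2 by auto
      define z where "z n l = (\<Sum>k\<in>D l. a (l - k) n * c k n)" for n l
      define Q where "Q = \<tau> * (\<Sum>n\<in>M. \<Sum>l\<in>L. (norm (z n l))\<^sup>2)"
      have Q0: "Q \<ge> 0" unfolding Q_def using \<tau> by (auto intro!: mult_nonneg_nonneg sum_nonneg)
      have "\<forall>k\<in>K1. \<exists>g. g \<in> borel_measurable borel \<and> a k = time_coeff \<tau> g \<and>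
         (\<integral>\<^sup>+s\<in>P. ennreal (modulation \<tau> k s powr (2 * b) * (norm (g s))\<^sup>2) \<partial>lborel) \<le> ennreal (A k)"
        using a by (auto simp: modulated_def P_def)
      then obtain g where g: "\<And>k. k \<in> K1 \<Longrightarrow> g k \<in> borel_measurable borel"
        "\<And>k. k \<in> K1 \<Longrightarrow> a k = time_coeff \<tau> (g k)"
        "\<And>k. k \<in> K1 \<Longrightarrow> (\<integral>\<^sup>+s\<in>P. ennreal (modulation \<tau> k s powr (2 * b) * (norm (g k s))\<^sup>2) \<partial>lborel) \<le> ennreal (A k)"
        by (auto dest!: bchoice)
      have "\<forall>k\<in>K2. \<exists>g. g \<in> borel_measurable borel \<and> c k = time_coeff \<tau> g \<and>
         (\<integral>\<^sup>+s\<in>P. ennreal (modulation \<tau> k s powr (2 * b) * (norm (g s))\<^sup>2) \<partial>lborel) \<le> ennreal (B k)"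
        using c by (auto simp: modulated_def P_def)
      then obtain h where h: "\<And>k. k \<in> K2 \<Longrightarrow> h k \<in> borel_measurable borel"
        "\<And>k. k \<in> K2 \<Longrightarrow> c k = time_coeff \<tau> (h k)"
        "\<And>k. k \<in> K2 \<Longrightarrow> (\<integral>\<^sup>+s\<in>P. ennreal (modulation \<tau> k s powr (2 * b) * (norm (h k s))\<^sup>2) \<partial>lborel) \<le> ennreal (B k)"
        by (auto dest!: bchoice)
      have A0: "A k \<ge> 0" if "k \<in> K1" for k using a[OF that] by (simp add: modulated_def)
      have B0: "B k \<ge> 0" if "k \<in> K2" for k using c[OF that] by (simp add: modulated_def)
      have integ: "set_integrable lborel P f"
        if [measurable]: "f \<in> borel_measurable borel"
          and le: "(\<integral>\<^sup>+s\<in>P. ennreal (modulation \<tau> k s powr (2 * b) * (norm (f s))\<^sup>2) \<partial>lborel) \<le> ennreal E"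
        for f :: "real \<Rightarrow> complex" and k :: "int \<times> int" and E :: real
        unfolding P_def
      proof (rule set_integrable_of_square[OF \<tau>(1)])
        have "cell_L2 (period_cell \<tau>) f
          \<le> (\<integral>\<^sup>+s\<in>P. ennreal (modulation \<tau> k s powr (2 * b) * (norm (f s))\<^sup>2) \<partial>lborel)"
          unfolding P_def using b modulation_powr_ge_1[where b = "2 * b" and k = k and \<tau> = \<tau>]
          by (intro nn_integral_mono mult_right_mono ennreal_leI) (auto simp: mult_le_cancel_right1)
        from this le show "cell_L2 (period_cell \<tau>) f < \<infinity>"
          by (rule le_less_trans[OF order_trans]) simp
      qed measurable
      have gi: "set_integrable lborel P (g k)" if "k \<in> K1" for k
        using integ g that by blast
      have hi: "set_integrable lborel P (h k)" if "k \<in> K2" for k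
        using integ h that by blast
      have [measurable]: "P \<in> sets borel" by (simp add: P_def)
      define Z where "Z l s = (\<Sum>n\<in>M. (of_real \<tau> * cnj (z n l)) * wave \<tau> n s)" for l s
      have [measurable]: "Z l \<in> borel_measurable borel" for l unfolding Z_def by measurable
      define I where "I l k = set_lebesgue_integral lborel P (\<lambda>s. g (l - k) s * set_lebesgue_integral lborel P (\<lambda>t. h k t * Z l (s + t)))" for l k
      have I_eq: "(\<Sum>n\<in>M. of_real \<tau> * (a (l - k) n * c k n * cnj (z n l))) = I l k / of_real ((2 * pi)\<^sup>2)"
        if k: "k \<in> D l" for l k
      proof -
        have k1: "l - k \<in> K1" and k2: "k \<in> K2" using k by (auto simp: D_def)
        have c_eq: "set_lebesgue_integral lborel P (\<lambda>t. h k t * wave \<tau> n t) = of_real (2 * pi) * c k n" for n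
          by (simp add: h(2)[OF k2] time_coeff_def P_def)
        have a_eq: "set_lebesgue_integral lborel P (\<lambda>t. g (l - k) t * wave \<tau> n t) = of_real (2 * pi) * a (l - k) n" for n
          by (simp add: g(2)[OF k1] time_coeff_def P_def)
        have "set_lebesgue_integral lborel P (\<lambda>t. h k t * Z l (s + t))
           = (\<Sum>n\<in>M. (of_real (2 * pi) * c k n * of_real \<tau> * cnj (z n l)) * wave \<tau> n s)" for s
        proof -
          have "set_lebesgue_integral lborel P (\<lambda>t. h k t * Z l (s + t))
            = set_lebesgue_integral lborel P (\<lambda>t. h k t * (\<Sum>n\<in>M. (of_real \<tau> * cnj (z n l) * wave \<tau> n s) * wave \<tau> n t))"
            by (simp add: Z_def wave_add mult.assoc)
          also have "\<dots> = (\<Sum>n\<in>M. (of_real \<tau> * cnj (z n l) * wave \<tau> n s) * (of_real (2 * pi) * c k n))"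
            unfolding set_lebesgue_integral_sum_wave[OF hi[OF k2] \<open>P \<in> sets borel\<close>] c_eq ..
          finally show ?thesis by (simp add: mult_ac)
        qed
        then have "I l k = set_lebesgue_integral lborel P (\<lambda>s. g (l - k) s
            * (\<Sum>n\<in>M. (of_real (2 * pi) * c k n * of_real \<tau> * cnj (z n l)) * wave \<tau> n s))"
          unfolding I_def by simp
        also have "\<dots> = (\<Sum>n\<in>M. (of_real (2 * pi) * c k n * of_real \<tau> * cnj (z n l)) * (of_real (2 * pi) * a (l - k) n))"
          unfolding set_lebesgue_integral_sum_wave[OF gi[OF k1] \<open>P \<in> sets borel\<close>] a_eq ..
        also have "\<dots> = of_real ((2 * pi)\<^sup>2) * (\<Sum>n\<in>M. of_real \<tau> * (a (l - k) n * c k n * cnj (z n l)))"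
          by (simp add: sum_distrib_left power2_eq_square mult_ac)
        finally show ?thesis by simp
      qed
      have Q_eq: "complex_of_real Q = (\<Sum>l\<in>L. \<Sum>k\<in>D l. I l k / of_real ((2 * pi)\<^sup>2))"
      proof -
        have "complex_of_real Q = (\<Sum>n\<in>M. \<Sum>l\<in>L. of_real \<tau> * (z n l * cnj (z n l)))"
          unfolding Q_def of_real_mult of_real_sum complex_norm_square by (simp add: sum_distrib_left)
        also have "\<dots> = (\<Sum>n\<in>M. \<Sum>l\<in>L. \<Sum>k\<in>D l. of_real \<tau> * (a (l - k) n * c k n * cnj (z n l)))"
          by (intro sum.cong refl) (simp add: z_def[of _ _] sum_distrib_left sum_distrib_right del: cnj_sum)
        also have "\<dots> = (\<Sum>l\<in>L. \<Sum>k\<in>D l. \<Sum>n\<in>M. of_real \<tau> * (a (l - k) n * c k n * cnj (z n l)))"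
          by (subst sum.swap) (intro sum.cong refl sum.swap)
        also have "\<dots> = (\<Sum>l\<in>L. \<Sum>k\<in>D l. I l k / of_real ((2 * pi)\<^sup>2))"
          by (intro sum.cong refl I_eq)
        finally show ?thesis .
      qed
      \<comment> \<open>With this choice the term containing \<open>Q\<close> is exactly half of the left-hand side.\<close>
      define t where "t = \<kappa> / pi"
      have t: "t > 0" using \<kappa> by (simp add: t_def)
      define J where "J l k = (\<integral>\<^sup>+\<sigma>\<in>period_cell (\<tau> / real 2). ennreal ((norm (Z l \<sigma>))\<^sup>2) *
          (\<integral>\<^sup>+s\<in>P. ennreal (modulation \<tau> (l - k) (\<sigma> - s) powr - (2 * b) * modulation \<tau> k s powr - (2 * b)) \<partial>lborel) \<partial>lborel)" for l k
      have I_le: "ennreal (norm (I l k)) \<le> ennreal (t / 2 * (A (l - k) * B k)) + ennreal (1 / (2 * t)) * J l k"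
        if k: "k \<in> D l" for l k
      proof -
        have k1: "l - k \<in> K1" and k2: "k \<in> K2" using k by (auto simp: D_def)
        have inv: "1 / (modulation \<tau> k' s powr (2 * b)) = modulation \<tau> k' s powr - (2 * b)" for k' s
          by (simp add: powr_minus_divide)
        have pos: "modulation \<tau> k' s powr (2 * b) > 0" for k' s
          using jbracket_pos[of "d_tau \<tau> (s + kbr k')"] by simp
        show ?thesis
          unfolding I_def J_def inv[symmetric] P_def
          by (rule trilinear_pairing_bound[OF \<tau>(1) t])
            (use g h k1 k2 pos A0 B0 in \<open>auto simp: P_def\<close>)
      qed
      have J_le: "(\<Sum>k\<in>D l. J l k) \<le> ennreal (\<kappa> * (4 * pi * \<tau> * (\<Sum>n\<in>M. (norm (z n l))\<^sup>2)))" for l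
      proof -
        have "(\<Sum>k\<in>D l. J l k) = (\<integral>\<^sup>+\<sigma>\<in>period_cell (\<tau> / real 2). ennreal ((norm (Z l \<sigma>))\<^sup>2) *
          (\<Sum>k\<in>D l. \<integral>\<^sup>+s\<in>P. ennreal (modulation \<tau> (l - k) (\<sigma> - s) powr - (2 * b) * modulation \<tau> k s powr - (2 * b)) \<partial>lborel) \<partial>lborel)"
          unfolding J_def by (subst nn_integral_sum[symmetric]) (auto simp: sum_distrib_left sum_distrib_right)
        also have "\<dots> \<le> (\<integral>\<^sup>+\<sigma>\<in>period_cell (\<tau> / real 2). ennreal ((norm (Z l \<sigma>))\<^sup>2) * ennreal \<kappa> \<partial>lborel)"
          unfolding P_def \<kappa>_def
          by (intro nn_integral_mono mult_right_mono mult_left_mono kernel \<tau> R finD)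
            (use K1 K2 KR in \<open>auto simp: D_def\<close>)
        also have "\<dots> = ennreal \<kappa> * cell_L2 (period_cell (\<tau> / real 2)) (Z l)"
          by (subst nn_integral_cmult[symmetric]) (auto simp: mult_ac)
        also have "cell_L2 (period_cell (\<tau> / real 2)) (Z l)
           = ennreal (2 * pi * real 2 / \<tau> * (\<Sum>n\<in>M. (norm (of_real \<tau> * cnj (z n l)))\<^sup>2))"
          unfolding Z_def by (rule nn_integral_norm_power2_wave_sum[OF \<tau>(1) _ M]) simp
        also have "2 * pi * real 2 / \<tau> * (\<Sum>n\<in>M. (norm (of_real \<tau> * cnj (z n l)))\<^sup>2) = 4 * pi * \<tau> * (\<Sum>n\<in>M. (norm (z n l))\<^sup>2)"
        proof -
          have "(\<Sum>n\<in>M. (norm (of_real \<tau> * cnj (z n l)))\<^sup>2) = \<tau>\<^sup>2 * (\<Sum>n\<in>M. (norm (z n l))\<^sup>2)"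
            by (simp add: norm_mult power_mult_distrib sum_distrib_left)
          then show ?thesis using \<tau> by (simp add: power2_eq_square[of \<tau>])
        qed
        finally show ?thesis using \<kappa> by (simp add: ennreal_mult'' sum_nonneg \<tau> less_imp_le)
      qed
      have AB_le: "(\<Sum>l\<in>L. \<Sum>k\<in>D l. A (l - k) * B k) \<le> sum A K1 * sum B K2"
      proof -
        have "(\<Sum>l\<in>L. \<Sum>k\<in>D l. A (l - k) * B k) = (\<Sum>(l, k)\<in>Sigma L D. A (l - k) * B k)"
          using L finD by (intro sum.Sigma) auto
        also have "\<dots> = (\<Sum>(j, k)\<in>(\<lambda>(l, k). (l - k, k)) ` Sigma L D. A j * B k)"
          by (subst sum.reindex) (auto simp: inj_on_def case_prod_unfold)
        also have "\<dots> \<le> (\<Sum>(j, k)\<in>K1 \<times> K2. A j * B k)"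
          using fin1 fin2 A0 B0 by (intro sum_mono2) (auto simp: D_def)
        also have "\<dots> = sum A K1 * sum B K2"
          by (simp add: sum_product sum.cartesian_product)
        finally show ?thesis .
      qed
      have "ennreal ((2 * pi)\<^sup>2 * Q) = ennreal (norm (complex_of_real ((2 * pi)\<^sup>2 * Q)))"
        using Q0 by (simp only: norm_of_real) simp
      also have "complex_of_real ((2 * pi)\<^sup>2 * Q) = (\<Sum>l\<in>L. \<Sum>k\<in>D l. I l k)"
        unfolding of_real_mult Q_eq by (simp add: sum_divide_distrib[symmetric])
      also have "ennreal (norm \<dots>) \<le> ennreal (\<Sum>l\<in>L. \<Sum>k\<in>D l. norm (I l k))"
        by (intro ennreal_leI order_trans[OF norm_sum] sum_mono norm_sum)
      also have "\<dots> = (\<Sum>l\<in>L. \<Sum>k\<in>D l. ennreal (norm (I l k)))"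
        by (simp add: sum_ennreal sum_nonneg)
      also have "\<dots> \<le> (\<Sum>l\<in>L. \<Sum>k\<in>D l. ennreal (t / 2 * (A (l - k) * B k)) + ennreal (1 / (2 * t)) * J l k)"
        by (intro sum_mono I_le)
      also have "\<dots> = (\<Sum>l\<in>L. \<Sum>k\<in>D l. ennreal (t / 2 * (A (l - k) * B k))) + ennreal (1 / (2 * t)) * (\<Sum>l\<in>L. \<Sum>k\<in>D l. J l k)"
        by (simp add: sum.distrib sum_distrib_left)
      also have "(\<Sum>l\<in>L. \<Sum>k\<in>D l. ennreal (t / 2 * (A (l - k) * B k))) = ennreal (t / 2 * (\<Sum>l\<in>L. \<Sum>k\<in>D l. A (l - k) * B k))"
      proof -
        have nn: "0 \<le> t / 2 * (A (l - k) * B k)" if "k \<in> D l" for l k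
          using that t A0 B0 by (auto simp: D_def)
        show ?thesis using nn by (simp add: sum_ennreal sum_nonneg sum_distrib_left)
      qed
      also have "\<dots> + ennreal (1 / (2 * t)) * (\<Sum>l\<in>L. \<Sum>k\<in>D l. J l k)
         \<le> ennreal (t / 2 * (sum A K1 * sum B K2)) + ennreal (1 / (2 * t)) * (\<Sum>l\<in>L. ennreal (\<kappa> * (4 * pi * \<tau> * (\<Sum>n\<in>M. (norm (z n l))\<^sup>2))))"
        using t by (intro add_mono ennreal_leI mult_left_mono AB_le sum_mono J_le) auto
      also have "(\<Sum>l\<in>L. ennreal (\<kappa> * (4 * pi * \<tau> * (\<Sum>n\<in>M. (norm (z n l))\<^sup>2)))) = ennreal (\<Sum>l\<in>L. \<kappa> * (4 * pi * \<tau> * (\<Sum>n\<in>M. (norm (z n l))\<^sup>2)))"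
        using \<kappa> \<tau> by (intro sum_ennreal) (auto intro!: mult_nonneg_nonneg sum_nonneg)
      also have "(\<Sum>l\<in>L. \<kappa> * (4 * pi * \<tau> * (\<Sum>n\<in>M. (norm (z n l))\<^sup>2))) = \<kappa> * (4 * pi * Q)"
        unfolding Q_def by (subst sum.swap) (simp add: sum_distrib_left mult_ac)
      also have "ennreal (t / 2 * (sum A K1 * sum B K2)) + ennreal (1 / (2 * t)) * ennreal (\<kappa> * (4 * pi * Q))
          = ennreal (t / 2 * (sum A K1 * sum B K2) + 1 / (2 * t) * (\<kappa> * (4 * pi * Q)))"
      proof -
        have a1: "0 \<le> t / 2 * (sum A K1 * sum B K2)"
          using t A0 B0 by (intro mult_nonneg_nonneg sum_nonneg) auto
        have a2: "0 \<le> \<kappa> * (4 * pi * Q)" using \<kappa> Q0 by simp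
        have a3: "0 \<le> 1 / (2 * t)" using t by simp
        show ?thesis unfolding ennreal_plus[OF a1 mult_nonneg_nonneg[OF a3 a2]] ennreal_mult[OF a3 a2] ..
      qed
      finally have "ennreal ((2 * pi)\<^sup>2 * Q) \<le> ennreal (t / 2 * (sum A K1 * sum B K2) + 1 / (2 * t) * (\<kappa> * (4 * pi * Q)))" .
      moreover have AB0: "0 \<le> sum A K1 * sum B K2"
        using A0 B0 by (intro mult_nonneg_nonneg sum_nonneg) auto
      moreover have "0 \<le> t / 2 * (sum A K1 * sum B K2) + 1 / (2 * t) * (\<kappa> * (4 * pi * Q))"
        using t \<kappa> Q0
        by (intro add_nonneg_nonneg mult_nonneg_nonneg[OF _ AB0] mult_nonneg_nonneg[of "1 / (2 * t)"]) auto
      ultimately have main: "(2 * pi)\<^sup>2 * Q \<le> t / 2 * (sum A K1 * sum B K2) + 1 / (2 * t) * (\<kappa> * (4 * pi * Q))"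
        by (simp only: ennreal_le_iff)
      have "1 / (2 * t) * (\<kappa> * (4 * pi * Q)) = 2 * pi\<^sup>2 * Q"
        using \<kappa> by (simp add: t_def power2_eq_square)
      moreover have "(2 * pi)\<^sup>2 * Q = 2 * pi\<^sup>2 * Q + 2 * pi\<^sup>2 * Q" by (simp add: power_mult_distrib)
      ultimately have "2 * pi\<^sup>2 * Q \<le> t / 2 * (sum A K1 * sum B K2)"
        using main by linarith
      also have "\<dots> \<le> \<kappa> * (sum A K1 * sum B K2)"
      proof (intro mult_right_mono AB0)
        have "\<kappa> / pi \<le> \<kappa> / 1" using \<kappa> pi_gt3 by (intro divide_left_mono) auto
        then show "t / 2 \<le> \<kappa>" using \<kappa> by (simp add: t_def)
      qed
      finally have "2 * pi\<^sup>2 * Q \<le> \<kappa> * (sum A K1 * sum B K2)" .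
      moreover have "1 * Q \<le> (2 * pi\<^sup>2) * Q"
      proof (intro mult_right_mono Q0)
        have "(1::real)\<^sup>2 \<le> pi\<^sup>2" using pi_gt3 by (intro power_mono) auto
        then show "1 \<le> 2 * pi\<^sup>2" by simp
      qed
      ultimately have "Q \<le> \<kappa> * (sum A K1 * sum B K2)" by linarith
      then show "\<tau> * (\<Sum>n\<in>M. \<Sum>l\<in>L. (norm (\<Sum>k | k \<in> K2 \<and> l - k \<in> K1. a (l - k) n * c k n))\<^sup>2)
          \<le> C * R powr (3 / 2 + \<epsilon>) * sum A K1 * sum B K2"
        by (simp add: Q_def z_def D_def \<kappa>_def mult.assoc)
    qed
  qed
qed

section \<open>Trigonometric polynomials on the torus\<close>

definition mode :: "int \<times> int \<Rightarrow> real \<times> real \<Rightarrow> complex" where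
  "mode k x = exp (\<i> * of_real (freq k \<bullet> x))"

lemma continuous_mode [continuous_intros]: "continuous_on UNIV (mode k)"
  unfolding mode_def by (intro continuous_intros)

lemma mode_0 [simp]: "mode 0 x = 1"
  by (simp add: mode_def freq_def zero_prod_def[symmetric])

lemma mode_mult: "mode k x * mode l x = mode (k + l) x"
  by (simp add: mode_def exp_add[symmetric] freq_add inner_add_left algebra_simps)

lemma cnj_mode: "cnj (mode k x) = mode (- k) x"
  by (simp add: mode_def exp_cnj freq_minus)

lemma norm_mode [simp]: "norm (mode k x) = 1"
  unfolding mode_def by (rule norm_exp_i_times)

lemma mode_wave: "mode k (x, y) = wave 1 (fst k) x * wave 1 (snd k) y"
  by (simp add: mode_def wave_def freq_def exp_add[symmetric] algebra_simps)

abbreviation torus_integral :: "(real \<times> real \<Rightarrow> 'a::{banach, second_countable_topology}) \<Rightarrow> 'a" where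
  "torus_integral f \<equiv> set_lebesgue_integral lebesgue torus_dom f"

lemma torus_dom_sets [measurable]: "torus_dom \<in> sets borel"
proof -
  have "torus_dom \<in> sets (borel \<Otimes>\<^sub>M borel)" unfolding torus_dom_def by measurable
  then show ?thesis unfolding borel_prod .
qed

lemma torus_integrable_lborel:
  fixes f :: "real \<times> real \<Rightarrow> 'a::{banach, second_countable_topology}"
  assumes "continuous_on UNIV f"
  shows "set_integrable lborel torus_dom f"
proof (rule set_integrable_subset)
  show "set_integrable lborel (cbox (- pi, - pi) (pi, pi)) f"
    unfolding set_integrable_def
    by (rule borel_integrable_compact) (auto intro: continuous_on_subset[OF assms])
  show "torus_dom \<subseteq> cbox (- pi, - pi) (pi, pi)"
    by (auto simp: torus_dom_def)
qed simp

lemma continuous_imp_borel: "continuous_on UNIV f \<Longrightarrow> f \<in> borel_measurable borel"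
  by (rule borel_measurable_continuous_onI)

lemma torus_integrable:
  fixes f :: "real \<times> real \<Rightarrow> 'a::{banach, second_countable_topology}"
  assumes "continuous_on UNIV f"
  shows "set_integrable lebesgue torus_dom f"
  using torus_integrable_lborel[OF assms] continuous_imp_borel[OF assms] unfolding set_integrable_def
  by (subst integrable_completion) auto

lemma torus_integral_lborel:
  fixes f :: "real \<times> real \<Rightarrow> 'a::{banach, second_countable_topology}"
  assumes "continuous_on UNIV f"
  shows "torus_integral f = set_lebesgue_integral lborel torus_dom f"
  using continuous_imp_borel[OF assms] unfolding set_lebesgue_integral_def
  by (intro integral_completion) auto

lemma torus_integral_mode: "torus_integral (mode k) = (if k = 0 then of_real ((2 * pi)\<^sup>2) else 0)"
proof -
  define I where "I = {- pi..<pi}"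
  have cell: "period_cell (1 / real 1) = I" by (simp add: period_cell_def I_def)
  have one: "(\<integral>x. indicator I x *\<^sub>R wave 1 n x \<partial>lborel) = (if n = 0 then of_real (2 * pi) else 0)" for n
    using wave_integral[of 1 1 n] unfolding cell set_lebesgue_integral_def by simp
  have ind: "indicator torus_dom (x, y) *\<^sub>R mode k (x, y)
      = (indicator I x *\<^sub>R wave 1 (fst k) x) * (indicator I y *\<^sub>R wave 1 (snd k) y)" for x y
    by (auto simp: torus_dom_def I_def mode_wave indicator_def)
  have int: "integrable (lborel \<Otimes>\<^sub>M lborel) (\<lambda>(x, y). indicator torus_dom (x, y) *\<^sub>R mode k (x, y))"
    using torus_integrable_lborel[OF continuous_mode, of k]
    by (simp add: set_integrable_def lborel_prod case_prod_unfold)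
  have "torus_integral (mode k) = set_lebesgue_integral lborel torus_dom (mode k)"
    by (intro torus_integral_lborel continuous_mode)
  also have "\<dots> = (\<integral>x. (\<integral>y. indicator torus_dom (x, y) *\<^sub>R mode k (x, y) \<partial>lborel) \<partial>lborel)"
    using lborel_pair.integral_fst[OF int]
    by (simp add: set_lebesgue_integral_def lborel_prod case_prod_unfold)
  also have "\<dots> = (if fst k = 0 then of_real (2 * pi) else 0) * (if snd k = 0 then of_real (2 * pi) else 0)"
    unfolding ind integral_mult_right_zero integral_mult_left_zero one by simp
  also have "\<dots> = (if k = 0 then of_real ((2 * pi)\<^sup>2) else 0)"
    by (auto simp: prod_eq_iff power2_eq_square)
  finally show ?thesis .
qed

lemma torus_integral_sum:
  fixes f :: "'i \<Rightarrow> real \<times> real \<Rightarrow> 'a::{banach, second_countable_topology}"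
  assumes "\<And>i. i \<in> S \<Longrightarrow> continuous_on UNIV (f i)"
  shows "torus_integral (\<lambda>x. \<Sum>i\<in>S. f i x) = (\<Sum>i\<in>S. torus_integral (f i))"
  using torus_integrable[OF assms] unfolding set_lebesgue_integral_def set_integrable_def scaleR_sum_right
  by (intro Bochner_Integration.integral_sum) auto

definition trig :: "(int \<times> int) set \<Rightarrow> (int \<times> int \<Rightarrow> complex) \<Rightarrow> real \<times> real \<Rightarrow> complex" where
  "trig K a x = (\<Sum>k\<in>K. a k * mode k x)"

lemma continuous_trig [continuous_intros]: "continuous_on UNIV (trig K a)"
  unfolding trig_def by (intro continuous_intros)

lemma torus_integral_trig:
  assumes "finite K"
  shows "torus_integral (trig K a) = (if 0 \<in> K then of_real ((2 * pi)\<^sup>2) * a 0 else 0)"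
proof -
  have "torus_integral (trig K a) = (\<Sum>k\<in>K. torus_integral (\<lambda>x. a k * mode k x))"
    unfolding trig_def by (intro torus_integral_sum continuous_intros)
  also have "\<dots> = (\<Sum>k\<in>K. if k = 0 then of_real ((2 * pi)\<^sup>2) * a 0 else 0)"
    by (intro sum.cong refl) (auto simp: torus_integral_mode)
  finally show ?thesis using assms by (auto simp: sum.delta)
qed

lemma trig_mult:
  assumes "finite K1" "finite K2"
  shows "trig K1 a x * trig K2 c x
     = trig ((\<lambda>(k, l). k + l) ` (K1 \<times> K2)) (\<lambda>l. \<Sum>k | k \<in> K2 \<and> l - k \<in> K1. a (l - k) * c k) x"
proof -
  define L where "L = (\<lambda>(k, l). k + l) ` (K1 \<times> K2)"
  have L: "finite L" using assms by (simp add: L_def)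
  have "trig L (\<lambda>l. \<Sum>k | k \<in> K2 \<and> l - k \<in> K1. a (l - k) * c k) x
     = (\<Sum>l\<in>L. \<Sum>k | k \<in> K2 \<and> l - k \<in> K1. a (l - k) * c k * mode l x)"
    by (simp add: trig_def sum_distrib_right)
  also have "\<dots> = (\<Sum>(l, k)\<in>Sigma L (\<lambda>l. {k. k \<in> K2 \<and> l - k \<in> K1}). a (l - k) * c k * mode l x)"
    using L assms by (intro sum.Sigma) auto
  also have "\<dots> = (\<Sum>(j, k)\<in>K1 \<times> K2. a j * c k * mode (j + k) x)"
    by (rule sum.reindex_bij_witness[of _ "\<lambda>(j, k). (j + k, k)" "\<lambda>(l, k). (l - k, k)"])
      (auto simp: L_def image_iff intro!: bexI)
  also have "\<dots> = trig K1 a x * trig K2 c x"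
    by (simp add: trig_def sum_product sum.cartesian_product mode_mult[symmetric] mult_ac)
  finally show ?thesis by (simp add: L_def)
qed

lemma cnj_trig: "cnj (trig K a x) = trig (uminus ` K) (\<lambda>k. cnj (a (- k))) x"
  by (simp add: trig_def sum.reindex inj_on_def cnj_mode)

lemma torus_integral_norm_trig:
  assumes "finite K"
  shows "torus_integral (\<lambda>x. (norm (trig K a x))\<^sup>2) = (2 * pi)\<^sup>2 * (\<Sum>k\<in>K. (norm (a k))\<^sup>2)"
proof -
  have eq: "complex_of_real ((norm (trig K a x))\<^sup>2) = (\<Sum>k\<in>K. \<Sum>l\<in>K. (a k * cnj (a l)) * mode (k - l) x)" for x
  proof -
    have "mode (k - l) x = mode k x * cnj (mode l x)" for k l
      by (simp add: cnj_mode mode_mult)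
    then show ?thesis
      unfolding complex_norm_square trig_def by (simp add: sum_product mult_ac)
  qed
  have "complex_of_real (torus_integral (\<lambda>x. (norm (trig K a x))\<^sup>2)) = torus_integral (\<lambda>x. complex_of_real ((norm (trig K a x))\<^sup>2))"
    by (rule set_integral_complex_of_real[symmetric])
  also have "\<dots> = (\<Sum>k\<in>K. \<Sum>l\<in>K. torus_integral (\<lambda>x. (a k * cnj (a l)) * mode (k - l) x))"
    unfolding eq by (subst torus_integral_sum, intro continuous_intros)
      (intro sum.cong refl torus_integral_sum continuous_intros)
  also have "\<dots> = (\<Sum>k\<in>K. \<Sum>l\<in>K. if k = l then a k * cnj (a l) * of_real ((2 * pi)\<^sup>2) else 0)"
    by (intro sum.cong refl) (auto simp: torus_integral_mode)
  also have "\<dots> = (\<Sum>k\<in>K. of_real ((2 * pi)\<^sup>2) * of_real ((norm (a k))\<^sup>2))"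
    unfolding complex_norm_square using assms by (simp add: mult.commute)
  also have "\<dots> = complex_of_real ((2 * pi)\<^sup>2 * (\<Sum>k\<in>K. (norm (a k))\<^sup>2))"
    by (simp only: sum_distrib_left of_real_sum of_real_mult[of "(2 * pi)\<^sup>2"])
  finally show ?thesis by (simp only: of_real_eq_iff)
qed

abbreviation sobolev_sum :: "real \<Rightarrow> (int \<times> int) set \<Rightarrow> (int \<times> int \<Rightarrow> real) \<Rightarrow> real" where
  "sobolev_sum s K A \<equiv> \<Sum>k\<in>K. kbr k powr (2 * s) * A k"

section \<open>Wave packets and their products\<close>

text \<open>A sequence of trigonometric polynomials with the same finite set \<open>K\<close> of frequencies, or the conjugate of
  such a sequence. In the second case \<open>K\<close> and \<open>A\<close> still refer to the unconjugated sequence, so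
  that the modulation is always measured with the same sign.\<close>
definition wave_packet ::
    "real \<Rightarrow> real \<Rightarrow> (int \<times> int) set \<Rightarrow> (int \<times> int \<Rightarrow> real) \<Rightarrow> (int \<Rightarrow> real \<times> real \<Rightarrow> complex) \<Rightarrow> bool" where
  "wave_packet \<tau> b K A V \<longleftrightarrow> finite K \<and> K \<subseteq> freq_box \<tau> \<and>
     (\<exists>a. (\<forall>k\<in>K. modulated \<tau> b k (a k) (A k)) \<and>
       (V = (\<lambda>n. trig K (\<lambda>k. a k n)) \<or> V = (\<lambda>n x. cnj (trig K (\<lambda>k. a k n) x))))"

lemma wave_packet_finite: "wave_packet \<tau> b K A V \<Longrightarrow> finite K"
  by (simp add: wave_packet_def)

lemma wave_packet_nonneg: "wave_packet \<tau> b K A V \<Longrightarrow> k \<in> K \<Longrightarrow> 0 \<le> A k"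
  by (auto simp: wave_packet_def modulated_def)

lemma wave_packet_trig:
  assumes "wave_packet \<tau> b K A V"
  obtains K' a where "finite K'" "V n = trig K' a" "\<And>k. k \<in> K' \<Longrightarrow> \<exists>k'\<in>K. kbr k = kbr k'"
proof -
  from assms obtain a where fin: "finite K"
    and V: "V = (\<lambda>n. trig K (\<lambda>k. a k n)) \<or> V = (\<lambda>n x. cnj (trig K (\<lambda>k. a k n) x))"
    unfolding wave_packet_def by blast
  from V have "V n = trig K (\<lambda>k. a k n) \<or> V n = trig (uminus ` K) (\<lambda>k. cnj (a (- k) n))"
    by (auto simp: cnj_trig)
  then show ?thesis
  proof (elim disjE)
    assume "V n = trig K (\<lambda>k. a k n)"
    then show ?thesis using that fin by blast
  next
    assume V: "V n = trig (uminus ` K) (\<lambda>k. cnj (a (- k) n))"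
    show ?thesis
    proof (rule that[OF _ V])
      fix k assume "k \<in> uminus ` K"
      then obtain k' where "k' \<in> K" "k = - k'" by blast
      then show "\<exists>k'\<in>K. kbr k = kbr k'"
        by (intro bexI[of _ k']) (simp_all only: freq_minus jbracket_minus)
    qed (use fin in auto)
  qed
qed

lemma wave_packet_continuous: "wave_packet \<tau> b K A V \<Longrightarrow> continuous_on UNIV (V n)"
  by (elim wave_packet_trig[where n = n]) (auto intro: continuous_intros)

text \<open>The norm of a product is unchanged when a factor is conjugated, so both packets may be taken unconjugated; then
  Parseval in \<open>x\<close> turns the left-hand side into that of the bilinear estimate. As the two factors may be swapped, a bound for
  the frequencies of either of them will do.\<close>
lemma wave_packet_product_bound:
  fixes b \<gamma> :: real
  assumes b: "b > 3 / 8" and \<gamma>: "\<gamma> > 3 / 4"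
  obtains C where "C > 0"
    and "\<And>\<tau> R K1 K2 M A B V W. \<lbrakk>0 < \<tau>; \<tau> \<le> 1; R \<ge> 1; wave_packet \<tau> b K1 A V; wave_packet \<tau> b K2 B W; finite M;
        (\<forall>k\<in>K1. kbr k \<le> R) \<or> (\<forall>k\<in>K2. kbr k \<le> R)\<rbrakk> \<Longrightarrow>
      \<tau> * (\<Sum>n\<in>M. torus_integral (\<lambda>x. (norm (V n x * W n x))\<^sup>2)) \<le> C * R powr (2 * \<gamma>) * sum A K1 * sum B K2"
proof -
  define \<epsilon> where "\<epsilon> = 2 * \<gamma> - 3 / 2"
  have \<epsilon>: "\<epsilon> > 0" using \<gamma> by (simp add: \<epsilon>_def)
  show ?thesis
  proof (cases rule: bilinear_estimate[OF b \<epsilon>])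
  case (1 C)
    note C = 1(1) and bil = 1(2)
    have key: "\<tau> * (\<Sum>n\<in>M. torus_integral (\<lambda>x. (norm (V n x * W n x))\<^sup>2)) \<le> ((2 * pi)\<^sup>2 * C) * R powr (2 * \<gamma>) * sum A K1 * sum B K2"
      if \<tau>: "0 < \<tau>" "\<tau> \<le> 1" and R: "R \<ge> 1" and V: "wave_packet \<tau> b K1 A V" and W: "wave_packet \<tau> b K2 B W"
        and M: "finite M" and KR: "\<forall>k\<in>K2. kbr k \<le> R"
      for \<tau> R K1 K2 A B V W and M :: "int set"
    proof -
      from V obtain a where K1: "finite K1" "K1 \<subseteq> freq_box \<tau>" "\<And>k. k \<in> K1 \<Longrightarrow> modulated \<tau> b k (a k) (A k)"
        and "V = (\<lambda>n. trig K1 (\<lambda>k. a k n)) \<or> V = (\<lambda>n x. cnj (trig K1 (\<lambda>k. a k n) x))"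
        unfolding wave_packet_def by blast
      from this(4) have V': "norm (V n x) = norm (trig K1 (\<lambda>k. a k n) x)" for n x
        by auto
      from W obtain c where K2: "finite K2" "K2 \<subseteq> freq_box \<tau>" "\<And>k. k \<in> K2 \<Longrightarrow> modulated \<tau> b k (c k) (B k)"
        and "W = (\<lambda>n. trig K2 (\<lambda>k. c k n)) \<or> W = (\<lambda>n x. cnj (trig K2 (\<lambda>k. c k n) x))"
        unfolding wave_packet_def by blast
      from this(4) have W': "norm (W n x) = norm (trig K2 (\<lambda>k. c k n) x)" for n x
        by auto
      define L where "L = (\<lambda>(k, l). k + l) ` (K1 \<times> K2)"
      have L: "finite L" using K1 K2 by (simp add: L_def)
      have "torus_integral (\<lambda>x. (norm (V n x * W n x))\<^sup>2)
         = (2 * pi)\<^sup>2 * (\<Sum>l\<in>L. (norm (\<Sum>k | k \<in> K2 \<and> l - k \<in> K1. a (l - k) n * c k n))\<^sup>2)" for n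
        unfolding norm_mult V' W'
        unfolding norm_mult[symmetric] trig_mult[OF K1(1) K2(1)]
        by (subst torus_integral_norm_trig) (use L in \<open>auto simp: L_def\<close>)
      then have "\<tau> * (\<Sum>n\<in>M. torus_integral (\<lambda>x. (norm (V n x * W n x))\<^sup>2))
        = (2 * pi)\<^sup>2 * (\<tau> * (\<Sum>n\<in>M. \<Sum>l\<in>L. (norm (\<Sum>k | k \<in> K2 \<and> l - k \<in> K1. a (l - k) n * c k n))\<^sup>2))"
        by (simp only: sum_distrib_left[symmetric] mult.left_commute)
      also have "\<dots> \<le> (2 * pi)\<^sup>2 * (C * R powr (3 / 2 + \<epsilon>) * sum A K1 * sum B K2)"
        using \<tau> R K1 K2 L M KR by (intro mult_left_mono bil) auto
      also have "\<dots> = ((2 * pi)\<^sup>2 * C) * R powr (2 * \<gamma>) * sum A K1 * sum B K2"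
        by (simp add: \<epsilon>_def mult_ac)
      finally show ?thesis .
    qed
    show ?thesis
    proof
      show "(2 * pi)\<^sup>2 * C > 0" using C by simp
      fix \<tau> R K1 K2 A B V W and M :: "int set"
      assume *: "0 < \<tau>" "\<tau> \<le> 1" "R \<ge> 1" "wave_packet \<tau> b K1 A V" "wave_packet \<tau> b K2 B W" "finite M"
        and "(\<forall>k\<in>K1. kbr k \<le> R) \<or> (\<forall>k\<in>K2. kbr k \<le> R)"
      from this(7) show "\<tau> * (\<Sum>n\<in>M. torus_integral (\<lambda>x. (norm (V n x * W n x))\<^sup>2))
         \<le> ((2 * pi)\<^sup>2 * C) * R powr (2 * \<gamma>) * sum A K1 * sum B K2"
      proof
        assume "\<forall>k\<in>K2. kbr k \<le> R"
        then show ?thesis using key * by blast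
      next
        assume "\<forall>k\<in>K1. kbr k \<le> R"
        then have "\<tau> * (\<Sum>n\<in>M. torus_integral (\<lambda>x. (norm (W n x * V n x))\<^sup>2))
           \<le> ((2 * pi)\<^sup>2 * C) * R powr (2 * \<gamma>) * sum B K2 * sum A K1"
          using key * by blast
        then show ?thesis by (simp add: mult.commute mult.left_commute)
      qed
    qed
  qed
qed

text \<open>The infimum over \<open>t\<close> of the hypothesis; it is attained only if both bounds are positive, whence the limit.\<close>
lemma le_sqrt_of_am_gm:
  fixes X P Q :: real
  assumes "P \<ge> 0" "Q \<ge> 0" and "\<And>t. t > 0 \<Longrightarrow> X \<le> t / 2 * P + 1 / (2 * t) * Q"
  shows "X \<le> sqrt P * sqrt Q"
proof -
  have *: "X \<le> sqrt (P + e) * sqrt (Q + e)" if e: "e > 0" for e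
  proof -
    define p q where "p = sqrt (P + e)" and "q = sqrt (Q + e)"
    have p: "p > 0" "p\<^sup>2 = P + e" and q: "q > 0" "q\<^sup>2 = Q + e" using assms(1,2) e by (auto simp: p_def q_def)
    have "X \<le> (q / p) / 2 * P + 1 / (2 * (q / p)) * Q"
      using assms(3)[of "q / p"] p q by simp
    also have "\<dots> \<le> (q / p) / 2 * p\<^sup>2 + 1 / (2 * (q / p)) * q\<^sup>2"
      using p q e by (intro add_mono mult_left_mono) auto
    also have "\<dots> = p * q" using p(1) q(1) by (simp add: power2_eq_square field_simps)
    finally show ?thesis by (simp add: p_def q_def)
  qed
  have "((\<lambda>e. sqrt (P + e) * sqrt (Q + e)) \<longlongrightarrow> sqrt (P + 0) * sqrt (Q + 0)) (at_right 0)"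
    by (intro tendsto_intros)
  then have "((\<lambda>e. sqrt (P + e) * sqrt (Q + e)) \<longlongrightarrow> sqrt P * sqrt Q) (at_right 0)" by simp
  moreover have "eventually (\<lambda>e. X \<le> sqrt (P + e) * sqrt (Q + e)) (at_right 0)"
    using * by (auto simp: eventually_at_filter)
  ultimately show ?thesis
    by (intro tendsto_lowerbound) auto
qed

lemma time_torus_cauchy_schwarz:
  fixes F G :: "int \<Rightarrow> real \<times> real \<Rightarrow> complex"
  assumes \<tau>: "\<tau> > 0" and F: "\<And>n. continuous_on UNIV (F n)" and G: "\<And>n. continuous_on UNIV (G n)"
    and P: "\<tau> * (\<Sum>n\<in>M. torus_integral (\<lambda>x. (norm (F n x))\<^sup>2)) \<le> P"
    and Q: "\<tau> * (\<Sum>n\<in>M. torus_integral (\<lambda>x. (norm (G n x))\<^sup>2)) \<le> Q"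
  shows "norm (of_real \<tau> * (\<Sum>n\<in>M. torus_integral (\<lambda>x. F n x * G n x))) \<le> sqrt P * sqrt Q"
proof (rule le_sqrt_of_am_gm)
  have nn: "0 \<le> torus_integral (\<lambda>x. (norm (H x))\<^sup>2)" for H :: "real \<times> real \<Rightarrow> complex"
    unfolding set_lebesgue_integral_def by (intro Bochner_Integration.integral_nonneg) auto
  show "P \<ge> 0" by (rule order_trans[OF _ P]) (use \<tau> nn in \<open>auto intro!: mult_nonneg_nonneg sum_nonneg\<close>)
  show "Q \<ge> 0" by (rule order_trans[OF _ Q]) (use \<tau> nn in \<open>auto intro!: mult_nonneg_nonneg sum_nonneg\<close>)
  fix t :: real assume t: "t > 0"
  have each: "norm (torus_integral (\<lambda>x. F n x * G n x))
    \<le> t / 2 * torus_integral (\<lambda>x. (norm (F n x))\<^sup>2) + 1 / (2 * t) * torus_integral (\<lambda>x. (norm (G n x))\<^sup>2)" for n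
  proof -
    have c1: "continuous_on UNIV (\<lambda>x. F n x * G n x)" by (intro continuous_intros F G)
    have c2: "continuous_on UNIV (\<lambda>x. t / 2 * (norm (F n x))\<^sup>2)" "continuous_on UNIV (\<lambda>x. 1 / (2 * t) * (norm (G n x))\<^sup>2)"
      by (intro continuous_intros F G)+
    have c3: "continuous_on UNIV (\<lambda>x. t / 2 * (norm (F n x))\<^sup>2 + 1 / (2 * t) * (norm (G n x))\<^sup>2)"
      by (intro continuous_intros F G)
    have "norm (torus_integral (\<lambda>x. F n x * G n x)) \<le> torus_integral (\<lambda>x. norm (F n x * G n x))"
      by (intro set_integral_norm_bound torus_integrable c1)
    also have "\<dots> \<le> torus_integral (\<lambda>x. t / 2 * (norm (F n x))\<^sup>2 + 1 / (2 * t) * (norm (G n x))\<^sup>2)"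
    proof (intro set_integral_mono torus_integrable c3 continuous_on_norm c1)
      fix x
      have "norm (F n x) * norm (G n x) \<le> t / 2 * ((1 * (norm (F n x))\<^sup>2) * (1 * 1\<^sup>2)) + 1 / (2 * t) * ((norm (G n x))\<^sup>2 * ((1 / 1) * (1 / 1)))"
        using weighted_am_gm[of t 1 1 "norm (F n x)" 1 "norm (G n x)"] t by simp
      then show "norm (F n x * G n x) \<le> t / 2 * (norm (F n x))\<^sup>2 + 1 / (2 * t) * (norm (G n x))\<^sup>2"
        by (simp add: norm_mult)
    qed
    also have "\<dots> = torus_integral (\<lambda>x. t / 2 * (norm (F n x))\<^sup>2) + torus_integral (\<lambda>x. 1 / (2 * t) * (norm (G n x))\<^sup>2)"
      by (intro set_integral_add torus_integrable c2)
    finally show ?thesis by simp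
  qed
  have "norm (of_real \<tau> * (\<Sum>n\<in>M. torus_integral (\<lambda>x. F n x * G n x))) = \<tau> * norm (\<Sum>n\<in>M. torus_integral (\<lambda>x. F n x * G n x))"
    using \<tau> by (simp add: norm_mult)
  also have "\<dots> \<le> \<tau> * (\<Sum>n\<in>M. t / 2 * torus_integral (\<lambda>x. (norm (F n x))\<^sup>2) + 1 / (2 * t) * torus_integral (\<lambda>x. (norm (G n x))\<^sup>2))"
    using \<tau> by (intro mult_left_mono order_trans[OF norm_sum] sum_mono each) auto
  also have "\<dots> = t / 2 * (\<tau> * (\<Sum>n\<in>M. torus_integral (\<lambda>x. (norm (F n x))\<^sup>2))) + 1 / (2 * t) * (\<tau> * (\<Sum>n\<in>M. torus_integral (\<lambda>x. (norm (G n x))\<^sup>2)))"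
    unfolding sum.distrib sum_distrib_left[symmetric] by (simp only: distrib_left mult.left_commute)
  also have "\<dots> \<le> t / 2 * P + 1 / (2 * t) * Q"
    using t P Q by (intro add_mono mult_left_mono) auto
  finally show "norm (of_real \<tau> * (\<Sum>n\<in>M. torus_integral (\<lambda>x. F n x * G n x))) \<le> t / 2 * P + 1 / (2 * t) * Q" .
qed

section \<open>Dyadic summation of the quadrilinear form\<close>

abbreviation quad_form :: "real \<Rightarrow> int set \<Rightarrow> (int \<Rightarrow> real \<times> real \<Rightarrow> complex) \<Rightarrow> (int \<Rightarrow> real \<times> real \<Rightarrow> complex) \<Rightarrow>
    (int \<Rightarrow> real \<times> real \<Rightarrow> complex) \<Rightarrow> (int \<Rightarrow> real \<times> real \<Rightarrow> complex) \<Rightarrow> complex" where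
  "quad_form \<tau> M V1 V2 V3 V4 \<equiv>
     of_real \<tau> * (\<Sum>n\<in>M. torus_integral (\<lambda>x. V1 n x * V2 n x * (V3 n x * V4 n x)))"

lemma packet_pairing_bound:
  fixes b \<gamma> :: real
  assumes b: "b > 3 / 8" and \<gamma>: "\<gamma> > 3 / 4"
  obtains C where "C > 0"
    and "\<And>\<tau> K1 K2 K3 K4 A1 A2 A3 A4 V1 V2 V3 V4 i1 i2 i3 i4 M. \<lbrakk>0 < \<tau>; \<tau> \<le> 1; finite M;
        wave_packet \<tau> b K1 A1 V1; wave_packet \<tau> b K2 A2 V2; wave_packet \<tau> b K3 A3 V3; wave_packet \<tau> b K4 A4 V4;
        \<And>k. k \<in> K1 \<Longrightarrow> kbr k \<le> 2 ^ Suc i1; \<And>k. k \<in> K2 \<Longrightarrow> kbr k \<le> 2 ^ Suc i2;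
        \<And>k. k \<in> K3 \<Longrightarrow> kbr k \<le> 2 ^ Suc i3; \<And>k. k \<in> K4 \<Longrightarrow> kbr k \<le> 2 ^ Suc i4\<rbrakk> \<Longrightarrow>
      norm (quad_form \<tau> M V1 V2 V3 V4)
        \<le> C * 2 powr (\<gamma> * (real (min i1 i2) + real (min i3 i4)))
            * (sqrt (sum A1 K1) * sqrt (sum A2 K2) * sqrt (sum A3 K3) * sqrt (sum A4 K4))"
proof -
  show ?thesis
  proof (cases rule: wave_packet_product_bound[OF b \<gamma>])
  case (1 C)
    note C = 1(1) and prod = 1(2)
    have two: "(2 ^ Suc i :: real) powr (2 * \<gamma>) = (2 powr (\<gamma> * (real i + 1)))\<^sup>2" for i
      by (simp add: powr_realpow[symmetric] powr_powr algebra_simps flip: powr_add powr_numeral power_Suc)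
    have pair: "sqrt (C * (2 ^ Suc i) powr (2 * \<gamma>) * X * Y) = sqrt C * 2 powr (\<gamma> * (real i + 1)) * sqrt X * sqrt Y" for i X Y
      unfolding two by (simp add: real_sqrt_mult)
    show ?thesis
    proof
      show "C * 2 powr (2 * \<gamma>) > 0" using C by simp
      fix \<tau> K1 K2 K3 K4 A1 A2 A3 A4 V1 V2 V3 V4 i1 i2 i3 i4 and M :: "int set"
      assume \<tau>: "0 < \<tau>" "\<tau> \<le> 1" and M: "finite M"
        and V: "wave_packet \<tau> b K1 A1 V1" "wave_packet \<tau> b K2 A2 V2" "wave_packet \<tau> b K3 A3 V3" "wave_packet \<tau> b K4 A4 V4"
        and K: "\<And>k. k \<in> K1 \<Longrightarrow> kbr k \<le> 2 ^ Suc i1" "\<And>k. k \<in> K2 \<Longrightarrow> kbr k \<le> 2 ^ Suc i2"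
          "\<And>k. k \<in> K3 \<Longrightarrow> kbr k \<le> 2 ^ Suc i3" "\<And>k. k \<in> K4 \<Longrightarrow> kbr k \<le> 2 ^ Suc i4"
      have R: "(1::real) \<le> 2 ^ Suc i" for i by (rule one_le_power) simp
      have "norm (quad_form \<tau> M V1 V2 V3 V4)
         \<le> sqrt (C * (2 ^ Suc (min i1 i2)) powr (2 * \<gamma>) * sum A1 K1 * sum A2 K2)
           * sqrt (C * (2 ^ Suc (min i3 i4)) powr (2 * \<gamma>) * sum A3 K3 * sum A4 K4)"
      proof (rule time_torus_cauchy_schwarz[OF \<tau>(1)])
        show "\<tau> * (\<Sum>n\<in>M. torus_integral (\<lambda>x. (norm (V1 n x * V2 n x))\<^sup>2))
            \<le> C * (2 ^ Suc (min i1 i2)) powr (2 * \<gamma>) * sum A1 K1 * sum A2 K2"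
          by (rule prod[OF \<tau> R V(1,2) M]) (use K(1,2) in \<open>auto simp: min_def\<close>)
        show "\<tau> * (\<Sum>n\<in>M. torus_integral (\<lambda>x. (norm (V3 n x * V4 n x))\<^sup>2))
            \<le> C * (2 ^ Suc (min i3 i4)) powr (2 * \<gamma>) * sum A3 K3 * sum A4 K4"
          by (rule prod[OF \<tau> R V(3,4) M]) (use K(3,4) in \<open>auto simp: min_def\<close>)
      qed (intro continuous_on_mult wave_packet_continuous[OF V(1)] wave_packet_continuous[OF V(2)]
          wave_packet_continuous[OF V(3)] wave_packet_continuous[OF V(4)])+
      also have "\<dots> = (sqrt C * sqrt C) * (2 powr (\<gamma> * (real (min i1 i2) + 1)) * 2 powr (\<gamma> * (real (min i3 i4) + 1)))
          * (sqrt (sum A1 K1) * sqrt (sum A2 K2) * sqrt (sum A3 K3) * sqrt (sum A4 K4))"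
        unfolding pair by (simp only: mult_ac)
      also have "2 powr (\<gamma> * (real (min i1 i2) + 1)) * 2 powr (\<gamma> * (real (min i3 i4) + 1))
         = 2 powr (2 * \<gamma>) * 2 powr (\<gamma> * (real (min i1 i2) + real (min i3 i4)))"
        unfolding powr_add[symmetric] by (rule arg_cong[where f = "(powr) 2"]) (simp add: algebra_simps)
      also have "sqrt C * sqrt C = C" using C by simp
      finally show "norm (quad_form \<tau> M V1 V2 V3 V4)
          \<le> C * 2 powr (2 * \<gamma>) * 2 powr (\<gamma> * (real (min i1 i2) + real (min i3 i4)))
              * (sqrt (sum A1 K1) * sqrt (sum A2 K2) * sqrt (sum A3 K3) * sqrt (sum A4 K4))"
        by (simp only: mult.assoc)
    qed
  qed
qed

text \<open>The integral picks out frequencies with \<open>k\<^sub>1 + k\<^sub>2 + k\<^sub>3 + k\<^sub>4 = 0\<close>, and brackets are subadditive.\<close>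
lemma packet_orthogonality:
  assumes V: "wave_packet \<tau> b K1 A1 V1" "wave_packet \<tau> b K2 A2 V2" "wave_packet \<tau> b K3 A3 V3" "wave_packet \<tau> b K4 A4 V4"
    and K: "\<And>k. k \<in> K1 \<Longrightarrow> kbr k \<le> r1" "\<And>k. k \<in> K2 \<Longrightarrow> kbr k \<le> r2"
      "\<And>k. k \<in> K3 \<Longrightarrow> kbr k \<le> r3" "\<And>k. k \<in> K4 \<Longrightarrow> r1 + r2 + r3 < kbr k"
  shows "torus_integral (\<lambda>x. V1 n x * V2 n x * (V3 n x * V4 n x)) = 0"
proof -
  obtain L1 a1 where 1: "finite L1" "V1 n = trig L1 a1" "\<And>k. k \<in> L1 \<Longrightarrow> kbr k \<le> r1"
    using wave_packet_trig[OF V(1), of n] K(1) by metis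
  obtain L2 a2 where 2: "finite L2" "V2 n = trig L2 a2" "\<And>k. k \<in> L2 \<Longrightarrow> kbr k \<le> r2"
    using wave_packet_trig[OF V(2), of n] K(2) by metis
  obtain L3 a3 where 3: "finite L3" "V3 n = trig L3 a3" "\<And>k. k \<in> L3 \<Longrightarrow> kbr k \<le> r3"
    using wave_packet_trig[OF V(3), of n] K(3) by metis
  obtain L4 a4 where 4: "finite L4" "V4 n = trig L4 a4" "\<And>k. k \<in> L4 \<Longrightarrow> r1 + r2 + r3 < kbr k"
    using wave_packet_trig[OF V(4), of n] K(4) by metis
  define S where "S A B = (\<lambda>(k, l). k + l) ` (A \<times> B)" for A B :: "(int \<times> int) set"
  have fin: "finite (S A B)" if "finite A" "finite B" for A B using that by (simp add: S_def)
  have S0: "0 \<notin> S (S L1 L2) (S L3 L4)"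
  proof
    assume "0 \<in> S (S L1 L2) (S L3 L4)"
    then obtain k1 k2 k3 k4 where k: "k1 \<in> L1" "k2 \<in> L2" "k3 \<in> L3" "k4 \<in> L4" and "0 = k1 + k2 + (k3 + k4)"
      unfolding S_def by auto
    from this(5) have e: "k4 = - (k1 + k2 + k3)"
      by (metis (no_types, opaque_lifting) add.assoc add.commute add_eq_0_iff)
    have "kbr k4 \<le> kbr (k1 + k2) + kbr k3"
      unfolding e freq_minus jbracket_minus freq_add by (intro jbracket_le_add norm_triangle_ineq)
    also have "kbr (k1 + k2) \<le> kbr k1 + kbr k2"
      unfolding freq_add by (intro jbracket_le_add norm_triangle_ineq)
    finally show False using 1(3)[OF k(1)] 2(3)[OF k(2)] 3(3)[OF k(3)] 4(3)[OF k(4)] by simp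
  qed
  have "\<exists>z. (\<lambda>x. V1 n x * V2 n x * (V3 n x * V4 n x)) = trig (S (S L1 L2) (S L3 L4)) z"
    unfolding 1(2) 2(2) 3(2) 4(2) trig_mult[OF 1(1) 2(1)] trig_mult[OF 3(1) 4(1)] S_def[symmetric]
      trig_mult[OF fin[OF 1(1) 2(1)] fin[OF 3(1) 4(1)]] by blast
  then show ?thesis
    using torus_integral_trig[of "S (S L1 L2) (S L3 L4)"] S0 fin 1 2 3 4 by auto
qed

definition dyadic_shell :: "nat \<Rightarrow> (int \<times> int) set" where
  "dyadic_shell j = {k. 2 ^ j \<le> kbr k \<and> kbr k < 2 ^ Suc j}"

lemma dyadic_shell_ex: "\<exists>j. k \<in> dyadic_shell j"
proof -
  define r where "r = kbr k"
  have r: "1 \<le> r" by (simp add: r_def jbracket_ge_1)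
  define m where "m = nat \<lfloor>r\<rfloor>"
  have m1: "1 \<le> m" using r by (simp add: m_def le_nat_iff)
  have mr: "real m \<le> r" "r < real m + 1" using r unfolding m_def by linarith+
  obtain j where j: "2 ^ j \<le> m" "m < 2 ^ (j + 1)"
    using ex_power_ivl1[of 2 m] m1 by auto
  have "real (2 ^ j) \<le> real m" using j(1) by (simp only: of_nat_le_iff)
  then have 1: "(2::real) ^ j \<le> real m" by (simp only: of_nat_power of_nat_numeral)
  have "real (Suc m) \<le> real (2 ^ (j + 1))" using j(2) by (simp only: of_nat_le_iff Suc_le_eq)
  then have 2: "real m + 1 \<le> 2 * 2 ^ j" by (simp add: add.commute)
  show ?thesis using order_trans[OF 1 mr(1)] less_le_trans[OF mr(2) 2] by (intro exI[of _ j]) (auto simp: dyadic_shell_def r_def[symmetric])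
qed

lemma dyadic_shell_disjoint:
  assumes "k \<in> dyadic_shell i" "k \<in> dyadic_shell j"
  shows "i = j"
proof -
  have "i < Suc j" if "k \<in> dyadic_shell i" "k \<in> dyadic_shell j" for i j
  proof -
    have "(2::real) ^ i < 2 ^ Suc j" using that by (auto simp: dyadic_shell_def intro: le_less_trans)
    then show ?thesis by (rule power_less_imp_less_exp[rotated]) simp
  qed
  from this[OF assms] this[OF assms(2,1)] show ?thesis by simp
qed

lemma wave_packet_dyadic:
  assumes "wave_packet \<tau> b K A V"
  obtains P J where "\<And>j. wave_packet \<tau> b (K \<inter> dyadic_shell j) A (P j)"
    and "\<And>J' n x. J \<le> J' \<Longrightarrow> V n x = (\<Sum>j\<le>J'. P j n x)"
proof -
  from assms obtain a where fin: "finite K" and K: "K \<subseteq> freq_box \<tau>"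
    and mod: "\<forall>k\<in>K. modulated \<tau> b k (a k) (A k)"
    and V: "V = (\<lambda>n. trig K (\<lambda>k. a k n)) \<or> V = (\<lambda>n x. cnj (trig K (\<lambda>k. a k n) x))"
    unfolding wave_packet_def by blast
  obtain j where j: "\<And>k. k \<in> dyadic_shell (j k)" using dyadic_shell_ex by metis
  obtain J where J: "\<And>k. k \<in> K \<Longrightarrow> j k \<le> J"
    using finite_imageI[OF fin, of j] by (meson finite_nat_set_iff_bounded_le imageI)
  have split: "trig K c x = (\<Sum>i\<le>J'. trig (K \<inter> dyadic_shell i) c x)" if "J \<le> J'" for J' c x
  proof -
    have "K = (\<Union>i\<in>{..J'}. K \<inter> dyadic_shell i)"
      using J j that by (fastforce intro: order_trans)
    then have "trig K c x = (\<Sum>k\<in>(\<Union>i\<in>{..J'}. K \<inter> dyadic_shell i). c k * mode k x)"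
      unfolding trig_def by simp
    also have "\<dots> = (\<Sum>i\<le>J'. trig (K \<inter> dyadic_shell i) c x)"
      unfolding trig_def using fin by (intro sum.UNION_disjoint) (auto dest: dyadic_shell_disjoint)
    finally show ?thesis .
  qed
  from V show ?thesis
  proof
    assume V: "V = (\<lambda>n. trig K (\<lambda>k. a k n))"
    show ?thesis
    proof (rule that[of "\<lambda>j n. trig (K \<inter> dyadic_shell j) (\<lambda>k. a k n)" J])
      show "wave_packet \<tau> b (K \<inter> dyadic_shell j) A (\<lambda>n. trig (K \<inter> dyadic_shell j) (\<lambda>k. a k n))" for j
        unfolding wave_packet_def using fin K mod by blast
    qed (simp add: V split)
  next
    assume V: "V = (\<lambda>n x. cnj (trig K (\<lambda>k. a k n) x))"
    show ?thesis
    proof (rule that[of "\<lambda>j n x. cnj (trig (K \<inter> dyadic_shell j) (\<lambda>k. a k n) x)" J])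
      show "wave_packet \<tau> b (K \<inter> dyadic_shell j) A (\<lambda>n x. cnj (trig (K \<inter> dyadic_shell j) (\<lambda>k. a k n) x))" for j
        unfolding wave_packet_def using fin K mod by blast
    qed (simp add: V split)
  qed
qed

text \<open>The exponent arithmetic on dyadic scale. The frequency sizes are \<open>2\<^sup>i, 2\<^sup>j, 2\<^sup>k, 2\<^sup>l\<close>; each alternative belongs to
  one of the three ways to pair four factors, and its left-hand side is the loss of the two
  product estimates. The Sobolev exponents must pay for the loss and still leave \<open>\<delta>\<close> in each factor for
  the summation. Sizes \<open>l\<close> beyond \<open>max i (max j k) + 3\<close> are excluded by orthogonality.\<close>
definition admissible :: "real \<Rightarrow> real \<Rightarrow> real \<Rightarrow> real \<Rightarrow> real \<Rightarrow> real \<Rightarrow> real \<Rightarrow> bool" where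
  "admissible \<gamma> \<delta> B s1 s2 s3 s4 \<longleftrightarrow>
    (\<forall>i j k l :: nat. l \<le> max i (max j k) + 3 \<longrightarrow>
      (let X = (s1 - \<delta>) * real i + (s2 - \<delta>) * real j + (s3 - \<delta>) * real k + (s4 - \<delta>) * real l + B in
       \<gamma> * (real (min i j) + real (min k l)) \<le> X \<or> \<gamma> * (real (min i k) + real (min j l)) \<le> X \<or>
       \<gamma> * (real (min j k) + real (min i l)) \<le> X))"

lemma admissible_equal:
  assumes "s > 3 / 8"
  obtains \<gamma> \<delta> where "\<gamma> > 3 / 4" "\<delta> > 0" "admissible \<gamma> \<delta> 0 s s s s"
proof
  define \<delta> where "\<delta> = (s - 3 / 8) / 2"
  show "\<delta> > 0" using assms by (simp add: \<delta>_def)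
  show "3 / 4 + 2 * \<delta> > 3 / 4" using \<open>\<delta> > 0\<close> by simp
  define w where "w = s - \<delta>"
  have sd: "3 / 4 + 2 * \<delta> = 2 * w" by (simp add: w_def \<delta>_def field_simps)
  have w: "w > 0" using \<open>\<delta> > 0\<close> sd by simp
  have "(3 / 4 + 2 * \<delta>) * (real (min i j) + real (min k l)) \<le>
     (s - \<delta>) * real i + (s - \<delta>) * real j + (s - \<delta>) * real k + (s - \<delta>) * real l + 0" for i j k l :: nat
  proof -
    have "w * (2 * (real (min i j) + real (min k l))) \<le> w * (real i + real j + real k + real l)"
      using w by (intro mult_left_mono) (auto simp: min_def)
    then show ?thesis unfolding sd w_def[symmetric] by (simp add: algebra_simps)
  qed
  then show "admissible (3 / 4 + 2 * \<delta>) \<delta> 0 s s s s" unfolding admissible_def Let_def by blast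
qed

text \<open>Here \<open>109/400 = 11/40 - 1/400\<close> and \<open>289/400 = 29/40 - 1/400\<close>, with \<open>301/400\<close> in place of \<open>3/4\<close>. The good
  pairing separates the two largest sizes. It works since the four coefficients add up to \<open>616 \<ge> 2 * 301\<close> and
  the three smallest ones to \<open>327 \<ge> 301\<close>.\<close>
lemma pairing_arith:
  fixes a b c d :: real
  assumes "0 \<le> a" "0 \<le> b" "0 \<le> c" "0 \<le> d"
  shows "301 * (min a b + min c d) \<le> 109 * a + 109 * b + 109 * c + 289 * d \<or>
     301 * (min a c + min b d) \<le> 109 * a + 109 * b + 109 * c + 289 * d \<or>
     301 * (min b c + min a d) \<le> 109 * a + 109 * b + 109 * c + 289 * d"
  using assms by (smt (verit))

text \<open>The hypothesis on \<open>s4\<close> says that \<open>(s1, s2, s3, s4)\<close> is at least as good as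
  \<open>(11/40, 11/40, 11/40, 29/40)\<close> on the sizes that occur; \<open>s4\<close> itself may be negative.\<close>
lemma admissible_trilinear:
  assumes s: "s1 \<ge> 11 / 40" "s2 \<ge> 11 / 40" "s3 \<ge> 11 / 40"
    and s4: "\<And>i j k l :: nat. l \<le> max i (max j k) + 3 \<Longrightarrow>
      11 / 40 * (real i + real j + real k) + 29 / 40 * real l \<le> s1 * real i + s2 * real j + s3 * real k + s4 * real l + B"
  shows "admissible (301 / 400) (1 / 400) B s1 s2 s3 s4"
  unfolding admissible_def Let_def
proof (intro allI impI)
  fix i j k l :: nat
  assume "l \<le> max i (max j k) + 3"
  from s4[OF this] have X: "(109 * i + 109 * j + 109 * k + 289 * l) / 400
     \<le> (s1 - 1 / 400) * real i + (s2 - 1 / 400) * real j + (s3 - 1 / 400) * real k + (s4 - 1 / 400) * real l + B"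
    by (simp add: algebra_simps add_divide_distrib)
  have le: "301 / 400 * Y \<le> (s1 - 1 / 400) * real i + (s2 - 1 / 400) * real j + (s3 - 1 / 400) * real k + (s4 - 1 / 400) * real l + B"
    if "301 * Y \<le> 109 * real i + 109 * real j + 109 * real k + 289 * real l" for Y
    by (rule order_trans[OF _ X]) (use that in simp)
  show "301 / 400 * (real (min i j) + real (min k l)) \<le> (s1 - 1 / 400) * real i + (s2 - 1 / 400) * real j + (s3 - 1 / 400) * real k + (s4 - 1 / 400) * real l + B \<or>
    301 / 400 * (real (min i k) + real (min j l)) \<le> (s1 - 1 / 400) * real i + (s2 - 1 / 400) * real j + (s3 - 1 / 400) * real k + (s4 - 1 / 400) * real l + B \<or>
    301 / 400 * (real (min j k) + real (min i l)) \<le> (s1 - 1 / 400) * real i + (s2 - 1 / 400) * real j + (s3 - 1 / 400) * real k + (s4 - 1 / 400) * real l + B"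
    using pairing_arith[OF of_nat_0_le_iff of_nat_0_le_iff of_nat_0_le_iff of_nat_0_le_iff, of i j k l] le
    unfolding of_nat_min by blast
qed

lemma sum4_product:
  fixes a b c d :: "nat \<Rightarrow> 'a::comm_semiring_0"
  shows "(\<Sum>i\<in>I. a i) * (\<Sum>i\<in>I. b i) * ((\<Sum>i\<in>I. c i) * (\<Sum>i\<in>I. d i))
    = (\<Sum>i\<in>I. \<Sum>k\<in>I. \<Sum>j\<in>I. \<Sum>l\<in>I. a i * b j * (c k * d l))"
  by (simp only: sum_product)

text \<open>On each quadruple of dyadic shells the best of the three pairings is used, and the Sobolev weights are
  constant up to the factor \<open>2 powr \<bar>s\<bar>\<close>. What is left is a product of four geometric series with
  ratio \<open>2 powr -\<delta>\<close>.\<close>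
lemma quadrilinear_estimate:
  fixes b \<gamma> \<delta> B s1 s2 s3 s4 :: real
  assumes b: "b > 3 / 8" and \<gamma>: "\<gamma> > 3 / 4" and \<delta>: "\<delta> > 0" and adm: "admissible \<gamma> \<delta> B s1 s2 s3 s4"
  obtains C where "C > 0"
    and "\<And>\<tau> K1 K2 K3 K4 A1 A2 A3 A4 V1 V2 V3 V4 S1 S2 S3 S4 M. \<lbrakk>0 < \<tau>; \<tau> \<le> 1; finite M;
        wave_packet \<tau> b K1 A1 V1; wave_packet \<tau> b K2 A2 V2; wave_packet \<tau> b K3 A3 V3; wave_packet \<tau> b K4 A4 V4;
        sobolev_sum s1 K1 A1 \<le> S1; sobolev_sum s2 K2 A2 \<le> S2;
        sobolev_sum s3 K3 A3 \<le> S3; sobolev_sum s4 K4 A4 \<le> S4\<rbrakk> \<Longrightarrow>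
      norm (quad_form \<tau> M V1 V2 V3 V4)
        \<le> C * (sqrt S1 * sqrt S2 * sqrt S3 * sqrt S4)"
proof -
  show ?thesis
  proof (cases rule: packet_pairing_bound[OF b \<gamma>])
  case (1 C)
    note C = 1(1) and pair = 1(2)
    define E where "E = 2 powr (\<bar>s1\<bar> + \<bar>s2\<bar> + \<bar>s3\<bar> + \<bar>s4\<bar> + B)"
    define q where "q = 2 powr - \<delta>"
    have q: "0 < q" "q < 1" using \<delta> by (auto simp: q_def powr_less_one)
    define G where "G = 1 / (1 - q)"
    have G: "G > 0" using q by (simp add: G_def)
    have geom: "(\<Sum>j\<le>J. q ^ j) \<le> G" for J
    proof -
      have "(\<Sum>j\<le>J. q ^ j) = (1 - q ^ Suc J) / (1 - q)" using q by (simp add: sum_gp0)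
      also have "\<dots> \<le> G" unfolding G_def using q by (intro divide_right_mono) auto
      finally show ?thesis .
    qed
    have shell: "sqrt (\<Sum>k\<in>K \<inter> dyadic_shell j. A k) \<le> 2 powr (\<bar>s\<bar> - s * real j) * sqrt S"
      if K: "finite K" and A: "\<And>k. k \<in> K \<Longrightarrow> 0 \<le> A k" and S: "sobolev_sum s K A \<le> S"
      for K A s S and j :: nat
    proof -
      have w: "2 powr (2 * (s * real j - \<bar>s\<bar>)) \<le> kbr k powr (2 * s)" if k: "k \<in> dyadic_shell j" for k
      proof (cases "s \<ge> 0")
        case True
        have "2 powr (2 * (s * real j - \<bar>s\<bar>)) \<le> 2 powr (real j * (2 * s))"
          using True by (intro powr_mono) (auto simp: algebra_simps)
        also have "\<dots> = (2 ^ j) powr (2 * s)" by (simp add: powr_realpow[symmetric] powr_powr)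
        also have "\<dots> \<le> kbr k powr (2 * s)"
          using k True by (intro powr_mono2) (auto simp: dyadic_shell_def)
        finally show ?thesis .
      next
        case False
        have "2 powr (2 * (s * real j - \<bar>s\<bar>)) = 2 powr (real (Suc j) * (2 * s))"
          using False by (intro arg_cong[where f = "(powr) 2"]) (auto simp: algebra_simps)
        also have "\<dots> = (2 ^ Suc j) powr (2 * s)" by (simp add: powr_realpow[symmetric] powr_powr del: power_Suc of_nat_Suc)
        also have "\<dots> \<le> kbr k powr (2 * s)"
          using k False jbracket_pos[of "freq k"] by (intro powr_mono2') (auto simp: dyadic_shell_def)
        finally show ?thesis .
      qed
      have "2 powr (2 * (s * real j - \<bar>s\<bar>)) * (\<Sum>k\<in>K \<inter> dyadic_shell j. A k) = (\<Sum>k\<in>K \<inter> dyadic_shell j. 2 powr (2 * (s * real j - \<bar>s\<bar>)) * A k)"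
        by (rule sum_distrib_left)
      also have "\<dots> \<le> (\<Sum>k\<in>K \<inter> dyadic_shell j. kbr k powr (2 * s) * A k)"
        using A w by (intro sum_mono mult_right_mono) auto
      also have "\<dots> \<le> (sobolev_sum s K A)"
        using A K by (intro sum_mono2) auto
      also have "\<dots> \<le> S" by (rule S)
      finally have *: "2 powr (2 * (s * real j - \<bar>s\<bar>)) * (\<Sum>k\<in>K \<inter> dyadic_shell j. A k) \<le> S" .
      have "(\<Sum>k\<in>K \<inter> dyadic_shell j. A k)
         = 2 powr (2 * (\<bar>s\<bar> - s * real j)) * (2 powr (2 * (s * real j - \<bar>s\<bar>)) * (\<Sum>k\<in>K \<inter> dyadic_shell j. A k))"
        unfolding mult.assoc[symmetric] powr_add[symmetric] by (simp add: algebra_simps)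
      also have "\<dots> \<le> 2 powr (2 * (\<bar>s\<bar> - s * real j)) * S"
        using * by (intro mult_left_mono) auto
      also have "2 powr (2 * (\<bar>s\<bar> - s * real j)) = (2 powr (\<bar>s\<bar> - s * real j))\<^sup>2"
        by (simp add: powr_powr mult.commute flip: powr_numeral)
      finally have "sqrt (\<Sum>k\<in>K \<inter> dyadic_shell j. A k) \<le> sqrt ((2 powr (\<bar>s\<bar> - s * real j))\<^sup>2 * S)"
        by (rule real_sqrt_le_mono)
      then show ?thesis by (simp add: real_sqrt_mult)
    qed
    show ?thesis
    proof
      show "C * E * G ^ 4 > 0" using C G by (simp add: E_def)
      fix \<tau> K1 K2 K3 K4 A1 A2 A3 A4 V1 V2 V3 V4 S1 S2 S3 S4 and M :: "int set"
      assume \<tau>: "0 < \<tau>" "\<tau> \<le> 1" and M: "finite M"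
        and V: "wave_packet \<tau> b K1 A1 V1" "wave_packet \<tau> b K2 A2 V2" "wave_packet \<tau> b K3 A3 V3" "wave_packet \<tau> b K4 A4 V4"
        and S: "sobolev_sum s1 K1 A1 \<le> S1" "sobolev_sum s2 K2 A2 \<le> S2"
          "sobolev_sum s3 K3 A3 \<le> S3" "sobolev_sum s4 K4 A4 \<le> S4"
      obtain P1 J1 where P1: "\<And>j. wave_packet \<tau> b (K1 \<inter> dyadic_shell j) A1 (P1 j)"
        "\<And>J' n x. J1 \<le> J' \<Longrightarrow> V1 n x = (\<Sum>j\<le>J'. P1 j n x)" using wave_packet_dyadic[OF V(1)] by blast
      obtain P2 J2 where P2: "\<And>j. wave_packet \<tau> b (K2 \<inter> dyadic_shell j) A2 (P2 j)"
        "\<And>J' n x. J2 \<le> J' \<Longrightarrow> V2 n x = (\<Sum>j\<le>J'. P2 j n x)" using wave_packet_dyadic[OF V(2)] by blast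
      obtain P3 J3 where P3: "\<And>j. wave_packet \<tau> b (K3 \<inter> dyadic_shell j) A3 (P3 j)"
        "\<And>J' n x. J3 \<le> J' \<Longrightarrow> V3 n x = (\<Sum>j\<le>J'. P3 j n x)" using wave_packet_dyadic[OF V(3)] by blast
      obtain P4 J4 where P4: "\<And>j. wave_packet \<tau> b (K4 \<inter> dyadic_shell j) A4 (P4 j)"
        "\<And>J' n x. J4 \<le> J' \<Longrightarrow> V4 n x = (\<Sum>j\<le>J'. P4 j n x)" using wave_packet_dyadic[OF V(4)] by blast
      define J where "J = J1 + J2 + J3 + J4"
      define T where "T i k j l = quad_form \<tau> M (P1 i) (P2 j) (P3 k) (P4 l)" for i k j l
      have cont: "continuous_on UNIV (P1 i n)" "continuous_on UNIV (P2 i n)" "continuous_on UNIV (P3 i n)" "continuous_on UNIV (P4 i n)" for i n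
        using P1(1) P2(1) P3(1) P4(1) wave_packet_continuous by blast+
      have "quad_form \<tau> M V1 V2 V3 V4
         = of_real \<tau> * (\<Sum>n\<in>M. torus_integral (\<lambda>x. \<Sum>i\<le>J. \<Sum>k\<le>J. \<Sum>j\<le>J. \<Sum>l\<le>J. P1 i n x * P2 j n x * (P3 k n x * P4 l n x)))"
      proof -
        have "V1 n x * V2 n x * (V3 n x * V4 n x) = (\<Sum>i\<le>J. \<Sum>k\<le>J. \<Sum>j\<le>J. \<Sum>l\<le>J. P1 i n x * P2 j n x * (P3 k n x * P4 l n x))" for n x
          using P1(2)[of J n x] P2(2)[of J n x] P3(2)[of J n x] P4(2)[of J n x] by (simp add: J_def sum4_product)
        then show ?thesis by simp
      qed
      also have "\<dots> = of_real \<tau> * (\<Sum>n\<in>M. \<Sum>i\<le>J. \<Sum>k\<le>J. \<Sum>j\<le>J. \<Sum>l\<le>J. torus_integral (\<lambda>x. P1 i n x * P2 j n x * (P3 k n x * P4 l n x)))"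
        by (subst torus_integral_sum, (intro continuous_intros cont)[1])+ (rule refl)
      also have "\<dots> = (\<Sum>i\<le>J. \<Sum>k\<le>J. \<Sum>j\<le>J. \<Sum>l\<le>J. T i k j l)"
        unfolding T_def sum_distrib_left
        by (subst sum.swap, rule sum.cong[OF refl])+ (rule refl)
      finally have eq: "quad_form \<tau> M V1 V2 V3 V4
         = (\<Sum>i\<le>J. \<Sum>k\<le>J. \<Sum>j\<le>J. \<Sum>l\<le>J. T i k j l)" .
      have K_le: "kbr k \<le> 2 ^ Suc i" if "k \<in> K \<inter> dyadic_shell i" for k K i
        using that by (simp add: dyadic_shell_def)
      define N where "N = sqrt S1 * sqrt S2 * sqrt S3 * sqrt S4"
      have "0 \<le> S'" if "wave_packet \<tau> b K A V" "sobolev_sum s K A \<le> S'" for K A V s S'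
        by (rule order_trans[OF sum_nonneg that(2)]) (simp add: wave_packet_nonneg[OF that(1)])
      from this[OF V(1) S(1)] this[OF V(2) S(2)] this[OF V(3) S(3)] this[OF V(4) S(4)]
      have S0: "0 \<le> S1" "0 \<le> S2" "0 \<le> S3" "0 \<le> S4" .
      have T_le: "norm (T i k j l) \<le> (C * E * N) * (q ^ i * q ^ j * (q ^ k * q ^ l))" for i k j l
      proof (cases "l \<le> max i (max j k) + 3")
        case False
        define m where "m = max i (max j k)"
        have "T i k j l = 0"
        proof -
          have "torus_integral (\<lambda>x. P1 i n x * P2 j n x * (P3 k n x * P4 l n x)) = 0" for n
          proof (rule packet_orthogonality[OF P1(1) P2(1) P3(1) P4(1), where ?r1.0 = "2 ^ Suc i" and ?r2.0 = "2 ^ Suc j" and ?r3.0 = "2 ^ Suc k"])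
            fix \<kappa> assume "\<kappa> \<in> K4 \<inter> dyadic_shell l"
            then have l: "(2::real) ^ l \<le> kbr \<kappa>" by (simp add: dyadic_shell_def)
            have "(2::real) ^ Suc i \<le> 2 ^ Suc m" "(2::real) ^ Suc j \<le> 2 ^ Suc m" "(2::real) ^ Suc k \<le> 2 ^ Suc m"
              by (intro power_increasing; simp add: m_def)+
            moreover have "(2::real) ^ (m + 3) \<le> 2 ^ l" using False by (intro power_increasing) (auto simp: m_def)
            moreover have "(2::real) ^ (m + 3) = 4 * 2 ^ Suc m" by (simp add: power_add)
            moreover have "(0::real) < 2 ^ Suc m" by simp
            ultimately show "2 ^ Suc i + 2 ^ Suc j + 2 ^ Suc k < kbr \<kappa>" using l by argo
          qed (erule K_le)+
          then show ?thesis by (simp add: T_def)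
        qed
        moreover have "0 \<le> N" using S0 by (simp add: N_def)
        ultimately show ?thesis using C q by (simp add: E_def)
      next
        case True
        define X where "X = (s1 - \<delta>) * real i + (s2 - \<delta>) * real j + (s3 - \<delta>) * real k + (s4 - \<delta>) * real l + B"
        define \<Sigma>1 where "\<Sigma>1 = sqrt (\<Sum>\<kappa>\<in>K1 \<inter> dyadic_shell i. A1 \<kappa>)"
        define \<Sigma>2 where "\<Sigma>2 = sqrt (\<Sum>\<kappa>\<in>K2 \<inter> dyadic_shell j. A2 \<kappa>)"
        define \<Sigma>3 where "\<Sigma>3 = sqrt (\<Sum>\<kappa>\<in>K3 \<inter> dyadic_shell k. A3 \<kappa>)"
        define \<Sigma>4 where "\<Sigma>4 = sqrt (\<Sum>\<kappa>\<in>K4 \<inter> dyadic_shell l. A4 \<kappa>)"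
        have \<Sigma>0: "0 \<le> \<Sigma>1" "0 \<le> \<Sigma>2" "0 \<le> \<Sigma>3" "0 \<le> \<Sigma>4"
          unfolding \<Sigma>1_def \<Sigma>2_def \<Sigma>3_def \<Sigma>4_def
          by (auto intro!: sum_nonneg wave_packet_nonneg[OF V(1)] wave_packet_nonneg[OF V(2)]
              wave_packet_nonneg[OF V(3)] wave_packet_nonneg[OF V(4)])
        have a: "norm (T i k j l) \<le> C * 2 powr (\<gamma> * (real (min i j) + real (min k l))) * (\<Sigma>1 * \<Sigma>2 * \<Sigma>3 * \<Sigma>4)"
          unfolding T_def \<Sigma>1_def \<Sigma>2_def \<Sigma>3_def \<Sigma>4_def
          by (rule pair[OF \<tau> M P1(1) P2(1) P3(1) P4(1)]; erule K_le)
        have "norm (quad_form \<tau> M (P1 i) (P3 k) (P2 j) (P4 l))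
            \<le> C * 2 powr (\<gamma> * (real (min i k) + real (min j l))) * (\<Sigma>1 * \<Sigma>3 * \<Sigma>2 * \<Sigma>4)"
          unfolding \<Sigma>1_def \<Sigma>2_def \<Sigma>3_def \<Sigma>4_def
          by (rule pair[OF \<tau> M P1(1) P3(1) P2(1) P4(1)]; erule K_le)
        then have b: "norm (T i k j l) \<le> C * 2 powr (\<gamma> * (real (min i k) + real (min j l))) * (\<Sigma>1 * \<Sigma>2 * \<Sigma>3 * \<Sigma>4)"
          unfolding T_def by (simp only: mult_ac)
        have "norm (quad_form \<tau> M (P2 j) (P3 k) (P1 i) (P4 l))
            \<le> C * 2 powr (\<gamma> * (real (min j k) + real (min i l))) * (\<Sigma>2 * \<Sigma>3 * \<Sigma>1 * \<Sigma>4)"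
          unfolding \<Sigma>1_def \<Sigma>2_def \<Sigma>3_def \<Sigma>4_def
          by (rule pair[OF \<tau> M P2(1) P3(1) P1(1) P4(1)]; erule K_le)
        then have c: "norm (T i k j l) \<le> C * 2 powr (\<gamma> * (real (min j k) + real (min i l))) * (\<Sigma>1 * \<Sigma>2 * \<Sigma>3 * \<Sigma>4)"
          unfolding T_def by (simp only: mult_ac)
        have le: "C * 2 powr Y * (\<Sigma>1 * \<Sigma>2 * \<Sigma>3 * \<Sigma>4) \<le> C * 2 powr X * (\<Sigma>1 * \<Sigma>2 * \<Sigma>3 * \<Sigma>4)" if "Y \<le> X" for Y
          using that C \<Sigma>0 by (intro mult_right_mono mult_left_mono powr_mono) auto
        have "\<gamma> * (real (min i j) + real (min k l)) \<le> X \<or> \<gamma> * (real (min i k) + real (min j l)) \<le> X \<or>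
           \<gamma> * (real (min j k) + real (min i l)) \<le> X"
          using adm[unfolded admissible_def Let_def] True unfolding X_def by blast
        then have "norm (T i k j l) \<le> C * 2 powr X * (\<Sigma>1 * \<Sigma>2 * \<Sigma>3 * \<Sigma>4)"
          using order_trans[OF a le] order_trans[OF b le] order_trans[OF c le] by blast
        also have "\<dots> \<le> C * 2 powr X * ((2 powr (\<bar>s1\<bar> - s1 * real i) * sqrt S1) * (2 powr (\<bar>s2\<bar> - s2 * real j) * sqrt S2)
            * (2 powr (\<bar>s3\<bar> - s3 * real k) * sqrt S3) * (2 powr (\<bar>s4\<bar> - s4 * real l) * sqrt S4))"
        proof (intro mult_left_mono mult_mono)
          show "\<Sigma>1 \<le> 2 powr (\<bar>s1\<bar> - s1 * real i) * sqrt S1" unfolding \<Sigma>1_def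
            by (intro shell wave_packet_finite[OF V(1)] wave_packet_nonneg[OF V(1)] S)
          show "\<Sigma>2 \<le> 2 powr (\<bar>s2\<bar> - s2 * real j) * sqrt S2" unfolding \<Sigma>2_def
            by (intro shell wave_packet_finite[OF V(2)] wave_packet_nonneg[OF V(2)] S)
          show "\<Sigma>3 \<le> 2 powr (\<bar>s3\<bar> - s3 * real k) * sqrt S3" unfolding \<Sigma>3_def
            by (intro shell wave_packet_finite[OF V(3)] wave_packet_nonneg[OF V(3)] S)
          show "\<Sigma>4 \<le> 2 powr (\<bar>s4\<bar> - s4 * real l) * sqrt S4" unfolding \<Sigma>4_def
            by (intro shell wave_packet_finite[OF V(4)] wave_packet_nonneg[OF V(4)] S)
        qed (use \<Sigma>0 S0 C in auto)
        also have "\<dots> = C * (2 powr X * 2 powr (\<bar>s1\<bar> - s1 * real i) * 2 powr (\<bar>s2\<bar> - s2 * real j) * 2 powr (\<bar>s3\<bar> - s3 * real k) * 2 powr (\<bar>s4\<bar> - s4 * real l)) * N"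
          unfolding N_def by (simp only: mult_ac)
        also have "2 powr X * 2 powr (\<bar>s1\<bar> - s1 * real i) * 2 powr (\<bar>s2\<bar> - s2 * real j) * 2 powr (\<bar>s3\<bar> - s3 * real k) * 2 powr (\<bar>s4\<bar> - s4 * real l)
           = E * (q ^ i * q ^ j * (q ^ k * q ^ l))"
        proof -
          have qp: "q ^ i * q ^ j * (q ^ k * q ^ l) = 2 powr (- \<delta> * (real i + real j + real k + real l))"
            unfolding q_def power_add[symmetric] by (simp add: powr_powr flip: powr_realpow) (simp add: algebra_simps)
          show ?thesis unfolding qp E_def powr_add[symmetric]
            by (rule arg_cong[where f = "(powr) 2"]) (simp add: X_def algebra_simps)
        qed
        finally show ?thesis by (simp only: mult_ac)
      qed
      have N0: "0 \<le> N" using S0 by (simp add: N_def)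
      have "norm (\<Sum>i\<le>J. \<Sum>k\<le>J. \<Sum>j\<le>J. \<Sum>l\<le>J. T i k j l) \<le> (\<Sum>i\<le>J. \<Sum>k\<le>J. \<Sum>j\<le>J. \<Sum>l\<le>J. (C * E * N) * (q ^ i * q ^ j * (q ^ k * q ^ l)))"
        by (intro sum_norm_le T_le)
      also have "\<dots> = (C * E * N) * ((\<Sum>i\<le>J. q ^ i) * (\<Sum>i\<le>J. q ^ i) * ((\<Sum>i\<le>J. q ^ i) * (\<Sum>i\<le>J. q ^ i)))"
        by (subst sum4_product) (simp only: sum_distrib_left)
      also have "\<dots> \<le> (C * E * N) * (G * G * (G * G))"
        using geom q G C N0 by (intro mult_left_mono mult_mono) (auto intro!: sum_nonneg mult_nonneg_nonneg simp: E_def)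
      also have "\<dots> = C * E * G ^ 4 * (sqrt S1 * sqrt S2 * sqrt S3 * sqrt S4)"
        by (simp add: N_def eval_nat_numeral mult_ac)
      finally show "norm (quad_form \<tau> M V1 V2 V3 V4)
          \<le> C * E * G ^ 4 * (sqrt S1 * sqrt S2 * sqrt S3 * sqrt S4)" unfolding eq .
    qed
  qed
qed

section \<open>Time transforms and their coefficients\<close>

lemma fourier_coeff_mode: "fourier_coeff f k = torus_integral (\<lambda>x. f x * mode (- k) x)"
  by (simp add: fourier_coeff_def mode_def freq_minus)

lemma wave_minus: "wave \<tau> (- m) s = exp (- \<i> * of_real (of_int m * \<tau> * s))"
  by (simp add: wave_def)

lemma has_time_transform_wave:
  "has_time_transform \<tau> u k g \<longleftrightarrow> g \<in> borel_measurable borel \<and>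
     ((\<lambda>M. \<integral>\<^sup>+\<sigma>\<in>period_cell \<tau>. ennreal ((norm (g \<sigma> - (\<Sum>m\<in>M. (of_real \<tau> * fourier_coeff (u m) k) * wave \<tau> (- m) \<sigma>)))\<^sup>2) \<partial>lborel)
        \<longlongrightarrow> 0) (finite_subsets_at_top UNIV)"
  by (simp add: has_time_transform_def wave_minus sum_distrib_left mult.assoc)

lemma nn_integral_square_triangle:
  fixes f g :: "real \<Rightarrow> complex"
  assumes [measurable]: "f \<in> borel_measurable borel" "g \<in> borel_measurable borel" "P \<in> sets borel"
  shows "cell_L2 P f \<le>
     2 * cell_L2 P (\<lambda>s. f s - g s) + 2 * cell_L2 P g"
proof -
  have "cell_L2 P f \<le>
    (\<integral>\<^sup>+s. ennreal 2 * (ennreal ((norm (f s - g s))\<^sup>2) * indicator P s) + ennreal 2 * (ennreal ((norm (g s))\<^sup>2) * indicator P s) \<partial>lborel)"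
  proof (rule nn_integral_mono)
    fix s
    have "norm (f s) \<le> norm (f s - g s) + norm (g s)"
      using norm_triangle_ineq[of "f s - g s" "g s"] by simp
    then have "(norm (f s))\<^sup>2 \<le> (norm (f s - g s) + norm (g s))\<^sup>2" by (intro power_mono) auto
    also have "\<dots> \<le> 2 * (norm (f s - g s))\<^sup>2 + 2 * (norm (g s))\<^sup>2"
      using zero_le_power2[of "norm (f s - g s) - norm (g s)"] by (simp add: power2_eq_square algebra_simps)
    finally have "ennreal ((norm (f s))\<^sup>2) \<le> ennreal (2 * (norm (f s - g s))\<^sup>2 + 2 * (norm (g s))\<^sup>2)"
      by (rule ennreal_leI)
    also have "\<dots> = ennreal 2 * ennreal ((norm (f s - g s))\<^sup>2) + ennreal 2 * ennreal ((norm (g s))\<^sup>2)"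
      by (subst ennreal_plus) (auto simp: ennreal_mult[symmetric] simp del: ennreal_numeral)
    finally show "ennreal ((norm (f s))\<^sup>2) * indicator P s \<le> ennreal 2 * (ennreal ((norm (f s - g s))\<^sup>2) * indicator P s)
        + ennreal 2 * (ennreal ((norm (g s))\<^sup>2) * indicator P s)"
      by (auto simp: indicator_def)
  qed
  also have "\<dots> = ennreal 2 * cell_L2 P (\<lambda>s. f s - g s) + ennreal 2 * cell_L2 P g"
    by (subst nn_integral_add) (auto simp: nn_integral_cmult)
  finally show ?thesis by simp
qed

lemma nn_integral_square_bounded:
  fixes f :: "real \<Rightarrow> complex"
  assumes \<tau>: "\<tau> > 0" and B: "\<And>s. norm (f s) \<le> B"
  shows "cell_L2 (period_cell \<tau>) f \<le> ennreal (B\<^sup>2 * (2 * pi / \<tau>))"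
proof -
  have "cell_L2 (period_cell \<tau>) f \<le> (\<integral>\<^sup>+s. ennreal (B\<^sup>2) * indicator (period_cell \<tau>) s \<partial>lborel)"
    using B by (intro nn_integral_mono mult_right_mono ennreal_leI power_mono) auto
  also have "\<dots> = ennreal (B\<^sup>2 * (2 * pi / \<tau>))"
    using \<tau> by (subst nn_integral_cmult_indicator) (auto simp: emeasure_period_cell ennreal_mult[symmetric])
  finally show ?thesis .
qed

lemma has_time_transform_square_integrable:
  assumes \<tau>: "\<tau> > 0" and g: "has_time_transform \<tau> u k g"
  shows "cell_L2 (period_cell \<tau>) g < \<infinity>"
proof -
  define S where "S M s = (\<Sum>m\<in>M. (of_real \<tau> * fourier_coeff (u m) k) * wave \<tau> (- m) s)" for M s
  have [measurable]: "g \<in> borel_measurable borel" using g by (simp add: has_time_transform_wave)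
  have [measurable]: "S M \<in> borel_measurable borel" for M unfolding S_def by measurable
  have "((\<lambda>M. \<integral>\<^sup>+s\<in>period_cell \<tau>. ennreal ((norm (g s - S M s))\<^sup>2) \<partial>lborel) \<longlongrightarrow> 0) (finite_subsets_at_top UNIV)"
    using g by (simp add: has_time_transform_wave S_def)
  then have "\<forall>\<^sub>F M in finite_subsets_at_top UNIV. cell_L2 (period_cell \<tau>) (\<lambda>s. g s - S M s) < 1"
    by (rule order_tendstoD) simp
  then obtain M where M: "cell_L2 (period_cell \<tau>) (\<lambda>s. g s - S M s) < 1"
    using eventually_happens finite_subsets_at_top_neq_bot by blast
  have "norm (S M s) \<le> (\<Sum>m\<in>M. norm (of_real \<tau> * fourier_coeff (u m) k))" for s
    unfolding S_def by (rule order_trans[OF norm_sum]) (simp add: norm_mult)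
  from nn_integral_square_bounded[OF \<tau>, of "S M", OF this]
  have "cell_L2 (period_cell \<tau>) (S M) < \<infinity>"
    by (rule le_less_trans) simp
  then show ?thesis
    using M by (intro le_less_trans[OF nn_integral_square_triangle[of g "S M" "period_cell \<tau>"]])
      (auto simp: ennreal_mult_less_top intro: less_trans)
qed

lemma norm_integral_product_le:
  fixes f h :: "real \<Rightarrow> complex"
  assumes [measurable]: "f \<in> borel_measurable borel" "h \<in> borel_measurable borel" "P \<in> sets borel" and t: "t > 0"
  shows "ennreal (norm (set_lebesgue_integral lborel P (\<lambda>s. f s * h s)))
     \<le> ennreal (t / 2) * cell_L2 P f + ennreal (1 / (2 * t)) * cell_L2 P h"
proof -
  have "ennreal (norm (set_lebesgue_integral lborel P (\<lambda>s. f s * h s))) \<le> (\<integral>\<^sup>+s\<in>P. ennreal (norm (f s * h s)) \<partial>lborel)"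
    by (rule norm_set_lebesgue_integral_le)
  also have "\<dots> \<le> (\<integral>\<^sup>+s. ennreal (t / 2) * (ennreal ((norm (f s))\<^sup>2) * indicator P s)
      + ennreal (1 / (2 * t)) * (ennreal ((norm (h s))\<^sup>2) * indicator P s) \<partial>lborel)"
  proof (rule nn_integral_mono)
    fix s
    have "norm (f s * h s) \<le> t / 2 * (norm (f s))\<^sup>2 + 1 / (2 * t) * (norm (h s))\<^sup>2"
      using weighted_am_gm[of t 1 1 "norm (f s)" 1 "norm (h s)"] t by (simp add: norm_mult)
    then have "ennreal (norm (f s * h s)) \<le> ennreal (t / 2 * (norm (f s))\<^sup>2 + 1 / (2 * t) * (norm (h s))\<^sup>2)"
      by (rule ennreal_leI)
    also have "\<dots> = ennreal (t / 2) * ennreal ((norm (f s))\<^sup>2) + ennreal (1 / (2 * t)) * ennreal ((norm (h s))\<^sup>2)"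
    proof -
      have nn: "0 \<le> t / 2" "0 \<le> 1 / (2 * t)" using t by auto
      show ?thesis
        by (simp only: ennreal_plus[OF mult_nonneg_nonneg[OF nn(1) zero_le_power2] mult_nonneg_nonneg[OF nn(2) zero_le_power2]]
            ennreal_mult[OF nn(1) zero_le_power2] ennreal_mult[OF nn(2) zero_le_power2])
    qed
    finally show "ennreal (norm (f s * h s)) * indicator P s \<le> ennreal (t / 2) * (ennreal ((norm (f s))\<^sup>2) * indicator P s)
      + ennreal (1 / (2 * t)) * (ennreal ((norm (h s))\<^sup>2) * indicator P s)"
      by (auto simp: indicator_def)
  qed
  also have "\<dots> = ennreal (t / 2) * cell_L2 P f + ennreal (1 / (2 * t)) * cell_L2 P h"
    by (subst nn_integral_add) (auto simp: nn_integral_cmult)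
  finally show ?thesis .
qed

lemma set_integrable_product:
  fixes f h :: "real \<Rightarrow> complex"
  assumes [measurable]: "f \<in> borel_measurable borel" "h \<in> borel_measurable borel" "P \<in> sets borel"
    and f: "cell_L2 P f < \<infinity>" and h: "cell_L2 P h < \<infinity>"
  shows "set_integrable lborel P (\<lambda>s. f s * h s)"
  unfolding set_integrable_def
proof (rule integrableI_bounded)
  have "(\<integral>\<^sup>+s. ennreal (norm (indicator P s *\<^sub>R (f s * h s))) \<partial>lborel)
    \<le> (\<integral>\<^sup>+s. ennreal ((norm (f s))\<^sup>2) * indicator P s + ennreal ((norm (h s))\<^sup>2) * indicator P s \<partial>lborel)"
  proof (rule nn_integral_mono)
    fix s
    have "2 * norm (f s * h s) \<le> (norm (f s))\<^sup>2 + (norm (h s))\<^sup>2"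
      using zero_le_power2[of "norm (f s) - norm (h s)"] by (simp add: norm_mult power2_eq_square algebra_simps)
    then have "norm (f s * h s) \<le> (norm (f s))\<^sup>2 + (norm (h s))\<^sup>2"
      using norm_ge_zero[of "f s * h s"] by argo
    then have "ennreal (norm (f s * h s)) \<le> ennreal ((norm (f s))\<^sup>2) + ennreal ((norm (h s))\<^sup>2)"
      by (simp add: ennreal_plus[symmetric] ennreal_leI del: ennreal_plus)
    then show "ennreal (norm (indicator P s *\<^sub>R (f s * h s))) \<le> ennreal ((norm (f s))\<^sup>2) * indicator P s + ennreal ((norm (h s))\<^sup>2) * indicator P s"
      by (auto simp: indicator_def)
  qed
  also have "\<dots> = cell_L2 P f + cell_L2 P h"
    by (subst nn_integral_add) auto
  also have "\<dots> < \<infinity>" using f h by simp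
  finally show "(\<integral>\<^sup>+s. ennreal (norm (indicator P s *\<^sub>R (f s * h s))) \<partial>lborel) < \<infinity>" .
qed measurable

text \<open>Weak convergence of the partial sums. Pairing with exponentials identifies the coefficients,
  and pairing with a weighted multiple of \<open>g\<close> itself computes its norm in the duality argument.\<close>
lemma time_transform_pairing:
  fixes h :: "real \<Rightarrow> complex"
  assumes \<tau>: "\<tau> > 0" and g: "has_time_transform \<tau> u k g"
    and h [measurable]: "h \<in> borel_measurable borel" and h2: "cell_L2 (period_cell \<tau>) h < \<infinity>"
  shows "((\<lambda>M. \<Sum>m\<in>M. (of_real \<tau> * fourier_coeff (u m) k) * set_lebesgue_integral lborel (period_cell \<tau>) (\<lambda>s. h s * wave \<tau> (- m) s))
     \<longlongrightarrow> set_lebesgue_integral lborel (period_cell \<tau>) (\<lambda>s. g s * h s)) (finite_subsets_at_top UNIV)"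
proof -
  define P where "P = period_cell \<tau>"
  have [measurable]: "P \<in> sets borel" by (simp add: P_def)
  define S where "S M s = (\<Sum>m\<in>M. (of_real \<tau> * fourier_coeff (u m) k) * wave \<tau> (- m) s)" for M s
  have [measurable]: "g \<in> borel_measurable borel" using g by (simp add: has_time_transform_wave)
  have [measurable]: "S M \<in> borel_measurable borel" for M unfolding S_def by measurable
  define D where "D M = cell_L2 P (\<lambda>s. g s - S M s)" for M
  have D: "(D \<longlongrightarrow> 0) (finite_subsets_at_top UNIV)"
    using g unfolding has_time_transform_wave S_def[symmetric] P_def[symmetric] D_def[symmetric] by simp
  obtain H where H: "H \<ge> 0" "cell_L2 P h = ennreal H"
    using h2 unfolding P_def by (cases rule: ennreal_cases) auto
  have hi: "set_integrable lborel P h"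
    unfolding P_def by (rule set_integrable_of_square[OF \<tau> h h2])
  have gh: "set_integrable lborel P (\<lambda>s. g s * h s)"
    using has_time_transform_square_integrable[OF \<tau> g] h2 unfolding P_def by (intro set_integrable_product) auto
  have lin: "(\<Sum>m\<in>M. (of_real \<tau> * fourier_coeff (u m) k) * set_lebesgue_integral lborel P (\<lambda>s. h s * wave \<tau> (- m) s))
     = set_lebesgue_integral lborel P (\<lambda>s. h s * S M s)" and Shi: "set_integrable lborel P (\<lambda>s. h s * S M s)" for M
  proof -
    have "set_lebesgue_integral lborel P (\<lambda>s. h s * S M s)
      = (\<integral>s. (\<Sum>m\<in>M. (of_real \<tau> * fourier_coeff (u m) k) * (indicator P s *\<^sub>R (h s * wave \<tau> (- m) s))) \<partial>lborel)"
      unfolding set_lebesgue_integral_def S_def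
      by (intro Bochner_Integration.integral_cong) (auto simp: sum_distrib_left scaleR_sum_right mult_ac)
    also have "\<dots> = (\<Sum>m\<in>M. (of_real \<tau> * fourier_coeff (u m) k) * (\<integral>s. indicator P s *\<^sub>R (h s * wave \<tau> (- m) s) \<partial>lborel))"
      using set_integrable_mult_wave[OF hi, unfolded set_integrable_def]
      by (subst Bochner_Integration.integral_sum) (auto simp del: mult_scaleR_right)
    finally show "(\<Sum>m\<in>M. (of_real \<tau> * fourier_coeff (u m) k) * set_lebesgue_integral lborel P (\<lambda>s. h s * wave \<tau> (- m) s))
     = set_lebesgue_integral lborel P (\<lambda>s. h s * S M s)" by (simp add: set_lebesgue_integral_def)
    have "integrable lborel (\<lambda>s. \<Sum>m\<in>M. (of_real \<tau> * fourier_coeff (u m) k) * (indicator P s *\<^sub>R (h s * wave \<tau> (- m) s)))"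
      using set_integrable_mult_wave[OF hi, unfolded set_integrable_def]
      by (auto simp del: mult_scaleR_right)
    then show "set_integrable lborel P (\<lambda>s. h s * S M s)"
      unfolding set_integrable_def S_def by (simp add: sum_distrib_left scaleR_sum_right mult_ac)
  qed
  have err: "ennreal (norm (set_lebesgue_integral lborel P (\<lambda>s. h s * S M s) - set_lebesgue_integral lborel P (\<lambda>s. g s * h s)))
     \<le> ennreal (t / 2) * D M + ennreal (1 / (2 * t)) * ennreal H" if t: "t > 0" for M t
  proof -
    have "set_lebesgue_integral lborel P (\<lambda>s. g s * h s) - set_lebesgue_integral lborel P (\<lambda>s. h s * S M s)
       = set_lebesgue_integral lborel P (\<lambda>s. g s * h s - h s * S M s)"
      by (rule set_integral_diff(2)[OF gh Shi, symmetric])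
    also have "\<dots> = set_lebesgue_integral lborel P (\<lambda>s. (g s - S M s) * h s)"
      by (simp add: algebra_simps)
    finally have e: "set_lebesgue_integral lborel P (\<lambda>s. g s * h s) - set_lebesgue_integral lborel P (\<lambda>s. h s * S M s)
       = set_lebesgue_integral lborel P (\<lambda>s. (g s - S M s) * h s)" .
    show ?thesis
      unfolding norm_minus_commute[of "set_lebesgue_integral lborel P (\<lambda>s. h s * S M s)"] e D_def H(2)[symmetric]
      by (rule norm_integral_product_le) (use t in auto)
  qed
  have "((\<lambda>M. set_lebesgue_integral lborel P (\<lambda>s. h s * S M s)) \<longlongrightarrow> set_lebesgue_integral lborel P (\<lambda>s. g s * h s)) (finite_subsets_at_top UNIV)"
  proof (rule tendstoI)
    fix e :: real assume e: "e > 0"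
    define t where "t = (H + 1) / e"
    have t: "t > 0" using H e by (simp add: t_def)
    have Ht: "1 / (2 * t) * H \<le> e / 2"
    proof -
      have "1 / (2 * t) * H = e / 2 * (H / (H + 1))" using e H by (simp add: t_def)
      also have "\<dots> \<le> e / 2 * 1" using e H by (intro mult_left_mono) auto
      finally show ?thesis by simp
    qed
    have "\<forall>\<^sub>F M in finite_subsets_at_top UNIV. D M < ennreal (e / (2 * t))"
      by (rule order_tendstoD(2)[OF D]) (use e t in simp)
    then show "\<forall>\<^sub>F M in finite_subsets_at_top UNIV. dist (set_lebesgue_integral lborel P (\<lambda>s. h s * S M s)) (set_lebesgue_integral lborel P (\<lambda>s. g s * h s)) < e"
    proof eventually_elim
      case (elim M)
      have "ennreal (norm (set_lebesgue_integral lborel P (\<lambda>s. h s * S M s) - set_lebesgue_integral lborel P (\<lambda>s. g s * h s)))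
          \<le> ennreal (t / 2) * D M + ennreal (1 / (2 * t)) * ennreal H"
        by (rule err[OF t])
      also have "\<dots> \<le> ennreal (t / 2) * ennreal (e / (2 * t)) + ennreal (1 / (2 * t)) * ennreal H"
        using elim by (intro add_right_mono mult_left_mono) auto
      also have "\<dots> = ennreal (e / 4 + 1 / (2 * t) * H)"
        using t e H by (simp add: ennreal_mult[symmetric] ennreal_plus[symmetric] del: ennreal_plus)
      also have "\<dots> \<le> ennreal (e / 4 + e / 2)" using Ht by (intro ennreal_leI) simp
      finally have "norm (set_lebesgue_integral lborel P (\<lambda>s. h s * S M s) - set_lebesgue_integral lborel P (\<lambda>s. g s * h s)) \<le> e / 4 + e / 2"
        using e by (subst (asm) ennreal_le_iff) auto
      then show ?case using e by (simp add: dist_norm)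
    qed
  qed
  then show ?thesis unfolding lin[symmetric] by (simp add: P_def)
qed

lemma fourier_coeff_eq_time_coeff:
  assumes \<tau>: "\<tau> > 0" and g: "has_time_transform \<tau> u k g"
  shows "fourier_coeff (u n) k = time_coeff \<tau> g n"
proof -
  define P where "P = period_cell \<tau>"
  have "cell_L2 (period_cell \<tau>) (\<lambda>s. wave \<tau> n s) < \<infinity>"
    by (rule le_less_trans[OF nn_integral_square_bounded[OF \<tau>, of _ 1]]) auto
  from time_transform_pairing[OF \<tau> g wave_measurable this]
  have lim: "((\<lambda>M. \<Sum>m\<in>M. (of_real \<tau> * fourier_coeff (u m) k) * set_lebesgue_integral lborel P (\<lambda>s. wave \<tau> n s * wave \<tau> (- m) s))
     \<longlongrightarrow> set_lebesgue_integral lborel P (\<lambda>s. g s * wave \<tau> n s)) (finite_subsets_at_top UNIV)"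
    by (simp add: P_def)
  have orth: "set_lebesgue_integral lborel P (\<lambda>s. wave \<tau> n s * wave \<tau> (- m) s) = (if m = n then of_real (2 * pi / \<tau>) else 0)" for m
    using wave_integral[OF \<tau>, of 1 "n + - m"] by (simp add: wave_mult P_def)
  have "\<forall>\<^sub>F M in finite_subsets_at_top UNIV. n \<in> M \<and> finite M"
    unfolding eventually_finite_subsets_at_top by (rule exI[of _ "{n}"]) auto
  then have "\<forall>\<^sub>F M in finite_subsets_at_top UNIV.
     (\<Sum>m\<in>M. (of_real \<tau> * fourier_coeff (u m) k) * set_lebesgue_integral lborel P (\<lambda>s. wave \<tau> n s * wave \<tau> (- m) s))
       = of_real (2 * pi) * fourier_coeff (u n) k"
  proof eventually_elim
    case (elim M)
    then show ?case using \<tau> by (simp add: orth if_distrib sum.delta cong: if_cong)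
  qed
  then have "((\<lambda>M. \<Sum>m\<in>M. (of_real \<tau> * fourier_coeff (u m) k) * set_lebesgue_integral lborel P (\<lambda>s. wave \<tau> n s * wave \<tau> (- m) s))
     \<longlongrightarrow> of_real (2 * pi) * fourier_coeff (u n) k) (finite_subsets_at_top UNIV)"
    by (rule tendsto_eventually)
  from tendsto_unique[OF finite_subsets_at_top_neq_bot this lim]
  show ?thesis by (simp add: time_coeff_def P_def eq_divide_eq mult.commute)
qed

text \<open>Bessel's inequality, again by testing with the trigonometric polynomial that has the conjugate coefficients and
  absorbing.\<close>
lemma bessel_time_coeff:
  assumes \<tau>: "\<tau> > 0" and [measurable]: "g \<in> borel_measurable borel"
    and G: "G \<ge> 0" "cell_L2 (period_cell \<tau>) g \<le> ennreal G" and M: "finite M"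
  shows "\<tau> * (\<Sum>n\<in>M. (norm (time_coeff \<tau> g n))\<^sup>2) \<le> G"
proof -
  define P where "P = period_cell \<tau>"
  have [measurable]: "P \<in> sets borel" by (simp add: P_def)
  define a where "a = time_coeff \<tau> g"
  define Q where "Q = (\<Sum>n\<in>M. (norm (a n))\<^sup>2)"
  define Z where "Z s = (\<Sum>n\<in>M. cnj (a n) * wave \<tau> n s)" for s
  have [measurable]: "Z \<in> borel_measurable borel" unfolding Z_def by measurable
  have gi: "set_integrable lborel P g"
    unfolding P_def by (rule set_integrable_of_square[OF \<tau>]) (use G in \<open>auto intro: le_less_trans\<close>)
  have "set_lebesgue_integral lborel P (\<lambda>s. g s * Z s) = (\<Sum>n\<in>M. cnj (a n) * (of_real (2 * pi) * a n))"
    unfolding Z_def set_lebesgue_integral_sum_wave[OF gi \<open>P \<in> sets borel\<close>] by (simp add: a_def time_coeff_def P_def)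
  also have "\<dots> = of_real (2 * pi * Q)"
    unfolding Q_def of_real_mult of_real_sum complex_norm_square by (simp add: sum_distrib_left mult_ac)
  finally have e: "set_lebesgue_integral lborel P (\<lambda>s. g s * Z s) = of_real (2 * pi * Q)" .
  have Q0: "Q \<ge> 0" by (simp add: Q_def sum_nonneg)
  have Z2: "cell_L2 P Z = ennreal (2 * pi / \<tau> * Q)"
    using nn_integral_norm_power2_wave_sum[OF \<tau>, of 1 M "\<lambda>n. cnj (a n)"] M by (simp add: P_def Z_def Q_def)
  have t: "\<tau> > 0" by fact
  have "ennreal (2 * pi * Q) = ennreal (norm (set_lebesgue_integral lborel P (\<lambda>s. g s * Z s)))"
    unfolding e norm_of_real using Q0 by simp
  also have "\<dots> \<le> ennreal ((1 / \<tau>) / 2) * cell_L2 P g + ennreal (1 / (2 * (1 / \<tau>))) * cell_L2 P Z"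
    by (rule norm_integral_product_le) (use \<tau> in auto)
  also have "\<dots> \<le> ennreal ((1 / \<tau>) / 2) * ennreal G + ennreal (1 / (2 * (1 / \<tau>))) * ennreal (2 * pi / \<tau> * Q)"
    unfolding Z2 using G by (intro add_right_mono mult_left_mono) (auto simp: P_def)
  also have "\<dots> = ennreal (G / (2 * \<tau>) + pi * Q)"
    using \<tau> G Q0 by (simp add: ennreal_mult[symmetric] ennreal_plus[symmetric] mult_ac del: ennreal_plus)
  finally have "2 * pi * Q \<le> G / (2 * \<tau>) + pi * Q"
    using \<tau> G Q0 by (subst (asm) ennreal_le_iff) auto
  then have "pi * Q \<le> G / (2 * \<tau>)" by (simp add: mult.commute)
  then have "2 * pi * (\<tau> * Q) \<le> G" using \<tau> by (simp add: field_simps)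
  moreover have "1 * (\<tau> * Q) \<le> 2 * pi * (\<tau> * Q)"
    using pi_gt3 \<tau> Q0 by (intro mult_right_mono) auto
  ultimately show ?thesis by (simp add: Q_def a_def)
qed

lemma modulated_square_summable:
  assumes \<tau>: "\<tau> > 0" and b: "b \<ge> 0" and a: "modulated \<tau> b k a A"
  shows "(\<lambda>n. (norm (a n))\<^sup>2) summable_on UNIV"
proof (rule nonneg_bdd_above_summable_on)
  from a obtain g where A: "0 \<le> A" and [measurable]: "g \<in> borel_measurable borel" and ag: "a = time_coeff \<tau> g"
    and g: "modulation_energy \<tau> b k g \<le> ennreal A"
    by (auto simp: modulated_def)
  have "cell_L2 (period_cell \<tau>) g
      \<le> modulation_energy \<tau> b k g"
    using b modulation_powr_ge_1[where b = "2 * b" and k = k and \<tau> = \<tau>]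
    by (intro nn_integral_mono mult_right_mono ennreal_leI) (auto simp: mult_le_cancel_right1)
  then have "cell_L2 (period_cell \<tau>) g \<le> ennreal A" using g by (rule order_trans)
  from bessel_time_coeff[OF \<tau> _ A this] have "(\<Sum>n\<in>M. (norm (a n))\<^sup>2) \<le> A / \<tau>" if "finite M" for M
    using that \<tau> by (simp add: ag field_simps)
  then show "bdd_above (sum (\<lambda>n. (norm (a n))\<^sup>2) ` {F. F \<subseteq> UNIV \<and> finite F})"
    by (intro bdd_aboveI2[of _ _ "A / \<tau>"]) auto
qed auto

text \<open>The norm of the trilinear expression is finite only if a transform exists at every frequency. Its
  coefficients are bounded by products of three square summable sequences and thus absolutely summable, so that their Fourier series
  converges uniformly and defines a transform.\<close>
lemma has_time_transform_of_summable:
  assumes \<tau>: "\<tau> > 0" and c: "(\<lambda>m. norm (fourier_coeff (u m) k)) summable_on UNIV"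
  shows "\<exists>g. has_time_transform \<tau> u k g"
proof -
  define c where "c m = of_real \<tau> * fourier_coeff (u m) k" for m
  have cs: "(\<lambda>m. norm (c m)) summable_on UNIV"
    unfolding c_def norm_mult using c by (intro summable_on_cmult_right)
  have fs: "(\<lambda>m. norm (c m * wave \<tau> (- m) s)) summable_on A" for s A
    using summable_on_subset_banach[OF cs, of A] by (simp add: norm_mult)
  define g where "g s = (\<Sum>\<^sub>\<infinity>m. c m * wave \<tau> (- m) s)" for s
  define S where "S M s = (\<Sum>m\<in>M. c m * wave \<tau> (- m) s)" for M s
  define r where "r M = (\<Sum>\<^sub>\<infinity>m. norm (c m)) - (\<Sum>m\<in>M. norm (c m))" for M
  have S_lim: "((\<lambda>M. S M s) \<longlongrightarrow> g s) (finite_subsets_at_top UNIV)" for s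
    using has_sum_infsum[OF abs_summable_summable[OF fs[of s UNIV]]]
    unfolding has_sum_def g_def S_def .
  have r_lim: "(r \<longlongrightarrow> 0) (finite_subsets_at_top UNIV)"
  proof -
    have "((\<lambda>M. \<Sum>m\<in>M. norm (c m)) \<longlongrightarrow> (\<Sum>\<^sub>\<infinity>m. norm (c m))) (finite_subsets_at_top UNIV)"
      using has_sum_infsum[OF cs] unfolding has_sum_def .
    from tendsto_diff[OF tendsto_const this, of "\<Sum>\<^sub>\<infinity>m. norm (c m)"] show ?thesis
      unfolding r_def by simp
  qed
  have "filterlim (\<lambda>N::nat. {- int N..int N}) (finite_subsets_at_top UNIV) sequentially"
    unfolding filterlim_finite_subsets_at_top
  proof (intro allI impI)
    fix X :: "int set" assume "finite X \<and> X \<subseteq> UNIV"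
    then obtain B :: nat where B: "\<And>x. x \<in> X \<Longrightarrow> nat \<bar>x\<bar> \<le> B"
      by (metis (mono_tags, lifting) finite_imageI finite_nat_set_iff_bounded_le imageI)
    show "\<forall>\<^sub>F N in sequentially. finite {- int N..int N} \<and> X \<subseteq> {- int N..int N} \<and> {- int N..int N} \<subseteq> UNIV"
      using eventually_ge_at_top[of B]
    proof eventually_elim
      case (elim N)
      then show ?case using B by (fastforce dest: order_trans)
    qed
  qed
  from filterlim_compose[OF S_lim this]
  have seq: "(\<lambda>N. S {- int N..int N} s) \<longlonglongrightarrow> g s" for s by simp
  have [measurable]: "S M \<in> borel_measurable borel" for M unfolding S_def by measurable
  have gm: "g \<in> borel_measurable borel"
    by (rule borel_measurable_LIMSEQ_metric[OF _ seq]) measurable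
  have err: "norm (g s - S M s) \<le> r M" if M: "finite M" for M s
  proof -
    have "g s - S M s = (\<Sum>\<^sub>\<infinity>m\<in>UNIV - M. c m * wave \<tau> (- m) s)"
      unfolding g_def S_def using abs_summable_summable[OF fs] M by (subst infsum_Diff) auto
    also have "norm \<dots> \<le> (\<Sum>\<^sub>\<infinity>m\<in>UNIV - M. norm (c m * wave \<tau> (- m) s))"
      by (rule norm_infsum_bound[OF fs])
    also have "\<dots> = (\<Sum>\<^sub>\<infinity>m\<in>UNIV - M. norm (c m))" by (simp add: norm_mult)
    also have "\<dots> = r M" unfolding r_def using cs M summable_on_subset_banach[OF cs, of M]
      by (subst infsum_Diff) auto
    finally show ?thesis .
  qed
  have "((\<lambda>M. \<integral>\<^sup>+s\<in>period_cell \<tau>. ennreal ((norm (g s - S M s))\<^sup>2) \<partial>lborel) \<longlongrightarrow> 0) (finite_subsets_at_top UNIV)"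
  proof (rule tendsto_sandwich)
    show "\<forall>\<^sub>F M in finite_subsets_at_top UNIV. 0 \<le> cell_L2 (period_cell \<tau>) (\<lambda>s. g s - S M s)" by simp
    have "\<forall>\<^sub>F M in finite_subsets_at_top UNIV. finite M"
      unfolding eventually_finite_subsets_at_top by auto
    then show "\<forall>\<^sub>F M in finite_subsets_at_top UNIV. cell_L2 (period_cell \<tau>) (\<lambda>s. g s - S M s) \<le> ennreal ((r M)\<^sup>2 * (2 * pi / \<tau>))"
      by eventually_elim (intro nn_integral_square_bounded \<tau> err)
    have "((\<lambda>M. ennreal ((r M)\<^sup>2 * (2 * pi / \<tau>))) \<longlongrightarrow> ennreal (0\<^sup>2 * (2 * pi / \<tau>))) (finite_subsets_at_top UNIV)"
      by (intro tendsto_ennrealI tendsto_intros r_lim)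
    then show "((\<lambda>M. ennreal ((r M)\<^sup>2 * (2 * pi / \<tau>))) \<longlongrightarrow> 0) (finite_subsets_at_top UNIV)" by simp
  qed auto
  then have "has_time_transform \<tau> u k g"
    using gm unfolding has_time_transform_wave S_def c_def by simp
  then show ?thesis by blast
qed

section \<open>From Bourgain norms to wave packets\<close>

lemma nn_integral_count_space_le:
  fixes f :: "'a::countable \<Rightarrow> ennreal"
  assumes "\<And>M. finite M \<Longrightarrow> (\<Sum>x\<in>M. f x) \<le> c"
  shows "(\<integral>\<^sup>+x. f x \<partial>count_space UNIV) \<le> c"
proof (cases "finite (UNIV :: 'a set)")
  case True
  then show ?thesis using assms by (simp add: nn_integral_count_space_finite)
next
  case False
  define e where "e = from_nat_into (UNIV :: 'a set)"
  have e: "bij_betw e UNIV UNIV" unfolding e_def using False by (intro bij_betw_from_nat_into) auto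
  have "(\<integral>\<^sup>+x. f x \<partial>count_space UNIV) = (\<Sum>i. f (e i))"
    by (simp add: nn_integral_bij_count_space[OF e, symmetric] nn_integral_count_space_nat)
  also have "\<dots> \<le> c"
  proof (rule suminf_le_const)
    fix n
    have "(\<Sum>i<n. f (e i)) = (\<Sum>x\<in>e ` {..<n}. f x)"
      using e by (subst sum.reindex) (auto simp: bij_betw_def inj_on_def)
    then show "(\<Sum>i<n. f (e i)) \<le> c" using assms[of "e ` {..<n}"] by simp
  qed (rule summableI)
  finally show ?thesis .
qed

lemma sum_le_nn_integral_count_space:
  fixes f :: "'a \<Rightarrow> ennreal"
  assumes "finite K"
  shows "(\<Sum>x\<in>K. f x) \<le> (\<integral>\<^sup>+x. f x \<partial>count_space UNIV)"
proof -
  have "(\<Sum>x\<in>K. f x) = (\<integral>\<^sup>+x. f x * indicator K x \<partial>count_space UNIV)"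
    using assms by (subst nn_integral_count_space'[of K]) (auto simp: indicator_def)
  also have "\<dots> \<le> (\<integral>\<^sup>+x. f x \<partial>count_space UNIV)"
    by (intro nn_integral_mono) (auto simp: indicator_def)
  finally show ?thesis .
qed

lemma ennpowr_ennreal: "0 \<le> x \<Longrightarrow> ennpowr (ennreal x) a = ennreal (x powr a)"
  by (simp add: ennpowr_def)

lemma ennpowr_mono:
  assumes "x \<le> ennreal y" "0 \<le> y" "0 \<le> a"
  shows "ennpowr x a \<le> ennreal (y powr a)"
proof -
  obtain z where z: "0 \<le> z" "x = ennreal z"
    using assms(1) by (cases x) (auto simp: top_unique)
  then show ?thesis using assms by (simp add: ennpowr_ennreal powr_mono2 ennreal_leI)
qed

text \<open>All that is used of the norm on the right-hand sides: the energies at the single frequencies, and a bound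
  for their weighted sums.\<close>
lemma bourgain_norm_finite:
  assumes \<tau>: "\<tau> > 0" and fin: "bourgain_norm \<tau> s b u < \<infinity>"
  shows "\<exists>A N. 0 \<le> N \<and> bourgain_norm \<tau> s b u = ennreal N \<and>
    (\<forall>k. modulated \<tau> b k (\<lambda>n. fourier_coeff (u n) k) (A k)) \<and>
    (\<forall>K. finite K \<longrightarrow> sobolev_sum s K A \<le> N\<^sup>2)"
proof -
  define g where "g k = time_transform \<tau> u k" for k
  define E where "E k = modulation_energy \<tau> b k (g k)" for k
  define I where "I = (\<integral>\<^sup>+k. ennreal (kbr k powr (2 * s)) * E k \<partial>count_space UNIV)"
  from fin have ex: "\<forall>k. \<exists>g. has_time_transform \<tau> u k g"
    by (auto simp: bourgain_norm_def split: if_splits)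
  then have g: "has_time_transform \<tau> u k (g k)" for k
    unfolding g_def time_transform_def by (intro someI_ex[of "has_time_transform \<tau> u k"]) (use ex in blast)
  have gm [measurable]: "g k \<in> borel_measurable borel" for k using g[of k] by (simp add: has_time_transform_wave)
  have inner: "(\<integral>\<^sup>+\<sigma>\<in>period_cell \<tau>. ennreal ((kbr k powr s * modulation \<tau> k \<sigma> powr b * norm (g k \<sigma>))\<^sup>2) \<partial>lborel)
     = ennreal (kbr k powr (2 * s)) * E k" for k
  proof -
    have sq: "(x powr a)\<^sup>2 = x powr (2 * a)" for x a :: real
      by (simp add: power2_eq_square powr_add[symmetric])
    have "(\<integral>\<^sup>+\<sigma>\<in>period_cell \<tau>. ennreal ((kbr k powr s * modulation \<tau> k \<sigma> powr b * norm (g k \<sigma>))\<^sup>2) \<partial>lborel)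
      = (\<integral>\<^sup>+\<sigma>. ennreal (kbr k powr (2 * s)) * (ennreal (modulation \<tau> k \<sigma> powr (2 * b) * (norm (g k \<sigma>))\<^sup>2) * indicator (period_cell \<tau>) \<sigma>) \<partial>lborel)"
      by (intro nn_integral_cong) (simp add: power_mult_distrib sq ennreal_mult mult.assoc)
    then show ?thesis by (simp add: E_def nn_integral_cmult)
  qed
  have norm_eq: "bourgain_norm \<tau> s b u = ennpowr I (1 / 2)"
    unfolding bourgain_norm_def I_def inner[symmetric] g_def using ex by simp
  with fin have "I \<noteq> \<infinity>" by (auto simp: ennpowr_def)
  then obtain J where J: "0 \<le> J" "I = ennreal J" by (cases I) auto
  have le: "(\<Sum>k\<in>K. ennreal (kbr k powr (2 * s)) * E k) \<le> ennreal J" if "finite K" for K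
    unfolding J(2)[symmetric] I_def by (rule sum_le_nn_integral_count_space[OF that])
  have "E k < \<infinity>" for k
  proof -
    have "ennreal (kbr k powr (2 * s)) * E k < \<infinity>"
      using le[of "{k}"] by (auto intro: le_less_trans)
    then show ?thesis using jbracket_pos[of "freq k"] by (auto simp: ennreal_mult_less_top)
  qed
  then have E: "E k = ennreal (enn2real (E k))" for k by (simp add: less_top)
  show ?thesis
  proof (intro exI[of _ "\<lambda>k. enn2real (E k)"] exI[of _ "J powr (1 / 2)"] conjI allI impI)
    show "0 \<le> J powr (1 / 2)" by simp
    show "bourgain_norm \<tau> s b u = ennreal (J powr (1 / 2))" by (simp add: norm_eq J ennpowr_ennreal)
    show "modulated \<tau> b k (\<lambda>n. fourier_coeff (u n) k) (enn2real (E k))" for k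
      unfolding modulated_def
    proof (intro conjI exI)
      show "(\<lambda>n. fourier_coeff (u n) k) = time_coeff \<tau> (g k)"
        using fourier_coeff_eq_time_coeff[OF \<tau> g] by (simp add: fun_eq_iff)
      show "modulation_energy \<tau> b k (g k) \<le> ennreal (enn2real (E k))"
        unfolding E[symmetric] by (simp add: E_def)
    qed (use gm in auto)
    fix K :: "(int \<times> int) set" assume K: "finite K"
    have "(\<Sum>k\<in>K. ennreal (kbr k powr (2 * s)) * E k) = (\<Sum>k\<in>K. ennreal (kbr k powr (2 * s) * enn2real (E k)))"
      by (intro sum.cong refl) (subst E, simp add: ennreal_mult)
    also have "\<dots> = ennreal (\<Sum>k\<in>K. kbr k powr (2 * s) * enn2real (E k))"
      by (intro sum_ennreal) auto
    finally have "ennreal (\<Sum>k\<in>K. kbr k powr (2 * s) * enn2real (E k)) \<le> ennreal J"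
      using le[OF K] by simp
    then have "(\<Sum>k\<in>K. kbr k powr (2 * s) * enn2real (E k)) \<le> J" using J(1) by (simp add: ennreal_le_iff)
    also have "J = (J powr (1 / 2))\<^sup>2" using J(1) by (simp add: powr_half_sqrt)
    finally show "(\<Sum>k\<in>K. kbr k powr (2 * s) * enn2real (E k)) \<le> (J powr (1 / 2))\<^sup>2" .
  qed
qed

definition Pi_freqs :: "real \<Rightarrow> (int \<times> int) set" where
  "Pi_freqs \<tau> = {k. \<tau> *\<^sub>R freq k \<in> {-1..<1} \<times> {-1..<1}}"

lemma finite_freq_box:
  assumes "\<tau> > 0"
  shows "finite (freq_box \<tau>)"
proof -
  have "freq_box \<tau> \<subseteq> {-\<lceil>1 / \<tau>\<rceil>..\<lceil>1 / \<tau>\<rceil>} \<times> {-\<lceil>1 / \<tau>\<rceil>..\<lceil>1 / \<tau>\<rceil>}"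
  proof
    fix k assume k: "k \<in> freq_box \<tau>"
    have *: "x \<in> {-\<lceil>1 / \<tau>\<rceil>..\<lceil>1 / \<tau>\<rceil>}" if "\<tau> * \<bar>of_int x\<bar> \<le> 1" for x :: int
    proof -
      have "\<bar>real_of_int x\<bar> \<le> 1 / \<tau>" using that assms by (simp add: field_simps)
      also have "\<dots> \<le> of_int \<lceil>1 / \<tau>\<rceil>" by (rule le_of_int_ceiling)
      finally have "\<bar>x\<bar> \<le> \<lceil>1 / \<tau>\<rceil>" by (simp only: of_int_le_iff flip: of_int_abs)
      then show ?thesis by auto
    qed
    show "k \<in> {-\<lceil>1 / \<tau>\<rceil>..\<lceil>1 / \<tau>\<rceil>} \<times> {-\<lceil>1 / \<tau>\<rceil>..\<lceil>1 / \<tau>\<rceil>}"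
      using k * by (cases k) (simp only: freq_box_def mem_Collect_eq fst_conv snd_conv mem_Times_iff)
  qed
  then show ?thesis by (rule finite_subset) simp
qed

lemma Pi_freqs_subset: "\<tau> > 0 \<Longrightarrow> Pi_freqs \<tau> \<subseteq> freq_box \<tau>"
  by (auto simp: Pi_freqs_def freq_box_def freq_def abs_if not_less)

lemma finite_Pi_freqs: "\<tau> > 0 \<Longrightarrow> finite (Pi_freqs \<tau>)"
  using finite_freq_box Pi_freqs_subset finite_subset by blast

lemma Pi_tau_trig: "Pi_tau \<tau> f x = trig (Pi_freqs \<tau>) (fourier_coeff f) x / of_real ((2 * pi)\<^sup>2)"
  by (simp add: Pi_tau_def trig_def Pi_freqs_def mode_def)

lemma fourier_coeff_cnj: "fourier_coeff (\<lambda>x. cnj (f x)) k = cnj (fourier_coeff f (- k))"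
proof -
  have "cnj (fourier_coeff f (- k)) = torus_integral (\<lambda>x. cnj (f x * mode k x))"
    unfolding fourier_coeff_mode set_lebesgue_integral_def
    by (subst Bochner_Integration.integral_cnj[symmetric]) (simp add: complex_cnj_scaleR del: Bochner_Integration.integral_cnj)
  then show ?thesis by (simp add: fourier_coeff_mode cnj_mode)
qed

text \<open>The half-open box is not symmetric, so \<open>\<Pi>\<^sub>\<tau>\<close> does not commute with conjugation: for \<open>v = conj_seq u\<close>
  the packet is the conjugate of the restriction of \<open>u\<close> to the reflected box.\<close>
lemma Pi_tau_wave_packet:
  assumes \<tau>: "\<tau> > 0" and mod: "\<And>k. modulated \<tau> b k (\<lambda>n. fourier_coeff (u n) k) (A k)"
    and v: "v = u \<or> v = conj_seq u"
  obtains K V where "wave_packet \<tau> b K A V" "\<And>n x. Pi_tau \<tau> (v n) x = V n x / of_real ((2 * pi)\<^sup>2)"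
  using v
proof
  assume v: "v = u"
  show ?thesis
  proof
    show "wave_packet \<tau> b (Pi_freqs \<tau>) A (\<lambda>n. trig (Pi_freqs \<tau>) (\<lambda>k. fourier_coeff (u n) k))"
      unfolding wave_packet_def
      by (intro conjI exI[of _ "\<lambda>k n. fourier_coeff (u n) k"])
        (use mod \<tau> finite_Pi_freqs Pi_freqs_subset in auto)
  qed (simp add: v Pi_tau_trig)
next
  assume v: "v = conj_seq u"
  have box: "uminus ` Pi_freqs \<tau> \<subseteq> freq_box \<tau>"
    using Pi_freqs_subset[OF \<tau>] by (fastforce simp: freq_box_def)
  have "Pi_tau \<tau> (v n) x = cnj (trig (uminus ` Pi_freqs \<tau>) (\<lambda>k. fourier_coeff (u n) k) x) / of_real ((2 * pi)\<^sup>2)" for n x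
  proof -
    have "cnj (trig (uminus ` Pi_freqs \<tau>) (\<lambda>k. fourier_coeff (u n) k) x) = trig (Pi_freqs \<tau>) (\<lambda>k. cnj (fourier_coeff (u n) (- k))) x"
      unfolding cnj_trig by (simp add: image_image)
    moreover have "fourier_coeff (v n) = (\<lambda>k. cnj (fourier_coeff (u n) (- k)))"
      using fourier_coeff_cnj[of "u n"] by (simp add: v conj_seq_def[abs_def] fun_eq_iff)
    ultimately show ?thesis by (simp add: Pi_tau_trig)
  qed
  moreover have "wave_packet \<tau> b (uminus ` Pi_freqs \<tau>) A (\<lambda>n x. cnj (trig (uminus ` Pi_freqs \<tau>) (\<lambda>k. fourier_coeff (u n) k) x))"
    unfolding wave_packet_def
    by (intro conjI exI[of _ "\<lambda>k n. fourier_coeff (u n) k"])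
      (use mod \<tau> finite_Pi_freqs box in auto)
  ultimately show ?thesis using that by blast
qed

lemma wave_packet_cnj:
  assumes "wave_packet \<tau> b K A V"
  shows "wave_packet \<tau> b K A (\<lambda>n x. cnj (V n x))"
proof -
  from assms obtain a where *: "finite K" "K \<subseteq> freq_box \<tau>" "\<forall>k\<in>K. modulated \<tau> b k (a k) (A k)"
    and V: "V = (\<lambda>n. trig K (\<lambda>k. a k n)) \<or> V = (\<lambda>n x. cnj (trig K (\<lambda>k. a k n) x))"
    unfolding wave_packet_def by blast
  from V have "(\<lambda>n x. cnj (V n x)) = (\<lambda>n. trig K (\<lambda>k. a k n)) \<or> (\<lambda>n x. cnj (V n x)) = (\<lambda>n x. cnj (trig K (\<lambda>k. a k n) x))"
    by auto
  then show ?thesis unfolding wave_packet_def using * by blast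
qed

section \<open>The Strichartz estimate\<close>

text \<open>The quadrilinear estimate for \<open>V * cnj V * V * cnj V\<close>, whose integral is the fourth power of the \<open>L\<^sup>4\<close>
  norm.\<close>
lemma discrete_strichartz:
  fixes s b :: real
  assumes s: "s > 3 / 8" and b: "b > 3 / 8"
  obtains C where "C > 0"
    and "\<And>\<tau> u. \<lbrakk>0 < \<tau>; \<tau> \<le> 1; bourgain_norm \<tau> s b u < \<infinity>\<rbrakk> \<Longrightarrow>
      lp_tau \<tau> 4 (\<lambda>n. Lp_torus 4 (Pi_tau \<tau> (u n))) \<le> ennreal C * bourgain_norm \<tau> s b u"
proof -
  obtain \<gamma> \<delta> where \<gamma>: "\<gamma> > 3 / 4" and \<delta>: "\<delta> > 0" and adm: "admissible \<gamma> \<delta> 0 s s s s"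
    using admissible_equal[OF s] .
  show ?thesis
  proof (cases rule: quadrilinear_estimate[OF b \<gamma> \<delta> adm])
  case (1 C)
    note C = 1(1) and quad = 1(2)
    show ?thesis
    proof
      show "C powr (1 / 4) > 0" using C by simp
      fix \<tau> :: real and u assume \<tau>: "0 < \<tau>" "\<tau> \<le> 1" and fin: "bourgain_norm \<tau> s b u < \<infinity>"
      obtain A N where N: "0 \<le> N" "bourgain_norm \<tau> s b u = ennreal N"
        and mod: "\<And>k. modulated \<tau> b k (\<lambda>n. fourier_coeff (u n) k) (A k)"
        and A: "\<And>K. finite K \<Longrightarrow> sobolev_sum s K A \<le> N\<^sup>2"
        using bourgain_norm_finite[OF \<tau>(1) fin] by blast
      obtain K V where V: "wave_packet \<tau> b K A V" and Pi: "\<And>n x. Pi_tau \<tau> (u n) x = V n x / of_real ((2 * pi)\<^sup>2)"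
        using Pi_tau_wave_packet[OF \<tau>(1) mod, of u] by blast
      note K = A[OF wave_packet_finite[OF V]]
      define y where "y n = torus_integral (\<lambda>x. norm (V n x) ^ 4)" for n
      have cont: "continuous_on UNIV (\<lambda>x. norm (V n x) ^ 4)" for n
        by (intro continuous_intros wave_packet_continuous[OF V])
      have y0: "y n \<ge> 0" for n
        unfolding y_def set_lebesgue_integral_def by (intro Bochner_Integration.integral_nonneg) auto
      define X where "X n = (\<integral>\<^sup>+x\<in>torus_dom. ennreal (norm (Pi_tau \<tau> (u n) x) powr 4) \<partial>lebesgue)" for n
      have X_le: "X n \<le> ennreal (y n)" for n
      proof -
        have "X n \<le> (\<integral>\<^sup>+x. ennreal (indicator torus_dom x *\<^sub>R norm (V n x) ^ 4) \<partial>lebesgue)"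
          unfolding X_def
        proof (rule nn_integral_mono)
          fix x
          have "norm (Pi_tau \<tau> (u n) x) \<le> norm (V n x)"
          proof -
            have "(1::real)\<^sup>2 \<le> (2 * pi)\<^sup>2" using pi_gt3 by (intro power_mono) auto
            then have "norm (V n x) / (2 * pi)\<^sup>2 \<le> norm (V n x) / 1" by (intro divide_left_mono) auto
            then show ?thesis unfolding Pi norm_divide norm_of_real by simp
          qed
          then have "norm (Pi_tau \<tau> (u n) x) powr 4 \<le> norm (V n x) powr 4" by (intro powr_mono2) auto
          also have "norm (V n x) powr 4 = norm (V n x) ^ 4" by (cases "V n x = 0") (auto simp: powr_numeral)
          finally show "ennreal (norm (Pi_tau \<tau> (u n) x) powr 4) * indicator torus_dom x
              \<le> ennreal (indicator torus_dom x *\<^sub>R norm (V n x) ^ 4)"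
            by (auto simp: indicator_def intro: ennreal_leI)
        qed
        also have "\<dots> = ennreal (y n)"
          using torus_integrable[OF cont[of n]] unfolding y_def set_lebesgue_integral_def set_integrable_def
          by (intro nn_integral_eq_integral) auto
        finally show ?thesis .
      qed
      have sum_le: "\<tau> * (\<Sum>n\<in>M. y n) \<le> C * N ^ 4" if M: "finite M" for M
      proof -
        have "norm (of_real \<tau> * (\<Sum>n\<in>M. torus_integral (\<lambda>x. V n x * cnj (V n x) * (V n x * cnj (V n x)))))
          \<le> C * (sqrt (N\<^sup>2) * sqrt (N\<^sup>2) * sqrt (N\<^sup>2) * sqrt (N\<^sup>2))"
          by (rule quad[OF \<tau> M V wave_packet_cnj[OF V] V wave_packet_cnj[OF V] K K K K])
        also have "\<dots> = C * N ^ 4" using N(1) by (simp add: eval_nat_numeral)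
        also have "(\<Sum>n\<in>M. torus_integral (\<lambda>x. V n x * cnj (V n x) * (V n x * cnj (V n x)))) = of_real (\<Sum>n\<in>M. y n)"
        proof -
          have "V n x * cnj (V n x) * (V n x * cnj (V n x)) = complex_of_real (norm (V n x) ^ 4)" for n x
          proof -
            have "V n x * cnj (V n x) = complex_of_real ((norm (V n x))\<^sup>2)" by (rule complex_norm_square[symmetric])
            then show ?thesis by (simp add: eval_nat_numeral)
          qed
          then show ?thesis unfolding y_def of_real_sum set_integral_complex_of_real[symmetric] by simp
        qed
        also have "norm (complex_of_real \<tau> * of_real (\<Sum>n\<in>M. y n)) = \<tau> * (\<Sum>n\<in>M. y n)"
          using \<tau> y0 by (simp add: norm_mult sum_nonneg del: of_real_sum)
        finally show ?thesis .
      qed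
      have Lp: "ennpowr (Lp_torus 4 (Pi_tau \<tau> (u n))) 4 = X n" for n
      proof -
        obtain x where x: "0 \<le> x" "X n = ennreal x"
          using X_le[of n] by (cases "X n") (auto simp: top_unique)
        have "Lp_torus 4 (Pi_tau \<tau> (u n)) = ennreal (x powr (1 / 4))"
          unfolding Lp_torus_def X_def[symmetric] x(2) using x(1) by (rule ennpowr_ennreal)
        then show ?thesis using x by (simp add: ennpowr_ennreal powr_powr)
      qed
      have "ennreal \<tau> * (\<integral>\<^sup>+n. X n \<partial>count_space UNIV) \<le> ennreal \<tau> * ennreal (C * N ^ 4 / \<tau>)"
      proof (intro mult_left_mono nn_integral_count_space_le)
        fix M :: "int set" assume M: "finite M"
        have "(\<Sum>n\<in>M. X n) \<le> (\<Sum>n\<in>M. ennreal (y n))" by (intro sum_mono X_le)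
        also have "\<dots> = ennreal (\<Sum>n\<in>M. y n)" by (intro sum_ennreal y0)
        also have "\<dots> \<le> ennreal (C * N ^ 4 / \<tau>)"
          using sum_le[OF M] \<tau> by (intro ennreal_leI) (simp add: field_simps)
        finally show "(\<Sum>n\<in>M. X n) \<le> ennreal (C * N ^ 4 / \<tau>)" .
      qed simp
      also have "\<dots> = ennreal (C * N ^ 4)" using \<tau> C by (simp add: ennreal_mult'[symmetric])
      finally have "lp_tau \<tau> 4 (\<lambda>n. Lp_torus 4 (Pi_tau \<tau> (u n))) \<le> ennreal ((C * N ^ 4) powr (1 / 4))"
        unfolding lp_tau_def Lp using C by (intro ennpowr_mono) auto
      also have "(C * N ^ 4) powr (1 / 4) = C powr (1 / 4) * N"
      proof (cases "N = 0")
        case False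
        then have "(N ^ 4) powr (1 / 4) = N" using N(1) by (simp add: powr_powr flip: powr_numeral)
        then show ?thesis using C N(1) by (simp add: powr_mult)
      qed simp
      finally show "lp_tau \<tau> 4 (\<lambda>n. Lp_torus 4 (Pi_tau \<tau> (u n))) \<le> ennreal (C powr (1 / 4)) * bourgain_norm \<tau> s b u"
        using N by (simp add: ennreal_mult')
    qed
  qed
qed

section \<open>The trilinear estimates\<close>

text \<open>Since only finitely many frequencies occur, the supremum over the torus inherits square summability in time from
  the coefficients. The bounds depend on \<open>\<tau>\<close>; they only serve the qualitative summability below.\<close>
lemma wave_packet_sup_bound:
  assumes \<tau>: "\<tau> > 0" and b: "b \<ge> 0" and V: "wave_packet \<tau> b K A V"
  shows "\<exists>\<sigma> S. (\<forall>n x. norm (V n x) \<le> \<sigma> n) \<and> (\<forall>n. \<sigma> n \<le> S) \<and> (\<lambda>n. (\<sigma> n)\<^sup>2) summable_on UNIV"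
proof -
  from V obtain a where fin: "finite K" and a: "\<And>k. k \<in> K \<Longrightarrow> modulated \<tau> b k (a k) (A k)"
    and "V = (\<lambda>n. trig K (\<lambda>k. a k n)) \<or> V = (\<lambda>n x. cnj (trig K (\<lambda>k. a k n) x))"
    unfolding wave_packet_def by blast
  from this(3) have V: "norm (V n x) = norm (trig K (\<lambda>k. a k n) x)" for n x by auto
  define \<sigma> where "\<sigma> n = (\<Sum>k\<in>K. norm (a k n))" for n
  have sum: "(\<lambda>n. \<Sum>k\<in>K'. (norm (a k n))\<^sup>2) summable_on UNIV" if "K' \<subseteq> K" for K'
    using finite_subset[OF that fin] that
  proof (induction K' rule: finite_induct)
    case (insert k K')
    then show ?case using modulated_square_summable[OF \<tau> b a[of k]] by (simp add: summable_on_add)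
  qed simp
  have sq: "(\<lambda>n. (\<sigma> n)\<^sup>2) summable_on UNIV"
  proof (rule summable_on_comparison_test)
    show "(\<lambda>n. real (card K) * (\<Sum>k\<in>K. (norm (a k n))\<^sup>2)) summable_on UNIV"
      by (intro summable_on_cmult_right sum order_refl)
    show "(\<sigma> n)\<^sup>2 \<le> real (card K) * (\<Sum>k\<in>K. (norm (a k n))\<^sup>2)" for n
      unfolding \<sigma>_def using sum_squared_le_sum_of_squares[of "\<lambda>k. norm (a k n)" K] by (simp add: mult.commute)
  qed auto
  show ?thesis
  proof (intro exI conjI allI)
    show "norm (V n x) \<le> \<sigma> n" for n x
      unfolding V trig_def \<sigma>_def by (rule order_trans[OF norm_sum]) (simp add: norm_mult)
    show "(\<lambda>n. (\<sigma> n)\<^sup>2) summable_on UNIV" by (rule sq)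
    show "\<sigma> n \<le> sqrt (\<Sum>\<^sub>\<infinity>n. (\<sigma> n)\<^sup>2)" for n
      using finite_sum_le_infsum[OF sq, of "{n}"] by (intro real_le_rsqrt) auto
  qed
qed

lemma norm_torus_integral_le:
  fixes f :: "real \<times> real \<Rightarrow> complex"
  assumes f: "continuous_on UNIV f" and B: "\<And>x. norm (f x) \<le> B"
  shows "norm (torus_integral f) \<le> (2 * pi)\<^sup>2 * B"
proof -
  have "norm (torus_integral f) \<le> torus_integral (\<lambda>x. norm (f x))"
    by (rule set_integral_norm_bound[OF torus_integrable[OF f]])
  also have "\<dots> \<le> torus_integral (\<lambda>x. (norm (trig {0} (\<lambda>k. of_real (sqrt B)) x))\<^sup>2)"
    using B order_trans[OF norm_ge_zero B] f
    by (intro set_integral_mono torus_integrable continuous_intros) (auto simp: trig_def)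
  also have "\<dots> = (2 * pi)\<^sup>2 * B"
    using order_trans[OF norm_ge_zero B] by (subst torus_integral_norm_trig) auto
  finally show ?thesis .
qed

lemma fourier_coeff_Pi_tau:
  assumes "\<tau> > 0"
  shows "fourier_coeff (Pi_tau \<tau> f) k = (if k \<in> Pi_freqs \<tau> then fourier_coeff f k else 0)"
proof -
  have "Pi_tau \<tau> f x * mode (- k) x = (\<Sum>l\<in>Pi_freqs \<tau>. fourier_coeff f l / of_real ((2 * pi)\<^sup>2) * mode (l - k) x)" for x
  proof -
    have "mode (l - k) x = mode l x * mode (- k) x" for l by (simp add: mode_mult)
    then show ?thesis by (simp add: Pi_tau_trig trig_def sum_distrib_left sum_distrib_right sum_divide_distrib mult_ac)
  qed
  then have "fourier_coeff (Pi_tau \<tau> f) k = (\<Sum>l\<in>Pi_freqs \<tau>. torus_integral (\<lambda>x. fourier_coeff f l / of_real ((2 * pi)\<^sup>2) * mode (l - k) x))"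
    unfolding fourier_coeff_mode[of "Pi_tau \<tau> f"] by (simp only:) (intro torus_integral_sum continuous_intros)
  also have "\<dots> = (\<Sum>l\<in>Pi_freqs \<tau>. if l = k then fourier_coeff f k else 0)"
    by (intro sum.cong refl) (auto simp: torus_integral_mode)
  finally show ?thesis using finite_Pi_freqs[OF assms] by simp
qed

text \<open>Duality. If \<open>g k\<close> is the transform of the trilinear expression, its squared norm \<open>\<Sum> x k\<close> is the pairing
  of \<open>g\<close> with \<open>h = \<beta>\<^sup>2 m\<^sup>2 g\<close>, where \<open>\<beta>\<close> and \<open>m\<close> are the weights in \<open>k\<close> and in the
  modulation. In the dual space \<open>h\<close> has the same squared norm, and the pairing is a limit of quadrilinear forms. So
  the squared norm \<open>xx\<close> satisfies \<open>xx \<le> R * sqrt xx\<close>. Working with finitely many frequencies at a time keeps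
  it finite, so that \<open>sqrt xx\<close> can be divided out.\<close>
lemma trilinear_estimate:
  fixes b \<gamma> \<delta> B s1 s2 s3 s4 :: real
  assumes b: "b > 3 / 8" and \<gamma>: "\<gamma> > 3 / 4" and \<delta>: "\<delta> > 0" and adm: "admissible \<gamma> \<delta> B s1 s2 s3 s4"
  obtains C where "C > 0"
    and "\<And>\<tau> u1 u2 u3 v1 v2 v3. \<lbrakk>0 < \<tau>; \<tau> \<le> 1; v1 = u1 \<or> v1 = conj_seq u1; v2 = u2 \<or> v2 = conj_seq u2; v3 = u3 \<or> v3 = conj_seq u3;
        bourgain_norm \<tau> s1 b u1 < \<infinity>; bourgain_norm \<tau> s2 b u2 < \<infinity>; bourgain_norm \<tau> s3 b u3 < \<infinity>\<rbrakk> \<Longrightarrow>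
      bourgain_norm \<tau> (- s4) (- b) (trilinear \<tau> v1 v2 v3)
        \<le> ennreal C * bourgain_norm \<tau> s1 b u1 * bourgain_norm \<tau> s2 b u2 * bourgain_norm \<tau> s3 b u3"
proof -
  show ?thesis
  proof (cases rule: quadrilinear_estimate[OF b \<gamma> \<delta> adm])
  case (1 C)
    note C = 1(1) and quad = 1(2)
    show ?thesis
    proof
      show "C > 0" by (rule C)
      fix \<tau> :: real and u1 u2 u3 v1 v2 v3
      assume \<tau>: "0 < \<tau>" "\<tau> \<le> 1" and v1: "v1 = u1 \<or> v1 = conj_seq u1" and v2: "v2 = u2 \<or> v2 = conj_seq u2"
        and v3: "v3 = u3 \<or> v3 = conj_seq u3"
        and fin: "bourgain_norm \<tau> s1 b u1 < \<infinity>" "bourgain_norm \<tau> s2 b u2 < \<infinity>" "bourgain_norm \<tau> s3 b u3 < \<infinity>"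
      obtain A1 N1 where N1: "0 \<le> N1" "bourgain_norm \<tau> s1 b u1 = ennreal N1"
        and mod1: "\<And>k. modulated \<tau> b k (\<lambda>n. fourier_coeff (u1 n) k) (A1 k)"
        and A1: "\<And>K. finite K \<Longrightarrow> sobolev_sum s1 K A1 \<le> N1\<^sup>2"
        using bourgain_norm_finite[OF \<tau>(1) fin(1)] by blast
      obtain A2 N2 where N2: "0 \<le> N2" "bourgain_norm \<tau> s2 b u2 = ennreal N2"
        and mod2: "\<And>k. modulated \<tau> b k (\<lambda>n. fourier_coeff (u2 n) k) (A2 k)"
        and A2: "\<And>K. finite K \<Longrightarrow> sobolev_sum s2 K A2 \<le> N2\<^sup>2"
        using bourgain_norm_finite[OF \<tau>(1) fin(2)] by blast
      obtain A3 N3 where N3: "0 \<le> N3" "bourgain_norm \<tau> s3 b u3 = ennreal N3"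
        and mod3: "\<And>k. modulated \<tau> b k (\<lambda>n. fourier_coeff (u3 n) k) (A3 k)"
        and A3: "\<And>K. finite K \<Longrightarrow> sobolev_sum s3 K A3 \<le> N3\<^sup>2"
        using bourgain_norm_finite[OF \<tau>(1) fin(3)] by blast
      define c where "c = complex_of_real ((2 * pi)\<^sup>2)"
      obtain K1 V1 where V1: "wave_packet \<tau> b K1 A1 V1" and Pi1: "\<And>n x. Pi_tau \<tau> (v1 n) x = V1 n x / c"
        using Pi_tau_wave_packet[OF \<tau>(1) mod1 v1] unfolding c_def by blast
      obtain K2 V2 where V2: "wave_packet \<tau> b K2 A2 V2" and Pi2: "\<And>n x. Pi_tau \<tau> (v2 n) x = V2 n x / c"
        using Pi_tau_wave_packet[OF \<tau>(1) mod2 v2] unfolding c_def by blast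
      obtain K3 V3 where V3: "wave_packet \<tau> b K3 A3 V3" and Pi3: "\<And>n x. Pi_tau \<tau> (v3 n) x = V3 n x / c"
        using Pi_tau_wave_packet[OF \<tau>(1) mod3 v3] unfolding c_def by blast
      note cV [continuous_intros] = wave_packet_continuous[OF V1] wave_packet_continuous[OF V2] wave_packet_continuous[OF V3]
      define F where "F n x = V1 n x * V2 n x * V3 n x / c ^ 3" for n x
      have c0: "c \<noteq> 0" by (simp add: c_def)
      have cF: "continuous_on UNIV (F n)" for n
        unfolding F_def using c0 by (intro continuous_intros) auto
      define T where "T = trilinear \<tau> v1 v2 v3"
      have T: "T n = Pi_tau \<tau> (F n)" for n
        unfolding T_def trilinear_def F_def Pi1 Pi2 Pi3 by (simp add: power3_eq_cube mult.assoc)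
      have T_hat: "fourier_coeff (T n) k = (if k \<in> Pi_freqs \<tau> then fourier_coeff (F n) k else 0)" for n k
        unfolding T by (rule fourier_coeff_Pi_tau[OF \<tau>(1)])
      have summ: "(\<lambda>n. norm (fourier_coeff (T n) k)) summable_on UNIV" for k
      proof -
        have b0: "b \<ge> 0" using b by simp
        obtain \<sigma>1 S1 where 1: "\<And>n x. norm (V1 n x) \<le> \<sigma>1 n" "(\<lambda>n. (\<sigma>1 n)\<^sup>2) summable_on UNIV"
          using wave_packet_sup_bound[OF \<tau>(1) b0 V1] by blast
        obtain \<sigma>2 S2 where 2: "\<And>n x. norm (V2 n x) \<le> \<sigma>2 n" "(\<lambda>n. (\<sigma>2 n)\<^sup>2) summable_on UNIV"
          using wave_packet_sup_bound[OF \<tau>(1) b0 V2] by blast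
        obtain \<sigma>3 S3 where 3: "\<And>n x. norm (V3 n x) \<le> \<sigma>3 n" "\<And>n. \<sigma>3 n \<le> S3"
          using wave_packet_sup_bound[OF \<tau>(1) b0 V3] by blast
        have pos: "0 \<le> \<sigma>1 n" "0 \<le> \<sigma>2 n" "0 \<le> \<sigma>3 n" "0 \<le> S3" for n
          using order_trans[OF norm_ge_zero 1(1)] order_trans[OF norm_ge_zero 2(1)] order_trans[OF norm_ge_zero 3(1)]
            order_trans[OF order_trans[OF norm_ge_zero 3(1)] 3(2)] by auto
        define D where "D = (2 * pi)\<^sup>2 * (S3 / norm (c ^ 3))"
        have D0: "D \<ge> 0" using pos by (simp add: D_def)
        show ?thesis
        proof (rule summable_on_comparison_test)
          show "(\<lambda>n. D * ((\<sigma>1 n)\<^sup>2 + (\<sigma>2 n)\<^sup>2)) summable_on UNIV"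
            by (intro summable_on_cmult_right summable_on_add 1 2)
          fix n
          have FB: "norm (F n x * mode (- k) x) \<le> \<sigma>1 n * \<sigma>2 n * S3 / norm (c ^ 3)" for x
          proof -
            have "norm (V1 n x) * norm (V2 n x) * norm (V3 n x) \<le> \<sigma>1 n * \<sigma>2 n * S3"
              using 1(1) 2(1) order_trans[OF 3(1) 3(2)] pos by (intro mult_mono) auto
            then show ?thesis by (simp add: F_def norm_mult norm_divide divide_right_mono)
          qed
          have "norm (fourier_coeff (T n) k) \<le> norm (fourier_coeff (F n) k)" by (simp add: T_hat)
          also have "\<dots> \<le> (2 * pi)\<^sup>2 * (\<sigma>1 n * \<sigma>2 n * S3 / norm (c ^ 3))"
            unfolding fourier_coeff_mode by (intro norm_torus_integral_le continuous_intros cF FB)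
          also have "\<dots> = D * (\<sigma>1 n * \<sigma>2 n)" by (simp add: D_def mult_ac)
          also have "\<dots> \<le> D * ((\<sigma>1 n)\<^sup>2 + (\<sigma>2 n)\<^sup>2)"
          proof (intro mult_left_mono D0)
            have "2 * (\<sigma>1 n * \<sigma>2 n) \<le> (\<sigma>1 n)\<^sup>2 + (\<sigma>2 n)\<^sup>2"
              using zero_le_power2[of "\<sigma>1 n - \<sigma>2 n"] by (simp add: power2_eq_square algebra_simps)
            moreover have "0 \<le> \<sigma>1 n * \<sigma>2 n" using pos by simp
            ultimately show "\<sigma>1 n * \<sigma>2 n \<le> (\<sigma>1 n)\<^sup>2 + (\<sigma>2 n)\<^sup>2" by argo
          qed
          finally show "norm (fourier_coeff (T n) k) \<le> D * ((\<sigma>1 n)\<^sup>2 + (\<sigma>2 n)\<^sup>2)" .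
        qed auto
      qed
      have ex: "\<exists>g. has_time_transform \<tau> T k g" for k
        by (rule has_time_transform_of_summable[OF \<tau>(1) summ])
      define g where "g k = time_transform \<tau> T k" for k
      have g: "has_time_transform \<tau> T k (g k)" for k
        unfolding g_def time_transform_def by (intro someI_ex[of "has_time_transform \<tau> T k"] ex)
      have gm [measurable]: "g k \<in> borel_measurable borel" for k using g[of k] by (simp add: has_time_transform_wave)
      define P where "P = period_cell \<tau>"
      have [measurable]: "P \<in> sets borel" by (simp add: P_def)
      have g2: "cell_L2 P (g k) < \<infinity>" for k
        unfolding P_def by (rule has_time_transform_square_integrable[OF \<tau>(1) g])
      define \<beta> where "\<beta> k = kbr k powr - s4" for k
      define m where "m k s = modulation \<tau> k s powr - b" for k s
      have [measurable]: "m k \<in> borel_measurable borel" for k unfolding m_def by measurable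
      have \<beta>0: "\<beta> k > 0" for k using jbracket_pos[of "freq k"] by (simp add: \<beta>_def)
      have m0: "m k s > 0" for k s using jbracket_pos[of "d_tau \<tau> (s + kbr k)"] by (simp add: m_def)
      have m1: "m k s \<le> 1" for k s
        using powr_mono[of "- b" 0 "modulation \<tau> k s"] jbracket_ge_1[of "d_tau \<tau> (s + kbr k)"] b
        by (simp add: m_def)
      define X where "X k = (\<integral>\<^sup>+s\<in>P. ennreal ((\<beta> k * m k s * norm (g k s))\<^sup>2) \<partial>lborel)" for k
      have X_fin: "X k < \<infinity>" for k
      proof -
        have "X k \<le> (\<integral>\<^sup>+s. ennreal ((\<beta> k)\<^sup>2) * (ennreal ((norm (g k s))\<^sup>2) * indicator P s) \<partial>lborel)"
          unfolding X_def
        proof (rule nn_integral_mono)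
          fix s
          have "(m k s)\<^sup>2 \<le> 1" using m0[of k s] m1[of k s] by (simp add: power_le_one)
          then have "(\<beta> k * m k s * norm (g k s))\<^sup>2 \<le> (\<beta> k)\<^sup>2 * (norm (g k s))\<^sup>2"
            by (simp add: power_mult_distrib mult_right_mono mult_left_le)
          then show "ennreal ((\<beta> k * m k s * norm (g k s))\<^sup>2) * indicator P s \<le> ennreal ((\<beta> k)\<^sup>2) * (ennreal ((norm (g k s))\<^sup>2) * indicator P s)"
            by (auto simp: indicator_def ennreal_mult[symmetric] intro: ennreal_leI)
        qed
        also have "\<dots> = ennreal ((\<beta> k)\<^sup>2) * cell_L2 P (g k)"
          by (simp add: nn_integral_cmult)
        also have "\<dots> < \<infinity>" using g2[of k] by (simp add: ennreal_mult_less_top)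
        finally show ?thesis .
      qed
      define x where "x k = enn2real (X k)" for k
      have X: "X k = ennreal (x k)" for k using X_fin[of k] by (simp add: x_def less_top)
      have x0: "x k \<ge> 0" for k by (simp add: x_def)
      \<comment> \<open>The test function, with energy \<open>A4 k\<close> and dual norm contribution \<open>x k\<close>.\<close>
      define h where "h k s = of_real ((\<beta> k)\<^sup>2 * (m k s)\<^sup>2) * g k s" for k s
      have [measurable]: "h k \<in> borel_measurable borel" for k unfolding h_def by measurable
      define A4 where "A4 k = (\<beta> k)\<^sup>2 * x k" for k
      have mod4: "modulated \<tau> b k (time_coeff \<tau> (h k)) (A4 k)" for k
        unfolding modulated_def
      proof (intro conjI exI)
        show "0 \<le> A4 k" using x0 by (simp add: A4_def)
        have "modulation_energy \<tau> b k (h k)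
           = (\<integral>\<^sup>+s. ennreal ((\<beta> k)\<^sup>2) * (ennreal ((\<beta> k * m k s * norm (g k s))\<^sup>2) * indicator P s) \<partial>lborel)"
        proof (rule nn_integral_cong)
          fix s
          have md: "modulation \<tau> k s powr (2 * b) = 1 / (m k s)\<^sup>2"
            unfolding m_def by (simp add: power2_eq_square powr_add[symmetric] powr_minus_divide)
          have "modulation \<tau> k s powr (2 * b) * (norm (h k s))\<^sup>2 = (\<beta> k)\<^sup>2 * (\<beta> k * m k s * norm (g k s))\<^sup>2"
            unfolding md h_def norm_mult norm_of_real using m0[of k s] by (simp add: power2_eq_square)
          then show "ennreal (modulation \<tau> k s powr (2 * b) * (norm (h k s))\<^sup>2) * indicator (period_cell \<tau>) s
            = ennreal ((\<beta> k)\<^sup>2) * (ennreal ((\<beta> k * m k s * norm (g k s))\<^sup>2) * indicator P s)"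
            by (simp add: P_def ennreal_mult mult.assoc)
        qed
        also have "\<dots> = ennreal ((\<beta> k)\<^sup>2) * X k" by (simp add: nn_integral_cmult X_def)
        also have "\<dots> = ennreal (A4 k)" by (simp add: X A4_def ennreal_mult x0)
        finally show "modulation_energy \<tau> b k (h k) \<le> ennreal (A4 k)"
          by simp
      qed measurable
      have h2: "cell_L2 P (\<lambda>s. cnj (h k s)) < \<infinity>" for k
      proof -
        have "cell_L2 P (\<lambda>s. cnj (h k s)) \<le> (\<integral>\<^sup>+s. ennreal ((\<beta> k)\<^sup>2) * (ennreal ((\<beta> k * m k s * norm (g k s))\<^sup>2) * indicator P s) \<partial>lborel)"
        proof (rule nn_integral_mono)
          fix s
          have "(m k s)\<^sup>2 \<le> 1" using m0[of k s] m1[of k s] by (simp add: power_le_one)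
          then have "(m k s)\<^sup>2 * ((\<beta> k)\<^sup>2 * (\<beta> k * m k s * norm (g k s))\<^sup>2) \<le> 1 * ((\<beta> k)\<^sup>2 * (\<beta> k * m k s * norm (g k s))\<^sup>2)"
            by (intro mult_right_mono) auto
          moreover have "(norm (cnj (h k s)))\<^sup>2 = (m k s)\<^sup>2 * ((\<beta> k)\<^sup>2 * (\<beta> k * m k s * norm (g k s))\<^sup>2)"
            unfolding h_def complex_mod_cnj norm_mult norm_of_real by (simp add: power2_eq_square)
          ultimately have "(norm (cnj (h k s)))\<^sup>2 \<le> (\<beta> k)\<^sup>2 * (\<beta> k * m k s * norm (g k s))\<^sup>2" by simp
          then show "ennreal ((norm (cnj (h k s)))\<^sup>2) * indicator P s \<le> ennreal ((\<beta> k)\<^sup>2) * (ennreal ((\<beta> k * m k s * norm (g k s))\<^sup>2) * indicator P s)"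
            by (auto simp: indicator_def ennreal_mult[symmetric] intro: ennreal_leI)
        qed
        also have "\<dots> = ennreal ((\<beta> k)\<^sup>2) * X k" by (simp add: nn_integral_cmult X_def)
        also have "\<dots> < \<infinity>" by (simp add: X ennreal_mult_less_top)
        finally show ?thesis .
      qed
      have gh: "set_lebesgue_integral lborel P (\<lambda>s. g k s * cnj (h k s)) = of_real (x k)" for k
      proof -
        have "g k s * cnj (h k s) = of_real ((\<beta> k * m k s * norm (g k s))\<^sup>2)" for s
        proof -
          have "g k s * cnj (h k s) = of_real ((\<beta> k)\<^sup>2 * (m k s)\<^sup>2) * (g k s * cnj (g k s))"
            by (simp add: h_def)
          also have "\<dots> = of_real ((\<beta> k)\<^sup>2 * (m k s)\<^sup>2) * of_real ((norm (g k s))\<^sup>2)"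
            by (simp only: complex_norm_square)
          finally show ?thesis by (simp add: power_mult_distrib)
        qed
        then have "set_lebesgue_integral lborel P (\<lambda>s. g k s * cnj (h k s))
          = of_real (set_lebesgue_integral lborel P (\<lambda>s. (\<beta> k * m k s * norm (g k s))\<^sup>2))"
          by (simp only: set_integral_complex_of_real)
        also have "set_lebesgue_integral lborel P (\<lambda>s. (\<beta> k * m k s * norm (g k s))\<^sup>2) = x k"
        proof -
          have "set_lebesgue_integral lborel P (\<lambda>s. (\<beta> k * m k s * norm (g k s))\<^sup>2)
            = enn2real (\<integral>\<^sup>+s. ennreal (indicator P s *\<^sub>R (\<beta> k * m k s * norm (g k s))\<^sup>2) \<partial>lborel)"
            unfolding set_lebesgue_integral_def by (rule integral_eq_nn_integral) auto
          also have "(\<integral>\<^sup>+s. ennreal (indicator P s *\<^sub>R (\<beta> k * m k s * norm (g k s))\<^sup>2) \<partial>lborel) = X k"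
            unfolding X_def by (intro nn_integral_cong) (auto simp: indicator_def)
          finally show ?thesis by (simp add: x_def)
        qed
        finally show ?thesis .
      qed
      define a4 where "a4 k n = time_coeff \<tau> (h k) n" for k n
      have cnj_int: "set_lebesgue_integral lborel P (\<lambda>s. cnj (h k s) * wave \<tau> (- n) s) = of_real (2 * pi) * cnj (a4 k n)" for k n
      proof -
        have "set_lebesgue_integral lborel P (\<lambda>s. cnj (h k s) * wave \<tau> (- n) s) = cnj (set_lebesgue_integral lborel P (\<lambda>s. h k s * wave \<tau> n s))"
          unfolding set_lebesgue_integral_def
          by (subst Bochner_Integration.integral_cnj[symmetric]) (simp add: complex_cnj_scaleR cnj_wave del: Bochner_Integration.integral_cnj)
        then show ?thesis by (simp add: a4_def time_coeff_def P_def)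
      qed
      have lim: "((\<lambda>M. \<Sum>n\<in>M. (of_real \<tau> * fourier_coeff (T n) k) * (of_real (2 * pi) * cnj (a4 k n))) \<longlongrightarrow> of_real (x k)) (finite_subsets_at_top UNIV)" for k
      proof -
        have "cnj \<in> borel_measurable borel"
          by (intro borel_measurable_continuous_onI continuous_on_cnj continuous_on_id)
        then have "(\<lambda>s. cnj (h k s)) \<in> borel_measurable borel" by measurable
        from time_transform_pairing[OF \<tau>(1) g[of k] this h2[unfolded P_def]]
        show ?thesis unfolding P_def[symmetric] cnj_int gh .
      qed
      define R where "R = C * (N1 * N2 * N3)"
      have R0: "R \<ge> 0" using C N1 N2 N3 by (simp add: R_def)
      have main: "(\<Sum>k\<in>K. x k) \<le> R\<^sup>2" if K: "finite K" for K
      proof -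
        define xx where "xx = (\<Sum>k\<in>K. x k)"
        have xx0: "xx \<ge> 0" by (simp add: xx_def sum_nonneg x0)
        define K4 where "K4 = K \<inter> Pi_freqs \<tau>"
        define W where "W n = trig K4 (\<lambda>k. a4 k n)" for n
        have W: "wave_packet \<tau> b K4 A4 W"
          unfolding wave_packet_def W_def[abs_def] K4_def a4_def
          by (intro conjI exI[of _ "\<lambda>k. time_coeff \<tau> (h k)"])
            (use K Pi_freqs_subset[OF \<tau>(1)] mod4 in auto)
        have S4: "sobolev_sum s4 K4 A4 \<le> xx"
        proof -
          have "kbr k powr (2 * s4) * A4 k = x k" for k
            using jbracket_pos[of "freq k"]
            by (simp add: A4_def \<beta>_def power2_eq_square powr_add[symmetric] mult.assoc[symmetric])
          then show ?thesis unfolding xx_def K4_def using K x0 by (simp add: sum_mono2)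
        qed
        have bound: "norm (\<Sum>k\<in>K. \<Sum>n\<in>M. (of_real \<tau> * fourier_coeff (T n) k) * (of_real (2 * pi) * cnj (a4 k n))) \<le> R * sqrt xx"
          if M: "finite M" for M
        proof -
          define Q where "Q = quad_form \<tau> M V1 V2 V3 (\<lambda>n x. cnj (W n x))"
          have "(\<Sum>k\<in>K. \<Sum>n\<in>M. (of_real \<tau> * fourier_coeff (T n) k) * (of_real (2 * pi) * cnj (a4 k n)))
            = (\<Sum>k\<in>K4. \<Sum>n\<in>M. (of_real \<tau> * fourier_coeff (F n) k) * (of_real (2 * pi) * cnj (a4 k n)))"
            unfolding K4_def by (rule sum.mono_neutral_cong_right) (use K in \<open>auto simp: T_hat\<close>)
          also have "\<dots> = of_real (2 * pi) * (of_real \<tau> * (\<Sum>n\<in>M. \<Sum>k\<in>K4. cnj (a4 k n) * fourier_coeff (F n) k))"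
            by (subst sum.swap) (simp add: sum_distrib_left mult_ac)
          also have "(\<Sum>n\<in>M. \<Sum>k\<in>K4. cnj (a4 k n) * fourier_coeff (F n) k)
            = (\<Sum>n\<in>M. torus_integral (\<lambda>x. V1 n x * V2 n x * (V3 n x * cnj (W n x))) / c ^ 3)"
          proof (rule sum.cong[OF refl])
            fix n
            have "(\<Sum>k\<in>K4. cnj (a4 k n) * fourier_coeff (F n) k) = (\<Sum>k\<in>K4. torus_integral (\<lambda>x. cnj (a4 k n) * (F n x * mode (- k) x)))"
              by (simp add: fourier_coeff_mode)
            also have "\<dots> = torus_integral (\<lambda>x. \<Sum>k\<in>K4. cnj (a4 k n) * (F n x * mode (- k) x))"
              by (intro torus_integral_sum[symmetric] continuous_intros cF)
            also have "(\<lambda>x. \<Sum>k\<in>K4. cnj (a4 k n) * (F n x * mode (- k) x)) = (\<lambda>x. V1 n x * V2 n x * (V3 n x * cnj (W n x)) / c ^ 3)"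
              by (rule ext) (simp add: W_def trig_def F_def cnj_mode sum_distrib_left sum_divide_distrib mult_ac)
            finally show "(\<Sum>k\<in>K4. cnj (a4 k n) * fourier_coeff (F n) k) = torus_integral (\<lambda>x. V1 n x * V2 n x * (V3 n x * cnj (W n x))) / c ^ 3"
              by simp
          qed
          also have "of_real (2 * pi) * (of_real \<tau> * (\<Sum>n\<in>M. torus_integral (\<lambda>x. V1 n x * V2 n x * (V3 n x * cnj (W n x))) / c ^ 3))
            = of_real (2 * pi) / c ^ 3 * Q"
            by (simp add: Q_def sum_divide_distrib[symmetric])
          also have "norm \<dots> \<le> 1 * norm Q"
            unfolding norm_mult
          proof (intro mult_right_mono norm_ge_zero)
            have p1: "1 \<le> 2 * pi" using pi_gt3 by simp
            have "norm (of_real (2 * pi) / c ^ 3) = 2 * pi / (2 * pi) ^ 6"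
              by (simp add: c_def norm_divide norm_power norm_mult flip: power_mult)
            also have "\<dots> = 1 / (2 * pi) ^ 5" by (simp add: eval_nat_numeral)
            also have "\<dots> \<le> 1" using one_le_power[OF p1, of 5] by (subst divide_le_eq_1_pos) auto
            finally show "norm (of_real (2 * pi) / c ^ 3) \<le> 1" .
          qed
          also have "1 * norm Q \<le> C * (sqrt (N1\<^sup>2) * sqrt (N2\<^sup>2) * sqrt (N3\<^sup>2) * sqrt xx)"
            unfolding Q_def mult_1
            by (rule quad[OF \<tau> M V1 V2 V3 wave_packet_cnj[OF W] A1[OF wave_packet_finite[OF V1]]
                  A2[OF wave_packet_finite[OF V2]] A3[OF wave_packet_finite[OF V3]] S4])
          also have "\<dots> = R * sqrt xx" using N1 N2 N3 by (simp add: R_def)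
          finally show ?thesis .
        qed
        have "((\<lambda>M. \<Sum>k\<in>K. \<Sum>n\<in>M. (of_real \<tau> * fourier_coeff (T n) k) * (of_real (2 * pi) * cnj (a4 k n))) \<longlongrightarrow> (\<Sum>k\<in>K. of_real (x k))) (finite_subsets_at_top UNIV)"
          by (intro tendsto_sum lim)
        then have "((\<lambda>M. norm (\<Sum>k\<in>K. \<Sum>n\<in>M. (of_real \<tau> * fourier_coeff (T n) k) * (of_real (2 * pi) * cnj (a4 k n)))) \<longlongrightarrow> norm (complex_of_real xx)) (finite_subsets_at_top UNIV)"
          unfolding xx_def of_real_sum by (rule tendsto_norm)
        moreover have "\<forall>\<^sub>F M in finite_subsets_at_top UNIV. norm (\<Sum>k\<in>K. \<Sum>n\<in>M. (of_real \<tau> * fourier_coeff (T n) k) * (of_real (2 * pi) * cnj (a4 k n))) \<le> R * sqrt xx"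
        proof -
          have "\<forall>\<^sub>F M in finite_subsets_at_top (UNIV :: int set). finite M"
            unfolding eventually_finite_subsets_at_top by auto
          then show ?thesis by eventually_elim (rule bound)
        qed
        ultimately have "norm (complex_of_real xx) \<le> R * sqrt xx"
          by (rule tendsto_upperbound) simp
        then have le: "sqrt xx * sqrt xx \<le> R * sqrt xx" using xx0 by simp
        have "sqrt xx \<le> R"
        proof (cases "sqrt xx = 0")
          case False
          then have "0 < sqrt xx" using xx0 by simp
          with le show ?thesis by (rule mult_right_le_imp_le)
        qed (use R0 in simp)
        then have "(sqrt xx)\<^sup>2 \<le> R\<^sup>2" using xx0 by (intro power_mono) auto
        then show ?thesis using xx0 by (simp add: xx_def)
      qed
      have "(\<integral>\<^sup>+k. X k \<partial>count_space UNIV) \<le> ennreal (R\<^sup>2)"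
      proof (rule nn_integral_count_space_le)
        fix K :: "(int \<times> int) set" assume K: "finite K"
        have "(\<Sum>k\<in>K. X k) = ennreal (\<Sum>k\<in>K. x k)" unfolding X by (intro sum_ennreal x0)
        then show "(\<Sum>k\<in>K. X k) \<le> ennreal (R\<^sup>2)" using main[OF K] by (simp add: ennreal_leI)
      qed
      then have "ennpowr (\<integral>\<^sup>+k. X k \<partial>count_space UNIV) (1 / 2) \<le> ennreal ((R\<^sup>2) powr (1 / 2))"
        by (intro ennpowr_mono) auto
      also have "(R\<^sup>2) powr (1 / 2) = R" using R0 by (simp add: powr_half_sqrt)
      also have "ennpowr (\<integral>\<^sup>+k. X k \<partial>count_space UNIV) (1 / 2) = bourgain_norm \<tau> (- s4) (- b) T"
        unfolding bourgain_norm_def X_def P_def \<beta>_def m_def g_def using ex by simp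
      finally show "bourgain_norm \<tau> (- s4) (- b) (trilinear \<tau> v1 v2 v3)
          \<le> ennreal C * bourgain_norm \<tau> s1 b u1 * bourgain_norm \<tau> s2 b u2 * bourgain_norm \<tau> s3 b u3"
        unfolding T_def N1(2) N2(2) N3(2) R_def using C N1(1) N2(1) N3(1) by (simp add: ennreal_mult mult.assoc)
    qed
  qed
qed

theorem theorem4p6:
  fixes s s' b :: real
  assumes "s > 11 / 40" and "s' > 3 / 8" and "b > 3 / 8"
  shows "\<exists>C::real. C > 0 \<and> (\<forall>\<tau>::real. 0 < \<tau> \<and> \<tau> \<le> 1 \<longrightarrow>
    (\<forall>u. (\<forall>n. torus_fun (u n)) \<and> bourgain_norm \<tau> s' b u < \<infinity> \<longrightarrow>
       lp_tau \<tau> 4 (\<lambda>n. Lp_torus 4 (Pi_tau \<tau> (u n))) \<le> ennreal C * bourgain_norm \<tau> s' b u) \<and>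
    (\<forall>u1 u2 u3 v1 v2 v3.
       (\<forall>n. torus_fun (u1 n) \<and> torus_fun (u2 n) \<and> torus_fun (u3 n)) \<and>
       (v1 = u1 \<or> v1 = conj_seq u1) \<and>
       (v2 = u2 \<or> v2 = conj_seq u2) \<and>
       (v3 = u3 \<or> v3 = conj_seq u3) \<longrightarrow>
       (bourgain_norm \<tau> s b u1 < \<infinity> \<and> bourgain_norm \<tau> s b u2 < \<infinity> \<and>
        bourgain_norm \<tau> s b u3 < \<infinity> \<longrightarrow>
          bourgain_norm \<tau> (s - 1) (- b) (trilinear \<tau> v1 v2 v3)
            \<le> ennreal C * bourgain_norm \<tau> s b u1 * bourgain_norm \<tau> s b u2
                * bourgain_norm \<tau> s b u3) \<and>
       (bourgain_norm \<tau> (11 / 40) b u1 < \<infinity> \<and> bourgain_norm \<tau> s b u2 < \<infinity> \<and>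
        bourgain_norm \<tau> s b u3 < \<infinity> \<longrightarrow>
          bourgain_norm \<tau> (- (29 / 40)) (- b) (trilinear \<tau> v1 v2 v3)
            \<le> ennreal C * bourgain_norm \<tau> (11 / 40) b u1 * bourgain_norm \<tau> s b u2
                * bourgain_norm \<tau> s b u3)))"
proof -
  show ?thesis
  proof (cases rule: discrete_strichartz[OF assms(2,3)])
  case (1 C1)
    note C1 = 1(1) and est1 = 1(2)
    have num: "301 / 400 > (3 / 4 :: real)" "1 / 400 > (0 :: real)" by simp_all
    define e where "e = s - 11 / 40"
    have e: "e > 0" using assms(1) by (simp add: e_def)
    \<comment> \<open>The dual exponent \<open>1 - s\<close> falls short of \<open>29/40\<close> by \<open>e\<close>, but each of the others exceeds \<open>11/40\<close> by
      \<open>e\<close>, and the fourth size exceeds the largest of the others by at most three dyadic steps.\<close>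
    have adm2: "admissible (301 / 400) (1 / 400) (3 * e) s s s (1 - s)"
    proof (rule admissible_trilinear)
      fix i j k l :: nat assume l: "l \<le> max i (max j k) + 3"
      then have "real l \<le> real i + real j + real k + 3" by simp
      then have "e * (real l - (real i + real j + real k)) \<le> e * 3" using e by (intro mult_left_mono) auto
      moreover have "s * real i + s * real j + s * real k + (1 - s) * real l + 3 * e
          - (11 / 40 * (real i + real j + real k) + 29 / 40 * real l) = e * 3 - e * (real l - (real i + real j + real k))"
        by (simp add: e_def field_simps)
      ultimately show "11 / 40 * (real i + real j + real k) + 29 / 40 * real l \<le> s * real i + s * real j + s * real k + (1 - s) * real l + 3 * e"
        by argo
    qed (use assms(1) in auto)
    show ?thesis
    proof (cases rule: trilinear_estimate[OF assms(3) num adm2])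
    case (1 C2)
      note C2 = 1(1) and est2 = 1(2)
      have adm3: "admissible (301 / 400) (1 / 400) 0 (11 / 40) s s (29 / 40)"
      proof (rule admissible_trilinear)
        fix i j k l :: nat
        have "11 / 40 * real j \<le> s * real j" "11 / 40 * real k \<le> s * real k"
          by (rule mult_right_mono; use assms(1) in simp)+
        then show "11 / 40 * (real i + real j + real k) + 29 / 40 * real l \<le> 11 / 40 * real i + s * real j + s * real k + 29 / 40 * real l + 0"
          by simp
      qed (use assms(1) in auto)
      show ?thesis
      proof (cases rule: trilinear_estimate[OF assms(3) num adm3])
      case (1 C3)
        note C3 = 1(1) and est3 = 1(2)
        define C where "C = C1 + C2 + C3"
        have C: "C > 0" "C1 \<le> C" "C2 \<le> C" "C3 \<le> C" using C1 C2 C3 by (auto simp: C_def)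
        have grow1: "X \<le> ennreal C * a" if "X \<le> ennreal D * a" "D \<le> C" for X a D
          using that(1) by (rule order_trans) (intro mult_right_mono ennreal_leI that(2), simp)
        have grow3: "X \<le> ennreal C * a * a' * a''" if "X \<le> ennreal D * a * a' * a''" "D \<le> C" for X a a' a'' D
          using that(1) by (rule order_trans) (intro mult_right_mono ennreal_leI that(2), simp_all)
        show ?thesis
        proof (intro exI[of _ C] conjI allI impI, goal_cases)
          case (2 \<tau> u)
          then show ?case using grow1[OF est1 C(2)] by blast
        next
          case (3 \<tau> u1 u2 u3 v1 v2 v3)
          then show ?case using grow3[OF est2 C(3)] by simp
        next
          case (4 \<tau> u1 u2 u3 v1 v2 v3)
          then show ?case using grow3[OF est3 C(4)] by simp
        qed (rule C)
      qed
    qed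
  qed
qed

end
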